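(* Let $d\in\mathbb N$, $1\le p,q\le\infty$, $\sigma_{p,q}=\left(\frac1q-\frac1p\right)_+$, $\beta\in\mathbb R$, $\gamma>0$, $\gamma-\beta+\sigma_{p,q}<\alpha$, $\gamma+\sigma_{p,q}\le\alpha$, and let $T\in\mathbb R$, $T<1$. Let $Q=(Q_j(\cdot,\varphi_j,\widetilde\varphi_j))_{j\in\mathbb Z_+}$ be a family of quasi-interpolation operators with $\widetilde\varphi_j\in\mathcal D'(\mathbb T)$ and $\varphi_j\in\mathcal T_j^1$ for each $j\in\mathbb Z_+$. Suppose that for some $N\ge 0$ and some $s>\max(\alpha+\beta,\alpha)$ there are constants $C_{\widetilde\varphi},C_\varphi,C_{\varphi,\widetilde\varphi,s}$ such that for all $j\in\mathbb Z_+$: $$|\widehat{\widetilde\varphi_j}(\ell)|\le C_{\widetilde\varphi}(1+|2^{-j}\ell|^N)\ \text{ for all }\ell\in\mathbb Z,\qquad |\widehat{\varphi_j}(\ell)|\le C_\varphi\ \text{ for all }\ell\in\mathbb Z,$$ $$|1-\widehat{\varphi_j}(\ell)\widehat{\widetilde\varphi_j}(\ell)|\le C_{\varphi,\widetilde\varphi,s}|2^{-j}\ell|^s\ \text{ for all }\ell\in D_j.$$ Assume also that at least one of the following holds: (i) $\min(\alpha+\beta,\alpha)>N+1/p'$; or (ii) $N=0$ and $\sup_{j\in\mathbb Z_+}\|\widetilde\varphi_j\|_{\widetilde A_{q',j}(\mathbb T)}<\infty$. Then there is a constant $C$, not depending on $f$ and $n$, such that for all $f\in A_p^{\alpha,\beta}(\mathbb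 T^d)$ and all $n\in\mathbb N$, $$\|f-P_{n,T}^Qf\|_{A_{q,\mathrm{mix}}^\gamma(\mathbb T^d)}\le C\,\Omega_{\mathrm{mix}}(n)\,\|f\|_{A_p^{\alpha,\beta}(\mathbb T^d)},$$ where $$\Omega_{\mathrm{mix}}(n)=\begin{cases}2^{-\left(\alpha+\beta-\gamma-\sigma_{p,q}-\left((\alpha-\gamma-\sigma_{p,q})T+\beta\right)\frac{d-1}{d-T}\right)n}\,n^{(d-1)\sigma_{p,q}}, & T\ge\frac{-\beta}{\alpha-\gamma-\sigma_{p,q}},\\[2mm] 2^{-(\alpha+\beta-\gamma-\sigma_{p,q})n}, & T<\frac{-\beta}{\alpha-\gamma-\sigma_{p,q}},\end{cases}$$ and where, if $\alpha=\gamma+\sigma_{p,q}$ (in which case necessarily $\beta>0$), the quotient $\frac{-\beta}{\alpha-\gamma-\sigma_{p,q}}$ is read as $-\infty$, so that the first case applies.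
   Context: $\mathbb T^d=\mathbb R^d/2\pi\mathbb Z^d$, $\mathbb Z_+=\{0,1,2,\dots\}$, $\frac1p+\frac1{p'}=1$, $\widehat f(\mathbf k)=(2\pi)^{-d}\int_{\mathbb T^d}f(\mathbf x)e^{-\mathrm i(\mathbf k,\mathbf x)}d\mathbf x$. For $\mathbf k\in\mathbb Z_+^d$: $|\mathbf k|_1=\sum_ik_i$, $|\mathbf k|_\infty=\max_ik_i$. Spaces. For $0<q\le\infty$, $\alpha,\beta\in\mathbb R$, the hybrid Wiener space $A_q^{\alpha,\beta}(\mathbb T^d)$ is the set of $f\in L_1(\mathbb T^d)$ with finite $\|f\|_{A_q^{\alpha,\beta}(\mathbb T^d)}=\big(\sum_{\mathbf k\in\mathbb Z^d}\prod_{j=1}^d(1+|k_j|)^{q\alpha}(1+|\mathbf k|)^{q\beta}|\widehat f(\mathbf k)|^q\big)^{1/q}$ (supremum if $q=\infty$), $|\mathbf k|$ being the Euclidean norm. The mixed Wiener space is $A_{q,\mathrm{mix}}^\gamma(\mathbb T^d)=A_q^{\gamma,0}(\mathbb T^d)$. Norms are considered up to equivalence. Sets and polynomials. $D_j=[-2^{j-1},2^{j-1})\cap\mathbb Z$; $\mathcal T_j^1=\mathrm{span}\{e^{\mathrm i kx}:k\in D_j\}$. $\mathcal D'(\mathbb T)$ is the space of periodic distributions on $\mathbb T$, with Fourier expansions $\widetilde\varphi=\sum_{k\in\mathbb Z}\widehat{\widetilde\varphi}(k)e^{\mathrm i kx}$. Amalgam-type norm: $\|\psi\|_{\widetilde A_{r,j}(\mathbb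 T)}=\sup_{\ell\in D_j}\big(\sum_{\mu\in\mathbb Z}|\widehat\psi(\ell+2^j\mu)|^r\big)^{1/r}$ for $1\le r<\infty$, and $\|\psi\|_{\widetilde A_{\infty,j}(\mathbb T)}=\sup_{k\in\mathbb Z}|\widehat\psi(k)|$ (defined through Fourier coefficients, possibly $+\infty$). Quasi-interpolation operators. For univariate $f$, $Q_j(f,\varphi_j,\widetilde\varphi_j)(x)=2^{-j}\sum_{k\in D_j}(f*\widetilde\varphi_j)(x_k^j)\,\varphi_j(x-x_k^j)$, $x_k^j=\pi k/2^{j-1}$, where $(f*\widetilde\varphi_j)(x)=\sum_{\nu\in\mathbb Z}\widehat f(\nu)\widehat{\widetilde\varphi_j}(\nu)e^{\mathrm i\nu x}$; equivalently $Q_j(f,\varphi_j,\widetilde\varphi_j)(x)=\sum_{\ell\in D_j}\widehat{\varphi_j}(\ell)\big(\sum_{\mu\in\mathbb Z}\widehat f(\ell+2^j\mu)\widehat{\widetilde\varphi_j}(\ell+2^j\mu)\big)e^{\mathrm i\ell x}$. For functions on $\mathbb T^d$, $Q_j^i$ is the operator $Q_j$ acting in the variable $x_i$, $Q_{-1}^i=0$, and $\eta_{\mathbf j}^Q=\prod_{i=1}^d(Q_{j_i}^i-Q_{j_i-1}^i)$ for $\mathbf j\in\mathbb Z_+^d$. Products are understood through Fourier coefficients: $\prod_iQ_{j_i}^if=\sum_{\boldsymbol\ell\in D_{j_1}\times\dots\times D_{j_d}}\prod_i\widehat{\varphi_{j_i}}(\ell_i)\big(\sum_{\boldsymbol\mu\in\mathbb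 Z^d}\widehat f(\ell_1+2^{j_1}\mu_1,\dots,\ell_d+2^{j_d}\mu_d)\prod_i\widehat{\widetilde\varphi_{j_i}}(\ell_i+2^{j_i}\mu_i)\big)e^{\mathrm i(\boldsymbol\ell,\mathbf x)}$. Sparse grid operator: $P_{n,T}^Q=\sum_{\mathbf j\in\Delta(n,T)}\eta_{\mathbf j}^Q$ with $\Delta(n,T)=\{\mathbf k\in\mathbb Z_+^d:|\mathbf k|_1-T|\mathbf k|_\infty\le(1-T)n\}$. *)

theory Defs
  imports "HOL-Analysis.Analysis"
begin

section \<open>Exponents and norms of sequences\<close>

text \<open>Exponents range over \<^typ>\<open>ennreal\<close>, so that the value \<open>\<infinity>\<close> is included; there
  \<open>1 / \<infinity> = 0\<close> and \<open>1 / 0 = \<infinity>\<close>.\<close>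

definition recip :: "ennreal \<Rightarrow> real" where
  "recip p = enn2real (1 / p)"

definition conj_exp :: "ennreal \<Rightarrow> ennreal" where
  "conj_exp p = 1 / (1 - 1 / p)"

definition sigma_pq :: "ennreal \<Rightarrow> ennreal \<Rightarrow> real" where
  "sigma_pq p q = max 0 (recip q - recip p)"

text \<open>A real power with the convention \<open>x\<^sup>0 = 1\<close> also at \<open>x = 0\<close>; in contrast
  \<open>0 powr 0 = 0\<close>.\<close>

definition rpow :: "real \<Rightarrow> real \<Rightarrow> real" where
  "rpow x a = (if a = 0 then 1 else x powr a)"

definition lq_norm :: "ennreal \<Rightarrow> ('k \<Rightarrow> 'b::real_normed_vector) \<Rightarrow> ennreal" where
  "lq_norm q a =
     (if q = \<infinity> then (SUP k. ennreal (norm (a k)))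
      else if (\<lambda>k. norm (a k) powr enn2real q) summable_on UNIV
      then ennreal ((\<Sum>\<^sub>\<infinity>k. norm (a k) powr enn2real q) powr (1 / enn2real q))
      else \<infinity>)"

section \<open>Functions on the torus and Wiener spaces\<close>

text \<open>Functions on the torus are \<open>2\<pi>\<close>-periodic functions on a Euclidean space. The general
  type \<^typ>\<open>'a::euclidean_space\<close> covers both the univariate case \<^typ>\<open>real\<close> and
  \<^typ>\<open>real ^ 'd\<close>.\<close>

definition torus_cell :: "'a::euclidean_space set" where
  "torus_cell = cbox 0 ((2 * pi) *\<^sub>R One)"

definition L1_torus :: "('a::euclidean_space \<Rightarrow> complex) set" where
  "L1_torus = {f. (\<forall>x. \<forall>b\<in>Basis. f (x + (2 * pi) *\<^sub>R b) = f x) \<and>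
                  f absolutely_integrable_on torus_cell}"

definition fourier_coeff :: "('a::euclidean_space \<Rightarrow> complex) \<Rightarrow> 'a \<Rightarrow> complex" where
  "fourier_coeff f \<xi> =
     integral torus_cell (\<lambda>x. f x * exp (- (\<i> * of_real (\<xi> \<bullet> x)))) / (2 * of_real pi) ^ DIM('a)"

definition real_vec :: "int ^ 'd \<Rightarrow> real ^ 'd" where
  "real_vec k = (\<chi> i. real_of_int (k $ i))"

text \<open>The weighted \<open>\<ell>\<^sub>q\<close>-norm of the Fourier coefficients; raising the weight to the power
  \<open>q\<close> happens inside \<^const>\<open>lq_norm\<close>.\<close>

definition wiener_norm :: "ennreal \<Rightarrow> real \<Rightarrow> real \<Rightarrow> (real ^ 'd \<Rightarrow> complex) \<Rightarrow> ennreal" where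
  "wiener_norm q \<alpha> \<beta> f =
     lq_norm q (\<lambda>k :: int ^ 'd.
       (\<Prod>j\<in>UNIV. (1 + \<bar>real_of_int (k $ j)\<bar>) powr \<alpha>) * (1 + norm (real_vec k)) powr \<beta> *
       norm (fourier_coeff f (real_vec k)))"

definition wiener_space :: "ennreal \<Rightarrow> real \<Rightarrow> real \<Rightarrow> (real ^ 'd \<Rightarrow> complex) set" where
  "wiener_space q \<alpha> \<beta> = {f \<in> L1_torus. wiener_norm q \<alpha> \<beta> f < \<infinity>}"

definition mixed_wiener_norm :: "ennreal \<Rightarrow> real \<Rightarrow> (real ^ 'd \<Rightarrow> complex) \<Rightarrow> ennreal" where
  "mixed_wiener_norm q \<gamma> f = wiener_norm q \<gamma> 0 f"

section \<open>Trigonometric polynomials and periodic distributions\<close>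

definition freqs :: "nat \<Rightarrow> int set" where
  "freqs j = {k. - (2 powi (int j - 1)) \<le> real_of_int k \<and> real_of_int k < 2 powi (int j - 1)}"

text \<open>The complex linear span, written out; the library's \<^const>\<open>span\<close> is the real one.\<close>

definition trig_polys :: "nat \<Rightarrow> (real \<Rightarrow> complex) set" where
  "trig_polys j =
     {g. \<exists>c :: int \<Rightarrow> complex. g = (\<lambda>x. \<Sum>k\<in>freqs j. c k * exp (\<i> * of_real (of_int k * x)))}"

definition iter_deriv :: "nat \<Rightarrow> (real \<Rightarrow> complex) \<Rightarrow> real \<Rightarrow> complex" where
  "iter_deriv m g = ((\<lambda>h x. vector_derivative h (at x)) ^^ m) g"

definition test_functions :: "(real \<Rightarrow> complex) set" where
  "test_functions = {g. (\<forall>x. g (x + 2 * pi) = g x) \<and>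
                        (\<forall>m x. iter_deriv m g differentiable (at x))}"

text \<open>Periodic distributions are the continuous complex-linear functionals on the space of smooth
  periodic functions with uniform convergence of all derivatives. That space is metrizable, so
  continuity is sequential continuity, for a linear functional at \<open>0\<close>. Values outside
  \<^const>\<open>test_functions\<close> are irrelevant.\<close>

definition periodic_distribution :: "((real \<Rightarrow> complex) \<Rightarrow> complex) \<Rightarrow> bool" where
  "periodic_distribution u \<longleftrightarrow>
     (\<forall>g\<in>test_functions. \<forall>h\<in>test_functions. \<forall>a b.
        u (\<lambda>x. a * g x + b * h x) = a * u g + b * u h) \<and>
     (\<forall>G. (\<forall>n. G n \<in> test_functions) \<longrightarrow>
          (\<forall>m. uniform_limit UNIV (\<lambda>n. iter_deriv m (G n)) (\<lambda>_. 0) sequentially) \<longrightarrow>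
          (\<lambda>n. u (G n)) \<longlonglongrightarrow> 0)"

text \<open>A periodic integrable function \<open>\<psi>\<close> is identified with the distribution
  \<open>g \<mapsto> \<integral> \<psi> g\<close> over one period, whence the factor \<open>1 / (2\<pi>)\<close>.\<close>

definition distr_coeff :: "((real \<Rightarrow> complex) \<Rightarrow> complex) \<Rightarrow> int \<Rightarrow> complex" where
  "distr_coeff u k = u (\<lambda>x. exp (- (\<i> * of_real (of_int k * x)))) / (2 * of_real pi)"

definition amalgam_norm :: "ennreal \<Rightarrow> nat \<Rightarrow> ((real \<Rightarrow> complex) \<Rightarrow> complex) \<Rightarrow> ennreal" where
  "amalgam_norm r j u =
     (if r = \<infinity> then (SUP k. ennreal (norm (distr_coeff u k)))
      else (SUP l\<in>freqs j. lq_norm r (\<lambda>\<mu> :: int. distr_coeff u (l + 2 ^ j * \<mu>))))"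

section \<open>Quasi-interpolation and sparse grid operators\<close>

text \<open>The composition of the univariate operators of levels \<open>j\<^sub>i\<close> acting in the variables
  \<open>x\<^sub>i\<close>, given through Fourier coefficients. The level \<open>-1\<close> is allowed and stands for
  the zero operator.\<close>

definition quasi_prod ::
  "(nat \<Rightarrow> real \<Rightarrow> complex) \<Rightarrow> (nat \<Rightarrow> (real \<Rightarrow> complex) \<Rightarrow> complex) \<Rightarrow> int ^ 'd
     \<Rightarrow> (real ^ 'd \<Rightarrow> complex) \<Rightarrow> real ^ 'd \<Rightarrow> complex" where
  "quasi_prod \<phi> \<psi> j f x =
     (if \<exists>i. j $ i < 0 then 0
      else \<Sum>l\<in>{l :: int ^ 'd. \<forall>i. l $ i \<in> freqs (nat (j $ i))}.
        (\<Prod>i\<in>UNIV. fourier_coeff (\<phi> (nat (j $ i))) (of_int (l $ i))) *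
        (\<Sum>\<^sub>\<infinity>\<mu> :: int ^ 'd.
           fourier_coeff f (real_vec (\<chi> i. l $ i + 2 ^ nat (j $ i) * \<mu> $ i)) *
           (\<Prod>i\<in>UNIV. distr_coeff (\<psi> (nat (j $ i))) (l $ i + 2 ^ nat (j $ i) * \<mu> $ i))) *
        exp (\<i> * of_real (real_vec l \<bullet> x)))"

text \<open>The product over \<open>i\<close> of the differences of consecutive levels, multiplied out: \<open>S\<close> is the
  set of the variables for which the subtracted operator of level \<open>j\<^sub>i - 1\<close> is chosen.\<close>

definition eta ::
  "(nat \<Rightarrow> real \<Rightarrow> complex) \<Rightarrow> (nat \<Rightarrow> (real \<Rightarrow> complex) \<Rightarrow> complex) \<Rightarrow> nat ^ 'd
     \<Rightarrow> (real ^ 'd \<Rightarrow> complex) \<Rightarrow> real ^ 'd \<Rightarrow> complex" where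
  "eta \<phi> \<psi> j f x =
     (\<Sum>S\<in>(UNIV :: 'd set set).
        (-1) ^ card S * quasi_prod \<phi> \<psi> (\<chi> i. int (j $ i) - (if i \<in> S then 1 else 0)) f x)"

definition sparse_index :: "nat \<Rightarrow> real \<Rightarrow> (nat ^ 'd) set" where
  "sparse_index n T =
     {k. real (\<Sum>i\<in>UNIV. k $ i) - T * real (Max (range (\<lambda>i. k $ i))) \<le> (1 - T) * real n}"

definition sparse_grid_op ::
  "(nat \<Rightarrow> real \<Rightarrow> complex) \<Rightarrow> (nat \<Rightarrow> (real \<Rightarrow> complex) \<Rightarrow> complex) \<Rightarrow> nat \<Rightarrow> real
     \<Rightarrow> (real ^ 'd \<Rightarrow> complex) \<Rightarrow> real ^ 'd \<Rightarrow> complex" where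
  "sparse_grid_op \<phi> \<psi> n T f x = (\<Sum>j\<in>sparse_index n T. eta \<phi> \<psi> j f x)"

text \<open>Here \<open>a = \<alpha> - \<gamma> - \<sigma>\<close>. For \<open>a = 0\<close> the threshold \<open>-\<beta> / a\<close> is read as
  minus infinity, whereas \<open>-\<beta> / 0 = 0\<close> in the library.\<close>

definition Omega_mix ::
  "nat \<Rightarrow> real \<Rightarrow> real \<Rightarrow> real \<Rightarrow> real \<Rightarrow> real \<Rightarrow> nat \<Rightarrow> real" where
  "Omega_mix d \<alpha> \<beta> \<gamma> \<sigma> T n =
     (let a = \<alpha> - \<gamma> - \<sigma> in
      if a = 0 \<or> T \<ge> - \<beta> / a
      then 2 powr (- (\<alpha> + \<beta> - \<gamma> - \<sigma> - (a * T + \<beta>) * ((real d - 1) / (real d - T))) * real n) *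
           real n powr ((real d - 1) * \<sigma>)
      else 2 powr (- (\<alpha> + \<beta> - \<gamma> - \<sigma>) * real n))"

end

theory Submission
  imports Defs
begin

text \<open>The coefficients of \<open>f - P f\<close> are \<open>\<Sum>\<^sub>j \<Sum>\<^sub>k e\<^sub>j(l,k) f^(k)\<close>, where \<open>j\<close> runs over the levels
  outside the sparse index set and \<open>e\<^sub>j(l,k)\<close> is the product over the variables of the univariate
  matrix entries of \<open>Q\<^sub>j - Q\<^sub>j\<^sub>-\<^sub>1\<close>: all levels together telescope to the identity. An entry
  is nonzero for at most two \<open>l\<close> per \<open>k\<close>; with \<open>r = (1 + |k|) / 2\<^sup>j\<close> for \<open>r < 1/4\<close> it vanishes unless
  \<open>l = k\<close> and is then of size \<open>r\<^sup>s\<close>, and divided by \<open>r\<^sup>\<kappa>\<close> the entries with \<open>r \<ge> 1/4\<close> in a residue class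
  are bounded in the norm with exponent \<open>q'\<close>, where \<open>\<kappa> + \<sigma> < min (\<alpha> + \<beta>) \<alpha>\<close>. One application of Hoelder's inequality to the sum over
  \<open>(j,k)\<close>, where \<open>\<gamma> > 0\<close> makes the sum over \<open>j\<close> converge, reduces the error to the weighted norm of \<open>f^\<close>
  over pairs \<open>(j,k)\<close>; there the weight decays geometrically in the distance of \<open>j\<close> from the
  dyadic level of \<open>k\<close>. A second application, with exponents \<open>1/\<sigma>\<close> and \<open>p\<close>, leaves the norm with
  exponent \<open>1/\<sigma>\<close> of \<open>2\<close> to the power \<open>- (a |j|\<^sub>1 + \<beta> |j|\<^sub>\<infinity>)\<close>, \<open>a = \<alpha> - \<gamma> - \<sigma>\<close>, over the levels outside the
  sparse index set, which is the asserted rate. This covers \<open>q \<le> p\<close>; for \<open>p < q\<close> the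
  pair \<open>(p,p)\<close> is used in case (i) and \<open>(q,q)\<close> in case (ii).\<close>

section \<open>Sequence norms with values in the extended reals\<close>

text \<open>Everything is estimated in the extended nonnegative reals, where sums can be reordered
  before they are known to converge. The block estimate holds for any set of levels: for all levels
  its finiteness gives the absolute convergence behind the telescoping, for the complement of the
  index set it gives the rate. The obstacle in the first use of Hoelder's inequality is that the
  entries depend on l, k and j together. Each term therefore also carries the indicator of a nonzero
  entry: the weight left over does not depend on l, and after the norms over l and (j,k) are
  exchanged the indicator costs a factor 2 per variable. The exponent \<kappa> lets one proof serve
  both alternatives: N + 1/q' plus a small number in (i), 0 in (ii). For p < q one has \<sigma> = 0,
  and the identity 1/q = \<sigma> + 1/p behind the second use fails. Since sequence norms decrease
  as the exponent grows, the target norm can be replaced by the one for p, which keeps the p' of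
  (i), or the source norm by the one for q, which keeps the q' of (ii).\<close>

abbreviation nnsum :: "('k \<Rightarrow> ennreal) \<Rightarrow> ennreal" where
  "nnsum f \<equiv> integral\<^sup>N (count_space UNIV) f"

text \<open>The values 0 and \<open>top\<close> are fixed points for every exponent, including 0 and
  negative ones, so that the laws for products, iterated powers and sums of exponents hold without
  sign conditions.\<close>

definition epow :: "ennreal \<Rightarrow> real \<Rightarrow> ennreal" where
  "epow x r = (if x = top then top else ennreal (enn2real x powr r))"

lemma epow_top [simp]: "epow top r = top"
  by (simp add: epow_def)

lemma epow_ennreal: "0 \<le> x \<Longrightarrow> epow (ennreal x) r = ennreal (x powr r)"
  by (simp add: epow_def)

lemma epow_0 [simp]: "epow 0 r = 0"
  by (simp add: epow_def)

lemma epow_1 [simp]: "epow 1 r = 1"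
  by (simp add: epow_def)

lemma epow_one [simp]: "epow x 1 = x"
  by (cases x) (auto simp: epow_def)

lemma epow_eq_0_iff [simp]: "epow x r = 0 \<longleftrightarrow> x = 0"
  by (cases x) (auto simp: epow_def)

lemma epow_eq_top_iff [simp]: "epow x r = top \<longleftrightarrow> x = top"
  by (cases x) (auto simp: epow_def)

lemma epow_mono: "x \<le> y \<Longrightarrow> 0 \<le> r \<Longrightarrow> epow x r \<le> epow y r"
  by (cases x; cases y) (auto simp: epow_def ennreal_le_iff top_unique intro!: powr_mono2 ennreal_leI)

lemma epow_mult: "epow (x * y) r = epow x r * epow y r"
proof (cases x; cases y)
  fix a b assume "0 \<le> a" "x = ennreal a" "0 \<le> b" "y = ennreal b"
  then show ?thesis
    by (simp add: epow_ennreal powr_mult flip: ennreal_mult')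
next
  fix a assume "0 \<le> a" "x = ennreal a" "y = top"
  then show ?thesis
    by (cases "a = 0") (auto simp: epow_ennreal ennreal_mult_top)
next
  fix a assume "0 \<le> a" "x = top" "y = ennreal a"
  then show ?thesis
    by (cases "a = 0") (auto simp: epow_ennreal ennreal_top_mult)
qed simp

lemma epow_epow: "epow (epow x r) s = epow x (r * s)"
  by (cases x) (auto simp: epow_ennreal powr_powr)

lemma epow_add: "epow x (r + s) = epow x r * epow x s"
  by (cases x) (auto simp: epow_ennreal powr_add ennreal_mult'')

text \<open>Enumerating the index type by \<open>to_nat\<close>, padded with zeros, turns the sum
  into a series whose partial sums are finite sums of f.\<close>

lemma nnsum_le_finite_sums:
  fixes f :: "'k :: countable \<Rightarrow> ennreal"
  assumes "\<And>F. finite F \<Longrightarrow> sum f F \<le> c"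
  shows "nnsum f \<le> c"
proof -
  define g where "g n = (if n \<in> range (to_nat :: 'k \<Rightarrow> nat) then f (from_nat n) else 0)" for n
  have "nnsum f = (\<integral>\<^sup>+ n. f (from_nat n) \<partial>count_space (range (to_nat :: 'k \<Rightarrow> nat)))"
    by (subst nn_integral_bij_count_space[OF inj_on_imp_bij_betw[OF inj_to_nat], symmetric]) simp
  also have "\<dots> = nnsum g"
    by (subst nn_integral_count_space_indicator) (auto simp: g_def intro!: nn_integral_cong split: split_indicator)
  also have "\<dots> = (\<Sum>n. g n)"
    by (rule nn_integral_count_space_nat)
  also have "\<dots> \<le> c"
  proof (rule suminf_le_const)
    fix n
    have "(\<Sum>i<n. g i) = (\<Sum>i\<in>{..<n} \<inter> range (to_nat :: 'k \<Rightarrow> nat). f (from_nat i))"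
      unfolding g_def by (rule sum.inter_restrict[symmetric]) simp
    also have "\<dots> = sum f (from_nat ` ({..<n} \<inter> range (to_nat :: 'k \<Rightarrow> nat)))"
      by (subst sum.reindex) (auto simp: inj_on_def)
    also have "\<dots> \<le> c" by (rule assms) simp
    finally show "(\<Sum>i<n. g i) \<le> c" .
  qed simp
  finally show ?thesis .
qed

lemma sum_le_nnsum: "finite F \<Longrightarrow> sum f F \<le> nnsum f"
proof -
  assume "finite F"
  then have "sum f F = (\<integral>\<^sup>+x. f x \<partial>count_space F)"
    by (simp add: nn_integral_count_space_finite)
  also have "\<dots> = (\<integral>\<^sup>+x. f x * indicator F x \<partial>count_space UNIV)"
    by (subst nn_integral_count_space_indicator) (auto)
  also have "\<dots> \<le> nnsum f"
    by (intro nn_integral_mono) (auto split: split_indicator)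
  finally show ?thesis .
qed

lemma le_nnsum: "f k \<le> nnsum f"
  using sum_le_nnsum[of "{k}" f] by simp

lemma nnsum_finite_support:
  assumes "finite F" "\<And>k. k \<notin> F \<Longrightarrow> f k = 0"
  shows "nnsum f = sum f F"
  using assms by (intro nn_integral_count_space') auto

text \<open>Comparison under a change of variables: injectivity on the support of f suffices, since
  terms of g that are missed only enlarge the right-hand side.\<close>

lemma nnsum_inj_le:
  fixes f :: "'k :: countable \<Rightarrow> ennreal"
  assumes "inj_on h A" "\<And>k. k \<in> A \<Longrightarrow> f k \<le> g (h k)" "\<And>k. k \<notin> A \<Longrightarrow> f k = 0"
  shows "nnsum f \<le> nnsum g"
proof (rule nnsum_le_finite_sums)
  fix F :: "'k set" assume F: "finite F"
  have "sum f F = sum f (F \<inter> A)"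
    using F assms(3) by (intro sum.mono_neutral_right) auto
  also have "\<dots> \<le> (\<Sum>k\<in>F \<inter> A. g (h k))"
    using assms(2) by (intro sum_mono) auto
  also have "\<dots> = sum g (h ` (F \<inter> A))"
    using assms(1) by (subst sum.reindex) (auto intro: inj_on_subset)
  also have "\<dots> \<le> nnsum g" using F by (intro sum_le_nnsum) auto
  finally show "sum f F \<le> nnsum g" .
qed

lemma nnsum_ennreal_suminf:
  assumes "summable g" "\<And>n. 0 \<le> g n"
  shows "nnsum (\<lambda>n :: nat. ennreal (g n)) = ennreal (\<Sum>n. g n)"
  using assms by (simp add: nn_integral_count_space_nat suminf_ennreal2)

text \<open>Links the extended sum to \<open>infsum\<close>. The latter is 0 for a divergent family
  while the extended sum is \<open>top\<close>, so a finite extended sum proves summability.\<close>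

lemma nnsum_ennreal_infsum:
  fixes g :: "'k :: countable \<Rightarrow> real"
  assumes "\<And>k. 0 \<le> g k"
  shows "nnsum (\<lambda>k. ennreal (g k)) = (if g summable_on UNIV then ennreal (\<Sum>\<^sub>\<infinity>k. g k) else top)"
proof -
  have le_infsum: "nnsum (\<lambda>k. ennreal (g k)) \<le> ennreal (infsum g UNIV)" if s: "g summable_on UNIV"
  proof (rule nnsum_le_finite_sums)
    fix F :: "'k set" assume "finite F"
    then show "(\<Sum>k\<in>F. ennreal (g k)) \<le> ennreal (infsum g UNIV)"
      using assms s by (subst sum_ennreal) (auto intro!: ennreal_leI finite_sum_le_infsum)
  qed
  show ?thesis
  proof (cases "nnsum (\<lambda>k. ennreal (g k)) = top")
    case False
    then obtain c where c: "0 \<le> c" "nnsum (\<lambda>k. ennreal (g k)) = ennreal c"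
      by (cases "nnsum (\<lambda>k. ennreal (g k))") auto
    have le: "sum g F \<le> c" if "finite F" for F
    proof -
      have "ennreal (sum g F) = (\<Sum>k\<in>F. ennreal (g k))" using assms by (subst sum_ennreal) auto
      also have "\<dots> \<le> ennreal c" unfolding c(2)[symmetric] using that by (rule sum_le_nnsum)
      finally show ?thesis using c(1) by simp
    qed
    have s: "g summable_on UNIV"
      by (rule nonneg_bounded_partial_sums_imp_summable_on[where C = c])
         (use assms le in \<open>auto intro!: always_eventually eventually_finite_subsets_at_top_weakI\<close>)
    have "infsum g UNIV \<le> c"
      using s le by (intro infsum_le_finite_sums) auto
    then show ?thesis using le_infsum[OF s] s c by (auto intro: antisym ennreal_leI)
  next
    case True
    have "\<not> g summable_on UNIV"
    proof
      assume "g summable_on UNIV"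
      from le_infsum[OF this]
      show False using True by (simp add: top_unique)
    qed
    with True show ?thesis by simp
  qed
qed

lemma nnsum_prod_eq: "nnsum (\<lambda>z. f (fst z) (snd z)) = nnsum (\<lambda>x. nnsum (f x))"
  using nn_integral_fst_count_space[of "\<lambda>z. f (fst z) (snd z)"] by simp

lemma nnsum_commute: "nnsum (\<lambda>x. nnsum (\<lambda>y. f x y)) = nnsum (\<lambda>y. nnsum (\<lambda>x. f x y))"
  using nn_integral_fst_count_space[of "\<lambda>z. f (fst z) (snd z)"]
    nn_integral_snd_count_space[of "\<lambda>z. f (fst z) (snd z)"] by simp

text \<open>A finite set of vectors lies in the box spanned by its coordinate projections, and over
  a box the sum of products factorizes.\<close>

lemma nnsum_vec_prod_le:
  fixes g :: "'d :: finite \<Rightarrow> 'k :: countable \<Rightarrow> ennreal"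
  shows "nnsum (\<lambda>x :: 'k ^ 'd. \<Prod>i\<in>UNIV. g i (x $ i)) \<le> (\<Prod>i\<in>UNIV. nnsum (g i))"
proof (rule nnsum_le_finite_sums)
  fix F :: "('k ^ 'd) set" assume F: "finite F"
  define B where "B i = (\<lambda>x. x $ i) ` F" for i
  have B: "finite (B i)" for i using F by (simp add: B_def)
  have "(\<Sum>x\<in>F. \<Prod>i\<in>UNIV. g i (x $ i)) = (\<Sum>x\<in>vec_nth ` F. \<Prod>i\<in>UNIV. g i (x i))"
    by (subst sum.reindex) (auto simp: inj_on_def vec_nth_inject)
  also have "\<dots> \<le> (\<Sum>x\<in>PiE UNIV B. \<Prod>i\<in>UNIV. g i (x i))"
    by (rule sum_mono2) (use B in \<open>auto simp: B_def intro!: finite_PiE\<close>)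
  also have "\<dots> = (\<Prod>i\<in>UNIV. \<Sum>y\<in>B i. g i y)"
    using B by (subst prod_sum_PiE) auto
  also have "\<dots> \<le> (\<Prod>i\<in>UNIV. nnsum (g i))"
    by (intro prod_mono_ennreal sum_le_nnsum B)
  finally show "(\<Sum>x\<in>F. \<Prod>i\<in>UNIV. g i (x $ i)) \<le> (\<Prod>i\<in>UNIV. nnsum (g i))" .
qed

section \<open>Norms indexed by the reciprocal of the exponent, and Hoelder's inequality\<close>

text \<open>The parameter \<open>u\<close> is the reciprocal of the exponent, so that Hoelder's inequality is
  additive in it and \<open>u = 0\<close> is the supremum norm.\<close>

definition lnorm :: "real \<Rightarrow> ('k \<Rightarrow> ennreal) \<Rightarrow> ennreal" where
  "lnorm u a = (if u = 0 then (SUP k. a k) else epow (nnsum (\<lambda>k. epow (a k) (1 / u))) u)"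

lemma lnorm_0: "lnorm 0 a = (SUP k. a k)"
  by (simp add: lnorm_def)

lemma lnorm_1: "lnorm 1 a = nnsum a"
  by (simp add: lnorm_def)

lemma lnorm_mono: "(\<And>k. a k \<le> b k) \<Longrightarrow> 0 \<le> u \<Longrightarrow> lnorm u a \<le> lnorm u b"
  unfolding lnorm_def by (auto intro!: epow_mono nn_integral_mono SUP_mono)

lemma lnorm_zero: "0 \<le> u \<Longrightarrow> lnorm u (\<lambda>_. 0) = 0"
  by (simp add: lnorm_def)

lemma lnorm_cmult: "lnorm u (\<lambda>k. c * a k) = c * lnorm u a"
  by (cases "u = 0")
     (simp_all add: lnorm_def epow_mult nn_integral_cmult epow_epow SUP_mult_left_ennreal)

lemma le_lnorm: "0 \<le> u \<Longrightarrow> a k \<le> lnorm u a"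
proof (cases "u = 0")
  case False
  assume "0 \<le> u"
  have "a k = epow (epow (a k) (1 / u)) u" using False by (simp add: epow_epow)
  also have "\<dots> \<le> epow (nnsum (\<lambda>k. epow (a k) (1 / u))) u"
    using \<open>0 \<le> u\<close> by (intro epow_mono le_nnsum)
  finally show ?thesis using False by (simp add: lnorm_def)
qed (auto simp: lnorm_def intro: SUP_upper)

lemma lnorm_fubini: "lnorm u (\<lambda>x. lnorm u (f x)) = lnorm u (\<lambda>z. f (fst z) (snd z))"
proof (cases "u = 0")
  case True
  have "(SUP x. SUP y. f x y) = (SUP z. f (fst z) (snd z))"
  proof (intro antisym SUP_least)
    show "f x y \<le> (SUP z. f (fst z) (snd z))" for x y
      by (rule SUP_upper2[of "(x, y)"]) auto
    show "f (fst z) (snd z) \<le> (SUP x. SUP y. f x y)" for z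
      by (rule SUP_upper2[of "fst z"], simp, rule SUP_upper) simp
  qed
  with True show ?thesis by (simp add: lnorm_def)
next
  case False
  then show ?thesis
    by (simp add: lnorm_def epow_epow nnsum_prod_eq[of "\<lambda>x y. epow (f x y) (1 / u)", symmetric])
qed

lemma lnorm_swap: "lnorm u (\<lambda>x. lnorm u (\<lambda>y. f x y)) = lnorm u (\<lambda>y. lnorm u (\<lambda>x. f x y))"
proof (cases "u = 0")
  case True
  then show ?thesis by (simp add: lnorm_def) (rule SUP_commute)
next
  case False
  then show ?thesis
    by (simp add: lnorm_def epow_epow nnsum_commute[of "\<lambda>x y. epow (f x y) (1 / u)"])
qed

text \<open>Every term is at most the larger norm Y, so the surplus power r = 1/u - 1/v of each term
  leaves the sum as a power of Y.\<close>

lemma lnorm_antimono: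
  assumes "0 \<le> u" "u \<le> v"
  shows "lnorm u a \<le> lnorm v a"
proof (cases "u = v \<or> u = 0")
  case True
  then show ?thesis using assms by (auto simp: lnorm_0 intro!: SUP_least le_lnorm)
next
  case False
  define Y where "Y = lnorm v a"
  have uv: "0 < u" "u < v" using False assms by auto
  define r where "r = 1 / u - 1 / v"
  have r: "0 < r" using uv by (simp add: r_def frac_less2)
  have "nnsum (\<lambda>k. epow (a k) (1 / u)) \<le> nnsum (\<lambda>k. epow Y r * epow (a k) (1 / v))"
  proof (rule nn_integral_mono)
    fix k
    have "epow (a k) (1 / u) = epow (a k) r * epow (a k) (1 / v)"
      by (simp add: r_def flip: epow_add)
    also have "\<dots> \<le> epow Y r * epow (a k) (1 / v)"
      using r uv unfolding Y_def by (intro mult_right_mono epow_mono le_lnorm) auto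
    finally show "epow (a k) (1 / u) \<le> epow Y r * epow (a k) (1 / v)" .
  qed
  also have "\<dots> = epow Y r * nnsum (\<lambda>k. epow (a k) (1 / v))"
    by (simp add: nn_integral_cmult)
  also have "nnsum (\<lambda>k. epow (a k) (1 / v)) = epow Y (1 / v)"
    using uv by (simp add: Y_def lnorm_def epow_epow)
  also have "epow Y r * epow Y (1 / v) = epow Y (1 / u)"
    by (simp add: r_def flip: epow_add)
  finally have "epow (nnsum (\<lambda>k. epow (a k) (1 / u))) u \<le> epow (epow Y (1 / u)) u"
    using uv by (intro epow_mono) auto
  then show ?thesis using uv by (simp add: lnorm_def[of u] Y_def[symmetric] epow_epow)
qed

text \<open>Young's inequality with weights u/t and v/t, applied to the powers 1/u and 1/v of the
  two factors.\<close>

lemma epow_young: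
  assumes "0 < u" "0 < v" "u + v = t"
  shows "epow a (1 / t) * epow b (1 / t) \<le> ennreal (u / t) * epow a (1 / u) + ennreal (v / t) * epow b (1 / v)"
proof (cases "a = top \<or> b = top")
  case True
  then show ?thesis using assms by (auto simp: ennreal_mult_top)
next
  case False
  then obtain x y where xy: "0 \<le> x" "a = ennreal x" "0 \<le> y" "b = ennreal y"
    by (metis ennreal_cases)
  have t: "0 < t" using assms by simp
  show ?thesis
  proof (cases "x = 0 \<or> y = 0")
    case True
    then show ?thesis using xy by auto
  next
    case False
    have "(x powr (1 / u)) powr (u / t) * (y powr (1 / v)) powr (v / t)
        \<le> u / t * x powr (1 / u) + v / t * y powr (1 / v)"
      using assms t xy False by (intro Youngs_inequality_0) (auto simp: add_divide_distrib[symmetric])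
    then have "x powr (1 / t) * y powr (1 / t) \<le> u / t * x powr (1 / u) + v / t * y powr (1 / v)"
      using assms by (simp add: powr_powr)
    then show ?thesis using xy t assms
      by (simp add: epow_ennreal flip: ennreal_mult' ennreal_plus)
  qed
qed

text \<open>For positive u and v, once the values 0 and \<open>top\<close> of the two norms are set
  aside, both families are divided by their norms and Young's inequality is summed termwise. A zero
  parameter means a supremum, which is pulled out directly.\<close>

lemma lnorm_Hoelder:
  assumes "0 \<le> u" "0 \<le> v"
  shows "lnorm (u + v) (\<lambda>k. a k * b k) \<le> lnorm u a * lnorm v b"
proof -
  consider "u = 0" | "v = 0" | "0 < u" "0 < v" using assms by linarith
  then show ?thesis
  proof cases
    case 1
    have "lnorm v (\<lambda>k. a k * b k) \<le> lnorm v (\<lambda>k. lnorm u a * b k)"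
      using assms by (intro lnorm_mono mult_right_mono le_lnorm) auto
    then show ?thesis by (simp add: 1 lnorm_cmult)
  next
    case 2
    have "lnorm u (\<lambda>k. a k * b k) \<le> lnorm u (\<lambda>k. lnorm v b * a k)"
      using assms by (intro lnorm_mono) (auto simp: mult.commute[of "lnorm v b"] intro!: mult_left_mono le_lnorm)
    then show ?thesis by (simp only: 2 lnorm_cmult add_0_right mult.commute[of "lnorm u a"])
  next
    case 3
    define X Y where "X = lnorm u a" and "Y = lnorm v b"
    consider "X = 0 \<or> Y = 0" | "X \<noteq> 0" "Y \<noteq> 0" "X = top \<or> Y = top"
      | "X \<noteq> 0" "Y \<noteq> 0" "X \<noteq> top" "Y \<noteq> top" by blast
    then show ?thesis
    proof cases
      case 1
      then have "(\<lambda>k. a k * b k) = (\<lambda>_. 0)"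
        using le_lnorm[of u a] le_lnorm[of v b] assms by (auto simp: X_def Y_def)
      then show ?thesis using assms by (simp add: lnorm_zero)
    next
      case 2
      then show ?thesis unfolding X_def[symmetric] Y_def[symmetric] 
        by (auto simp: ennreal_mult_top ennreal_top_mult)
    next
      case 3
      define t where "t = u + v"
      have t: "0 < t" "0 < u" "0 < v" using \<open>0 < u\<close> \<open>0 < v\<close> by (auto simp: t_def)
      define a' b' where "a' k = a k / X" and "b' k = b k / Y" for k
      have a: "a k = X * a' k" for k
        unfolding a'_def ennreal_times_divide mult.commute[of X] using 3 by (simp add: ennreal_mult_divide_eq)
      have b: "b k = Y * b' k" for k
        unfolding b'_def ennreal_times_divide mult.commute[of Y] using 3 by (simp add: ennreal_mult_divide_eq)
      have "X * lnorm u a' = X * 1"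
        unfolding lnorm_cmult[symmetric] a[symmetric] by (simp add: X_def)
      then have "lnorm u a' = 1" using 3 by (metis ennreal_mult_cancel_left)
      then have "epow (lnorm u a') (1 / u) = 1" by simp
      then have A: "nnsum (\<lambda>k. epow (a' k) (1 / u)) = 1" using t by (simp add: lnorm_def epow_epow)
      have "Y * lnorm v b' = Y * 1"
        unfolding lnorm_cmult[symmetric] b[symmetric] by (simp add: Y_def)
      then have "lnorm v b' = 1" using 3 by (metis ennreal_mult_cancel_left)
      then have "epow (lnorm v b') (1 / v) = 1" by simp
      then have B: "nnsum (\<lambda>k. epow (b' k) (1 / v)) = 1" using t by (simp add: lnorm_def epow_epow)
      have "nnsum (\<lambda>k. epow (a' k * b' k) (1 / t))
          \<le> nnsum (\<lambda>k. ennreal (u / t) * epow (a' k) (1 / u) + ennreal (v / t) * epow (b' k) (1 / v))"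
        unfolding epow_mult using t by (intro nn_integral_mono epow_young) (auto simp: t_def)
      also have "\<dots> = ennreal (u / t) + ennreal (v / t)"
        by (simp add: nn_integral_add nn_integral_cmult A B)
      also have "\<dots> = 1" using t by (simp add: t_def add_divide_distrib[symmetric] flip: ennreal_plus)
      finally have "lnorm t (\<lambda>k. a' k * b' k) \<le> 1"
        using t epow_mono[of _ 1 t] by (simp add: lnorm_def)
      then have "X * Y * lnorm t (\<lambda>k. a' k * b' k) \<le> X * Y * 1"
        by (intro mult_left_mono) auto
      also have "X * Y * lnorm t (\<lambda>k. a' k * b' k) = lnorm t (\<lambda>k. a k * b k)"
        unfolding lnorm_cmult[symmetric] a b by (simp add: mult_ac)
      finally show ?thesis by (simp add: t_def X_def Y_def)
    qed
  qed
qed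

text \<open>Reduces norms of tensor products over levels or frequencies to one variable; it follows
  from the bound on sums of products since powers are multiplicative.\<close>

lemma lnorm_prod_le:
  fixes g :: "'d :: finite \<Rightarrow> 'k :: countable \<Rightarrow> ennreal"
  assumes "0 \<le> u"
  shows "lnorm u (\<lambda>x :: 'k ^ 'd. \<Prod>i\<in>UNIV. g i (x $ i)) \<le> (\<Prod>i\<in>UNIV. lnorm u (g i))"
proof (cases "u = 0")
  case True
  then show ?thesis
    by (auto simp: lnorm_0 intro!: SUP_least prod_mono_ennreal SUP_upper)
next
  case False
  have epow_prod: "epow (\<Prod>i\<in>A. h i) r = (\<Prod>i\<in>A. epow (h i) r)" for A :: "'d set" and h r
    by (induction A rule: infinite_finite_induct) (auto simp: epow_mult)
  have "lnorm u (\<lambda>x :: 'k ^ 'd. \<Prod>i\<in>UNIV. g i (x $ i))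
      = epow (nnsum (\<lambda>x :: 'k ^ 'd. \<Prod>i\<in>UNIV. epow (g i (x $ i)) (1 / u))) u"
    using False by (simp add: lnorm_def epow_prod)
  also have "\<dots> \<le> epow (\<Prod>i\<in>UNIV. nnsum (\<lambda>y. epow (g i y) (1 / u))) u"
    using assms by (intro epow_mono nnsum_vec_prod_le)
  also have "\<dots> = (\<Prod>i\<in>UNIV. lnorm u (g i))"
    using False by (simp add: lnorm_def epow_prod)
  finally show ?thesis .
qed

section \<open>Reciprocals of exponents, and the sequence norms in terms of them\<close>

lemma recip_bounds:
  assumes "1 \<le> p"
  shows "0 \<le> recip p" "recip p \<le> 1" "recip p = 0 \<longleftrightarrow> p = \<infinity>" 
    "p \<noteq> \<infinity> \<Longrightarrow> recip p = 1 / enn2real p" "recip (conj_exp p) = 1 - recip p"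
    "1 \<le> conj_exp p"
proof -
  have "recip p = 1 / enn2real p \<and> 1 \<le> enn2real p" if fin: "p \<noteq> \<infinity>"
  proof -
    obtain x where x: "0 \<le> x" "p = ennreal x" using fin by (cases p) (auto simp: infinity_ennreal_def)
    with assms have "1 \<le> x" by simp
    with x show ?thesis by (simp add: recip_def divide_ennreal flip: ennreal_1)
  qed
  note 1 = this
  show 2: "p \<noteq> \<infinity> \<Longrightarrow> recip p = 1 / enn2real p" using 1 by simp
  have 3: "recip \<infinity> = 0" by (simp add: recip_def)
  show 4: "0 \<le> recip p" by (simp add: recip_def)
  show 5: "recip p \<le> 1" using 1 3 by (cases "p = \<infinity>") auto
  show "recip p = 0 \<longleftrightarrow> p = \<infinity>" using 1 3 by (cases "p = \<infinity>") auto
  have "1 / p \<noteq> top" using assms by (auto simp: ennreal_divide_eq_top_iff)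
  then have "1 / p = ennreal (recip p)"
    by (simp add: recip_def less_top)
  then have c: "conj_exp p = 1 / ennreal (1 - recip p)"
    using 4 5 by (simp add: conj_exp_def flip: ennreal_1 ennreal_minus)
  have e: "conj_exp p = (if recip p = 1 then top else ennreal (1 / (1 - recip p)))"
    using 4 5 by (auto simp: c divide_ennreal simp flip: ennreal_1)
  show "recip (conj_exp p) = 1 - recip p"
  proof (cases "recip p = 1")
    case False
    have "recip (ennreal y) = 1 / y" if "0 < y" for y
      using that by (simp add: recip_def divide_ennreal flip: ennreal_1)
    with False 5 show ?thesis by (simp add: e)
  qed (use 3 in \<open>simp add: e infinity_ennreal_def\<close>)
  show "1 \<le> conj_exp p" using 4 5 by (auto simp: e simp flip: ennreal_1)
qed

lemma lq_norm_eq_lnorm: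
  fixes a :: "'k :: countable \<Rightarrow> 'b::real_normed_vector"
  assumes "1 \<le> q"
  shows "lq_norm q a = lnorm (recip q) (\<lambda>k. ennreal (norm (a k)))"
proof (cases "q = \<infinity>")
  case True
  then have "recip q = 0" using recip_bounds[OF assms] by simp
  then show ?thesis by (simp add: lq_norm_def lnorm_def True)
next
  case False
  define r where "r = enn2real q"
  have r: "recip q = 1 / r" "recip q \<noteq> 0" using recip_bounds[OF assms] False by (auto simp: r_def)
  have "lnorm (recip q) (\<lambda>k. ennreal (norm (a k))) = epow (nnsum (\<lambda>k. ennreal (norm (a k) powr r))) (1 / r)"
    using r by (simp add: lnorm_def epow_ennreal)
  also have "\<dots> = lq_norm q a"
    using False by (subst nnsum_ennreal_infsum)
      (auto simp: lq_norm_def r_def[symmetric] epow_ennreal infsum_nonneg)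
  finally show ?thesis ..
qed

section \<open>Weights outside the sparse grid index set\<close>

lemma nnsum_geometric:
  assumes "0 < g"
  shows "nnsum (\<lambda>x :: nat. ennreal (2 powr (- g * real x))) = ennreal (1 / (1 - 2 powr (- g)))"
proof -
  have r: "norm (2 powr (- g)) < 1" using assms by (simp add: powr_less_one)
  have "2 powr (- g * real x) = (2 powr (- g)) ^ x" for x
    by (subst powr_realpow[symmetric]) (simp_all add: powr_powr)
  then show ?thesis
    using summable_geometric[OF r] suminf_geometric[OF r] by (simp add: nnsum_ennreal_suminf)
qed

text \<open>The n arguments below n contribute 1 each, and the rest is a geometric series. Each of
  the d - 1 free coordinates of a level pays such a factor n, which is the origin of the power of n
  in the rate.\<close>

lemma nnsum_powr_excess_le:
  assumes "0 < g" "1 \<le> n"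
  shows "nnsum (\<lambda>x. ennreal (2 powr (- g * max 0 (real x - real n))))
           \<le> ennreal ((1 + 1 / (1 - 2 powr (- g))) * real n)"
proof -
  let ?c = "1 / (1 - 2 powr (- g))"
  have c: "0 \<le> ?c" using assms by (simp add: powr_le_one_le less_imp_le powr_less_one)
  have "nnsum (\<lambda>x. ennreal (2 powr (- g * max 0 (real x - real n))))
      \<le> nnsum (\<lambda>x. (if x < n then 1 else 0) + (if n \<le> x then ennreal (2 powr (- g * real (x - n))) else 0))"
    by (intro nn_integral_mono) (auto simp: of_nat_diff)
  also have "\<dots> = nnsum (\<lambda>x. if x < n then 1 else 0) +
      nnsum (\<lambda>x. if n \<le> x then ennreal (2 powr (- g * real (x - n))) else 0)"
    by (rule nn_integral_add) auto
  also have "nnsum (\<lambda>x. if x < n then 1 else 0) = ennreal (real n)"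
    by (subst nnsum_finite_support[of "{..<n}"]) (auto simp: ennreal_of_nat_eq_real_of_nat)
  also have "nnsum (\<lambda>x. if n \<le> x then ennreal (2 powr (- g * real (x - n))) else 0)
      \<le> nnsum (\<lambda>x. ennreal (2 powr (- g * real x)))"
    by (rule nnsum_inj_le[of "\<lambda>x. x - n" "{n..}"]) (auto simp: inj_on_def)
  also have "\<dots> = ennreal ?c" by (rule nnsum_geometric) fact
  also have "ennreal (real n) + ennreal ?c = ennreal (real n + ?c)"
    using c by (subst ennreal_plus) auto
  also have "\<dots> \<le> ennreal ((1 + ?c) * real n)"
    using c assms(2) mult_left_mono[of 1 "real n" ?c] by (intro ennreal_leI) (simp add: algebra_simps)
  finally show ?thesis by (simp add: add_left_mono)
qed

lemma nnsum_powr_abs_le: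
  assumes "0 < g"
  shows "nnsum (\<lambda>x. ennreal (2 powr (- g * \<bar>real x - real n\<bar>))) \<le> ennreal (2 / (1 - 2 powr (- g)))"
proof -
  let ?c = "1 / (1 - 2 powr (- g))"
  have c: "0 \<le> ?c" using assms by (simp add: powr_le_one_le less_imp_le powr_less_one)
  have "nnsum (\<lambda>x. ennreal (2 powr (- g * \<bar>real x - real n\<bar>)))
      \<le> nnsum (\<lambda>x. (if x \<le> n then ennreal (2 powr (- g * real (n - x))) else 0) +
                   (if n \<le> x then ennreal (2 powr (- g * real (x - n))) else 0))"
    by (intro nn_integral_mono) (auto simp: of_nat_diff abs_if)
  also have "\<dots> = nnsum (\<lambda>x. if x \<le> n then ennreal (2 powr (- g * real (n - x))) else 0) +
      nnsum (\<lambda>x. if n \<le> x then ennreal (2 powr (- g * real (x - n))) else 0)"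
    by (rule nn_integral_add) auto
  also have "\<dots> \<le> nnsum (\<lambda>x. ennreal (2 powr (- g * real x))) + nnsum (\<lambda>x. ennreal (2 powr (- g * real x)))"
    by (intro add_mono nnsum_inj_le[of "\<lambda>x. x - n" "{n..}"] nnsum_inj_le[of "\<lambda>x. n - x" "{..n}"])
       (auto simp: inj_on_def)
  also have "\<dots> = ennreal (2 / (1 - 2 powr (- g)))"
    unfolding nnsum_geometric[OF assms] using c by (simp flip: ennreal_plus)
  finally show ?thesis .
qed

text \<open>The map replacing the coordinate \<open>i\<close> of \<open>j\<close> by \<open>\<lfloor>\<tau> / \<xi>\<rfloor>\<close> is injective, which turns the sum into a
  product of univariate sums: one is bounded and the others are of order \<open>n\<close>.\<close>

lemma nnsum_excess_le:
  fixes \<xi> \<kappa> g :: real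
  assumes "0 < \<xi>" "0 < g"
  shows "\<exists>C\<ge>0. \<forall>n\<ge>1. \<forall>\<zeta>. \<forall>F :: nat ^ 'd \<Rightarrow> ennreal.
    (\<forall>j. F j \<noteq> 0 \<longrightarrow> (\<exists>i \<tau>. \<tau> = \<xi> * real (j $ i) + \<kappa> * (\<Sum>l\<in>-{i}. real (j $ l)) + \<zeta> \<and> 0 < \<tau> \<and>
        (\<forall>l. \<xi> * (real (j $ l) - real n) \<le> \<tau>) \<and> F j \<le> ennreal (2 powr (- g * \<tau>)))) \<longrightarrow>
    nnsum F \<le> ennreal (C * real n ^ (CARD('d) - 1))"
proof -
  define d where "d = real CARD('d)"
  have d: "1 \<le> d" unfolding d_def using zero_less_card_finite[where 'a='d] by linarith
  \<comment> \<open>Half of the decay g \<tau> is spent on the coordinate i, the other half on the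
    excesses max 0 (j_l - n) of the others; there are fewer than d of them, each at most \<tau> /
    \<xi>.\<close>
  define e where "e = g * \<xi> / (2 * d)"
  have e: "0 < e" using assms d by (simp add: e_def)
  define C1 where "C1 = 1 / (1 - 2 powr (- (g * \<xi> / 2)))"
  define C2 where "C2 = 1 + 1 / (1 - 2 powr (- e))"
  have C1: "0 \<le> C1" using assms by (simp add: C1_def less_imp_le powr_less_one)
  have C2: "0 \<le> C2" using e by (simp add: C2_def less_imp_le powr_less_one)
  define C where "C = d * (C1 * C2 ^ (CARD('d) - 1))"
  have "nnsum F \<le> ennreal (C * real n ^ (CARD('d) - 1))"
    if n: "1 \<le> n" and
      F: "\<forall>j. F j \<noteq> 0 \<longrightarrow> (\<exists>i \<tau>. \<tau> = \<xi> * real (j $ i) + \<kappa> * (\<Sum>l\<in>-{i}. real (j $ l)) + \<zeta> \<and> 0 < \<tau> \<and>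
        (\<forall>l. \<xi> * (real (j $ l) - real n) \<le> \<tau>) \<and> F j \<le> ennreal (2 powr (- g * \<tau>)))"
    for n \<zeta> and F :: "nat ^ 'd \<Rightarrow> ennreal"
  proof -
    define \<tau> where "\<tau> i j = \<xi> * real (j $ i) + \<kappa> * (\<Sum>l\<in>-{i}. real (j $ l)) + \<zeta>" for i and j :: "nat ^ 'd"
    define A where "A i = {j. 0 < \<tau> i j \<and> (\<forall>l. \<xi> * (real (j $ l) - real n) \<le> \<tau> i j)}" for i
    define G where "G i j = (if j \<in> A i then ennreal (2 powr (- g * \<tau> i j)) else 0)" for i j
    have "F j \<le> (\<Sum>i\<in>UNIV. G i j)" for j
    proof (cases "F j = 0")
      case False
      then obtain i where "j \<in> A i" "F j \<le> ennreal (2 powr (- g * \<tau> i j))"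
        using F unfolding \<tau>_def A_def by blast
      then have "F j \<le> G i j" by (simp add: G_def)
      also have "\<dots> \<le> (\<Sum>i\<in>UNIV. G i j)" by (rule member_le_sum) auto
      finally show ?thesis .
    qed simp
    then have "nnsum F \<le> nnsum (\<lambda>j. \<Sum>i\<in>UNIV. G i j)" by (intro nn_integral_mono)
    also have "\<dots> = (\<Sum>i\<in>UNIV. nnsum (G i))" by (rule nn_integral_sum) auto
    also have "\<dots> \<le> (\<Sum>i\<in>(UNIV :: 'd set). ennreal (C1 * (C2 * real n) ^ (CARD('d) - 1)))"
    proof (rule sum_mono)
      fix i :: 'd
      define h where "h j = (\<chi> l. if l = i then nat \<lfloor>\<tau> i j / \<xi>\<rfloor> else j $ l)" for j :: "nat ^ 'd"
      define H where "H l x = (if l = i then 2 powr (- (g * \<xi> / 2) * real x)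
        else 2 powr (- e * max 0 (real x - real n)))" for l and x :: nat
      have inj: "inj_on h (A i)"
      proof (rule inj_onI)
        fix j k assume jk: "j \<in> A i" "k \<in> A i" "h j = h k"
        have other: "j $ l = k $ l" if "l \<noteq> i" for l
          using arg_cong[OF jk(3), of "\<lambda>v. v $ l"] that by (simp add: h_def)
        have "nat \<lfloor>\<tau> i j / \<xi>\<rfloor> = nat \<lfloor>\<tau> i k / \<xi>\<rfloor>"
          using arg_cong[OF jk(3), of "\<lambda>v. v $ i"] by (simp add: h_def)
        moreover have "0 \<le> \<lfloor>\<tau> i j / \<xi>\<rfloor>" "0 \<le> \<lfloor>\<tau> i k / \<xi>\<rfloor>"
          using jk assms by (auto simp: A_def)
        \<comment> \<open>Since the other coordinates agree, \<tau> / \<xi> is the integer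
          coordinate i plus the same real number D / \<xi> for both points, and the floor commutes
          with adding an integer.\<close>
        moreover define D where "D = \<kappa> * (\<Sum>l\<in>-{i}. real (j $ l)) + \<zeta>"
        have "\<kappa> * (\<Sum>l\<in>-{i}. real (k $ l)) + \<zeta> = D"
          using other by (simp add: D_def)
        then have "\<tau> i j / \<xi> = of_int (int (j $ i)) + D / \<xi>" "\<tau> i k / \<xi> = of_int (int (k $ i)) + D / \<xi>"
          using assms by (auto simp: \<tau>_def D_def field_simps)
        ultimately have "j $ i = k $ i" by (simp add: floor_add_int[symmetric] add.commute)
        with other show "j = k" unfolding vec_eq_iff by metis
      qed
      have "G i j \<le> (\<Prod>l\<in>UNIV. ennreal (H l (h j $ l)))" if j: "j \<in> A i" for j
      proof -
        let ?e = "\<Sum>l\<in>-{i}. max 0 (real (j $ l) - real n)" and ?t = "real (nat \<lfloor>\<tau> i j / \<xi>\<rfloor>)"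
        have t: "0 < \<tau> i j" "\<And>l. \<xi> * (real (j $ l) - real n) \<le> \<tau> i j" using j by (auto simp: A_def)
        have "?t \<le> \<tau> i j / \<xi>" using t assms by simp
        then have 1: "\<xi> * ?t \<le> \<tau> i j" using assms by (simp add: field_simps)
        have "(\<Sum>l\<in>-{i}. \<xi> * max 0 (real (j $ l) - real n)) \<le> (\<Sum>l\<in>-{i}. \<tau> i j)"
          using t assms by (intro sum_mono) (auto simp: max_def less_imp_le)
        also have "\<dots> \<le> d * \<tau> i j"
          using t by (simp add: d_def card_Diff_subset Compl_eq_Diff_UNIV)
        finally have 2: "\<xi> * ?e \<le> d * \<tau> i j"
          by (simp add: sum_distrib_left)
        have "(\<Prod>l\<in>UNIV. H l (h j $ l)) = H i (h j $ i) * (\<Prod>l\<in>-{i}. H l (h j $ l))"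
          by (subst prod.remove[of _ i]) (auto simp: Compl_eq_Diff_UNIV)
        also have "(\<Prod>l\<in>-{i}. H l (h j $ l)) = (\<Prod>l\<in>-{i}. 2 powr (- e * max 0 (real (j $ l) - real n)))"
          by (intro prod.cong) (auto simp: H_def h_def)
        also have "\<dots> = 2 powr (\<Sum>l\<in>-{i}. - e * max 0 (real (j $ l) - real n))"
          by (rule powr_sum[symmetric]) auto
        also have "\<dots> = 2 powr (- e * ?e)"
          by (simp add: sum_distrib_left sum_negf)
        also have "H i (h j $ i) = 2 powr (- (g * \<xi> / 2) * ?t)"
          by (simp add: H_def h_def)
        finally have "(\<Prod>l\<in>UNIV. H l (h j $ l)) = 2 powr (- (g * \<xi> / 2) * ?t
            - e * ?e)"
          by (simp add: powr_add[symmetric])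
        moreover have "2 powr (- g * \<tau> i j) \<le> \<dots>"
        proof (rule powr_mono)
          have "g * \<xi> / 2 * ?t \<le> g / 2 * \<tau> i j"
            using mult_left_mono[OF 1, of "g / 2"] assms by (simp add: mult_ac)
          moreover have "e * ?e \<le> g / 2 * \<tau> i j"
            using mult_left_mono[OF 2, of "g / (2 * d)"] assms d by (simp add: e_def field_simps)
          ultimately show "- g * \<tau> i j \<le> - (g * \<xi> / 2) * ?t
            - e * ?e" by (simp add: algebra_simps)
        qed simp
        ultimately show ?thesis using j
          by (subst prod_ennreal) (auto simp: G_def H_def intro!: ennreal_leI)
      qed
      then have "nnsum (G i) \<le> nnsum (\<lambda>j :: nat ^ 'd. \<Prod>l\<in>UNIV. ennreal (H l (j $ l)))"
        by (intro nnsum_inj_le[OF inj]) (auto simp: G_def)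
      also have "\<dots> \<le> (\<Prod>l\<in>UNIV. nnsum (\<lambda>x. ennreal (H l x)))"
        by (rule nnsum_vec_prod_le)
      also have "\<dots> = nnsum (\<lambda>x. ennreal (H i x)) * (\<Prod>l\<in>-{i}. nnsum (\<lambda>x. ennreal (H l x)))"
        by (subst prod.remove[of _ i]) (auto simp: Compl_eq_Diff_UNIV)
      also have "\<dots> \<le> ennreal C1 * (\<Prod>l\<in>-{i}. ennreal (C2 * real n))"
      proof (intro mult_mono prod_mono_ennreal)
        show "nnsum (\<lambda>x. ennreal (H i x)) \<le> ennreal C1"
          using nnsum_geometric[of "g * \<xi> / 2"] assms by (simp add: H_def C1_def)
        fix l assume "l \<in> -{i}"
        then show "nnsum (\<lambda>x. ennreal (H l x)) \<le> ennreal (C2 * real n)"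
          using nnsum_powr_excess_le[OF e n] by (simp add: H_def C2_def)
      qed auto
      also have "\<dots> = ennreal (C1 * (C2 * real n) ^ (CARD('d) - 1))"
        unfolding prod_constant using C1 C2
        by (subst ennreal_power) (simp_all add: Compl_eq_Diff_UNIV card_Diff_subset flip: ennreal_mult')
      finally show "nnsum (G i) \<le> ennreal (C1 * (C2 * real n) ^ (CARD('d) - 1))" .
    qed
    also have "\<dots> = ennreal (C * real n ^ (CARD('d) - 1))"
      using C1 C2 by (simp add: C_def d_def power_mult_distrib ennreal_of_nat_eq_real_of_nat mult_ac flip: ennreal_mult)
    finally show ?thesis .
  qed
  moreover have "0 \<le> C" using C1 C2 d by (simp add: C_def)
  ultimately show ?thesis by blast
qed

text \<open>The weight decays in the l1 distance from a corner, where one coordinate is n and the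
  others are 0. It factorizes into geometric weights, two-sided in the coordinate i, whose sums are
  bounded uniformly in n, so no power of n arises.\<close>

lemma nnsum_corner_le:
  fixes g :: real
  assumes "0 < g"
  shows "\<exists>C\<ge>0. \<forall>n. \<forall>F :: nat ^ 'd \<Rightarrow> ennreal.
    (\<forall>j. F j \<noteq> 0 \<longrightarrow> (\<exists>i. F j \<le> ennreal (2 powr (- g * ((\<Sum>l\<in>-{i}. real (j $ l)) + \<bar>real (j $ i) - real n\<bar>))))) \<longrightarrow>
    nnsum F \<le> ennreal C"
proof -
  define C1 where "C1 = 2 / (1 - 2 powr (- g))"
  have C1: "0 \<le> C1" using assms by (simp add: C1_def less_imp_le powr_less_one)
  have "nnsum F \<le> ennreal (real CARD('d) * C1 ^ CARD('d))"
    if F: "\<forall>j. F j \<noteq> 0 \<longrightarrow>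
      (\<exists>i. F j \<le> ennreal (2 powr (- g * ((\<Sum>l\<in>-{i}. real (j $ l)) + \<bar>real (j $ i) - real n\<bar>))))"
    for n and F :: "nat ^ 'd \<Rightarrow> ennreal"
  proof -
    define H where "H i l x = 2 powr (- g * (if l = i then \<bar>real x - real n\<bar> else \<bar>real x - real 0\<bar>))" for i l :: 'd and x :: nat
    have H: "2 powr (- g * ((\<Sum>l\<in>-{i}. real (j $ l)) + \<bar>real (j $ i) - real n\<bar>)) = (\<Prod>l\<in>UNIV. H i l (j $ l))"
      for i and j :: "nat ^ 'd"
    proof -
      have "(\<Prod>l\<in>UNIV. H i l (j $ l)) = H i i (j $ i) * (\<Prod>l\<in>-{i}. H i l (j $ l))"
        by (subst prod.remove[of _ i]) (auto simp: Compl_eq_Diff_UNIV)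
      also have "(\<Prod>l\<in>-{i}. H i l (j $ l)) = (\<Prod>l\<in>-{i}. 2 powr (- g * real (j $ l)))"
        by (intro prod.cong) (auto simp: H_def)
      also have "\<dots> = 2 powr (\<Sum>l\<in>-{i}. - g * real (j $ l))"
        by (rule powr_sum[symmetric]) auto
      also have "\<dots> = 2 powr (- g * (\<Sum>l\<in>-{i}. real (j $ l)))"
        by (simp add: sum_distrib_left sum_negf)
      finally show ?thesis by (simp add: H_def powr_add[symmetric] algebra_simps)
    qed
    have "F j \<le> (\<Sum>i\<in>UNIV. \<Prod>l\<in>UNIV. ennreal (H i l (j $ l)))" for j
    proof (cases "F j = 0")
      case False
      then obtain i where "F j \<le> (\<Prod>l\<in>UNIV. ennreal (H i l (j $ l)))"
        using F unfolding H by (subst (asm) prod_ennreal[symmetric]) (auto simp: H_def)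
      also have "\<dots> \<le> (\<Sum>i\<in>UNIV. \<Prod>l\<in>UNIV. ennreal (H i l (j $ l)))" by (rule member_le_sum) auto
      finally show ?thesis .
    qed simp
    then have "nnsum F \<le> nnsum (\<lambda>j. \<Sum>i\<in>UNIV. \<Prod>l\<in>UNIV. ennreal (H i l (j $ l)))" by (intro nn_integral_mono)
    also have "\<dots> = (\<Sum>i\<in>UNIV. nnsum (\<lambda>j. \<Prod>l\<in>UNIV. ennreal (H i l (j $ l))))" by (rule nn_integral_sum) auto
    also have "\<dots> \<le> (\<Sum>i\<in>(UNIV :: 'd set). \<Prod>l\<in>(UNIV :: 'd set). ennreal C1)"
    proof (rule sum_mono)
      fix i :: 'd
      have "nnsum (\<lambda>j :: nat ^ 'd. \<Prod>l\<in>UNIV. ennreal (H i l (j $ l))) \<le> (\<Prod>l\<in>UNIV. nnsum (\<lambda>x. ennreal (H i l x)))"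
        by (rule nnsum_vec_prod_le)
      also have "\<dots> \<le> (\<Prod>l\<in>(UNIV :: 'd set). ennreal C1)"
      proof (rule prod_mono_ennreal)
        fix l :: 'd
        show "nnsum (\<lambda>x. ennreal (H i l x)) \<le> ennreal C1"
          using nnsum_powr_abs_le[OF assms, of n] nnsum_powr_abs_le[OF assms, of 0]
          by (cases "l = i") (simp_all add: H_def C1_def)
      qed
      finally show "nnsum (\<lambda>j :: nat ^ 'd. \<Prod>l\<in>UNIV. ennreal (H i l (j $ l))) \<le> (\<Prod>l\<in>(UNIV :: 'd set). ennreal C1)" .
    qed
    also have "\<dots> = ennreal (real CARD('d) * C1 ^ CARD('d))"
      using C1 by (simp add: ennreal_power ennreal_of_nat_eq_real_of_nat ennreal_mult)
    finally show ?thesis .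
  qed
  then show ?thesis using C1 by (intro exI[of _ "real CARD('d) * C1 ^ CARD('d)"]) auto
qed

section \<open>Sum and maximum of a level, and the sparse grid index set\<close>

definition l1 :: "nat ^ 'd \<Rightarrow> real" where
  "l1 j = (\<Sum>i\<in>UNIV. real (j $ i))"

definition linf :: "nat ^ 'd \<Rightarrow> nat" where
  "linf j = Max (range (\<lambda>i. j $ i))"

abbreviation lev :: "real \<Rightarrow> real \<Rightarrow> nat ^ 'd \<Rightarrow> real" where
  "lev a \<beta> j \<equiv> 2 powr (- (a * l1 j + \<beta> * real (linf j)))"

lemma linf_attained: "\<exists>i. j $ i = linf j"
proof -
  have "linf j \<in> range (\<lambda>i. j $ i)" unfolding linf_def by (rule Max_in) auto
  then show ?thesis by auto
qed

lemma le_linf: "j $ i \<le> linf j"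
  unfolding linf_def by (rule Max_ge) auto

lemma l1_split: "l1 j = real (j $ i) + (\<Sum>l\<in>-{i}. real (j $ l))"
  unfolding l1_def by (subst sum.remove[of _ i]) (auto simp: Compl_eq_Diff_UNIV)

lemma linf_le_l1: "real (linf j) \<le> l1 j"
proof -
  obtain i where "j $ i = linf j" using linf_attained by blast
  then show ?thesis using l1_split[of j i] by (simp add: sum_nonneg)
qed

lemma l1_le: "l1 (j :: nat ^ 'd) \<le> real CARD('d) * real (linf j)"
proof -
  have "l1 j \<le> (\<Sum>i\<in>(UNIV :: 'd set). real (linf j))"
    unfolding l1_def by (intro sum_mono) (simp add: le_linf)
  then show ?thesis by simp
qed

lemma sparse_index_iff: "j \<in> sparse_index n T \<longleftrightarrow> l1 j - T * real (linf j) \<le> (1 - T) * real n"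
  by (simp add: sparse_index_def l1_def linf_def)

text \<open>As \<open>linf\<close> is at most \<open>l1\<close>, the quantity l1 - T linf is at
  least (1 - T) linf, whatever the sign of T.\<close>

lemma linf_le_of_sparse_index:
  assumes "T < 1" "j \<in> sparse_index n T"
  shows "linf j \<le> n"
proof -
  have "(1 - T) * real (linf j) \<le> (1 - T) * real n"
    using assms(2) linf_le_l1[of j] by (simp add: sparse_index_iff algebra_simps)
  then show ?thesis using assms(1) by simp
qed

lemma finite_vec_bounded: "finite {j :: 'a :: finite \<Rightarrow> nat. \<forall>i. j i \<le> n}"
  using finite_PiE[of UNIV "\<lambda>_ :: 'a. {..n}"] by (simp add: PiE_def Pi_def)

lemma finite_sparse_index:
  assumes "T < 1"
  shows "finite (sparse_index n T :: (nat ^ 'd) set)"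
proof (rule finite_subset)
  show "sparse_index n T \<subseteq> vec_lambda ` {j :: 'd \<Rightarrow> nat. \<forall>i. j i \<le> n}"
  proof
    fix j :: "nat ^ 'd" assume "j \<in> sparse_index n T"
    then have "\<forall>i. j $ i \<le> n"
      using linf_le_of_sparse_index[OF assms] le_linf[of j] by (meson le_trans)
    then show "j \<in> vec_lambda ` {j :: 'd \<Rightarrow> nat. \<forall>i. j i \<le> n}"
      by (intro image_eqI[of _ _ "vec_nth j"]) auto
  qed
qed (use finite_vec_bounded in blast)

text \<open>The diagonal point with all coordinates n' = (1 - T) n / (d - T) lies on the boundary of
  the index set, and E n is the exponent there. In general the exponent is E n + a y + (a T +
  \<beta>) z, where y is the excess over the boundary and z = linf - n'. Outside the index set y and
  z are both positive, so no term lowers the exponent.\<close>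

lemma lnorm_diagonal_case:
  fixes a \<beta> \<sigma> T :: real
  defines "E \<equiv> a + \<beta> - (a * T + \<beta>) * ((real CARD('d) - 1) / (real CARD('d) - T))"
  assumes "0 \<le> \<sigma>" "0 \<le> a" "0 < a + \<beta>" "T < 1" "0 \<le> a * T + \<beta>"
  shows "\<exists>C\<ge>0. \<forall>n\<ge>1. lnorm \<sigma> (\<lambda>j :: nat ^ 'd. if j \<in> sparse_index n T then 0
            else ennreal (lev a \<beta> j))
          \<le> ennreal (C * (2 powr (- E * real n) * real n powr ((real CARD('d) - 1) * \<sigma>)))"
proof -
  define d where "d = real CARD('d)"
  have d: "1 \<le> d" unfolding d_def using zero_less_card_finite[where 'a='d] by linarith
  define n' where "n' n = (1 - T) * real n / (d - T)" for n
  have E: "E * real n = a * (1 - T) * real n + (a * T + \<beta>) * n' n" for n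
  proof -
    have dT: "d - T \<noteq> 0" using d assms by simp
    have "E = a * (1 - T) + (a * T + \<beta>) * ((1 - T) / (d - T))"
      unfolding E_def d_def[symmetric] using dT by (simp add: field_simps)
    then show ?thesis by (simp add: n'_def distrib_right)
  qed
  have n'_le: "n' n \<le> real n" for n
    using d assms mult_right_mono[of "1 - T" "d - T" "real n"] by (simp add: n'_def field_simps)
  define y where "y n j = l1 j - T * real (linf j) - (1 - T) * real n" for n and j :: "nat ^ 'd"
  define z where "z n j = real (linf j) - n' n" for n and j :: "nat ^ 'd"
  have exp_eq: "a * l1 j + \<beta> * real (linf j) = E * real n + (a * y n j + (a * T + \<beta>) * z n j)" for n j
    unfolding E y_def z_def by (simp add: algebra_simps)
  have y_pos: "0 < y n j" if "j \<notin> sparse_index n T" for n and j :: "nat ^ 'd"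
    using that by (simp add: sparse_index_iff y_def)
  have z_pos: "0 < z n j" if "j \<notin> sparse_index n T" for n and j :: "nat ^ 'd"
  proof -
    have "(1 - T) * real n < l1 j - T * real (linf j)" using that by (simp add: sparse_index_iff)
    also have "\<dots> \<le> (d - T) * real (linf j)" using l1_le[of j] by (simp add: d_def algebra_simps)
    finally show ?thesis using d assms by (simp add: z_def n'_def field_simps)
  qed
  show ?thesis
  proof (cases "\<sigma> = 0")
    case True
    have "ennreal (lev a \<beta> j) \<le> ennreal (2 powr (- E * real n))"
      if "j \<notin> sparse_index n T" for n and j :: "nat ^ 'd"
    proof (intro ennreal_leI powr_mono)
      have "0 \<le> a * y n j" "0 \<le> (a * T + \<beta>) * z n j"
        using y_pos[OF that] z_pos[OF that] assms by (auto intro!: mult_nonneg_nonneg)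
      then show "- (a * l1 j + \<beta> * real (linf j)) \<le> - E * real n"
        unfolding exp_eq[of j n] by linarith
    qed simp
    then show ?thesis using True
      unfolding lnorm_0 \<open>\<sigma> = 0\<close> by (intro exI[of _ 1] conjI allI impI SUP_least) simp_all
  next
    case False
    with assms have \<sigma>: "0 < \<sigma>" by simp
    let ?h = "\<lambda>n j. 2 powr (- (a * y n j + (a * T + \<beta>) * z n j) / \<sigma>)"
    let ?f = "\<lambda>n j. if j \<in> sparse_index n T then 0 else ennreal (?h n j)"
    \<comment> \<open>Kept general because the decay has two sources. For a > 0 it is taken from
      \<tau> = y, the term with z being nonnegative. For a = 0 the term with y vanishes, and \<tau>
      = z is used with rate \<beta> > 0.\<close>
    have bound: "\<exists>C\<ge>0. \<forall>n\<ge>1. nnsum (\<lambda>j :: nat ^ 'd. ?f n j) \<le> ennreal (C * real n ^ (CARD('d) - 1))"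
      if g: "0 < g" and \<xi>: "0 < \<xi>" and \<tau>: "\<And>n j i. j \<notin> sparse_index n T \<Longrightarrow> j $ i = linf j \<Longrightarrow>
        \<tau> n j = \<xi> * real (j $ i) + \<kappa> * (\<Sum>l\<in>-{i}. real (j $ l)) + \<zeta> n \<and> 0 < \<tau> n j \<and>
        (\<forall>l. \<xi> * (real (j $ l) - real n) \<le> \<tau> n j) \<and> g * \<tau> n j \<le> a * y n j + (a * T + \<beta>) * z n j"
      for g \<xi> \<kappa> \<zeta> and \<tau> :: "nat \<Rightarrow> nat ^ 'd \<Rightarrow> real"
    proof -
      have "\<exists>i t. t = \<xi> * real (j $ i) + \<kappa> * (\<Sum>l\<in>-{i}. real (j $ l)) + \<zeta> n \<and> 0 < t \<and>
        (\<forall>l. \<xi> * (real (j $ l) - real n) \<le> t) \<and> ?f n j \<le> ennreal (2 powr (- (g / \<sigma>) * t))"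
        if "?f n j \<noteq> 0" for n and j :: "nat ^ 'd"
      proof -
        from that have j: "j \<notin> sparse_index n T" by (simp split: if_splits)
        obtain i where i: "j $ i = linf j" using linf_attained by blast
        note t = \<tau>[OF j i]
        have "?h n j \<le> 2 powr (- (g / \<sigma>) * \<tau> n j)"
        proof (rule powr_mono)
          have "- Y / \<sigma> \<le> - (g / \<sigma>) * r" if "g * r \<le> Y" for r Y
            using divide_right_mono[OF that, of \<sigma>] \<sigma> by simp
          then show "- (a * y n j + (a * T + \<beta>) * z n j) / \<sigma> \<le> - (g / \<sigma>) * \<tau> n j" using t by blast
        qed simp
        then have "?f n j \<le> ennreal (2 powr (- (g / \<sigma>) * \<tau> n j))" using j by (auto intro: ennreal_leI)
        with t show ?thesis by blast
      qed
      note exc = this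
      have "0 < g / \<sigma>" using g \<sigma> by simp
      from nnsum_excess_le[where 'd = 'd, OF \<xi> this, of \<kappa>]
      show ?thesis
      proof (elim exE conjE)
        fix C assume "0 \<le> C" and C: "\<forall>n\<ge>1. \<forall>\<zeta>. \<forall>F :: nat ^ 'd \<Rightarrow> ennreal. (\<forall>j. F j \<noteq> 0 \<longrightarrow>
          (\<exists>i t. t = \<xi> * real (j $ i) + \<kappa> * (\<Sum>l\<in>-{i}. real (j $ l)) + \<zeta> \<and> 0 < t \<and>
          (\<forall>l. \<xi> * (real (j $ l) - real n) \<le> t) \<and> F j \<le> ennreal (2 powr (- (g / \<sigma>) * t)))) \<longrightarrow>
          nnsum F \<le> ennreal (C * real n ^ (CARD('d) - 1))"
        have "nnsum (\<lambda>j :: nat ^ 'd. ?f n j) \<le> ennreal (C * real n ^ (CARD('d) - 1))" if "1 \<le> n" for n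
          by (rule C[THEN spec, THEN mp, OF that, THEN spec[of _ "\<zeta> n"], THEN spec, THEN mp]) (intro allI impI exc)
        then show ?thesis using \<open>0 \<le> C\<close> by blast
      qed
    qed
    have "\<exists>C\<ge>0. \<forall>n\<ge>1. nnsum (\<lambda>j :: nat ^ 'd. ?f n j) \<le> ennreal (C * real n ^ (CARD('d) - 1))"
    proof (cases "a = 0")
      case True
      show ?thesis
      proof (rule bound[of \<beta> 1 z 0 "\<lambda>n. - n' n"])
        fix n i and j :: "nat ^ 'd" assume j: "j \<notin> sparse_index n T" "j $ i = linf j"
        have "real (j $ l) - real n \<le> z n j" for l
          using le_linf[of j l] n'_le[of n] by (simp add: z_def)
        with z_pos[OF j(1)] j(2) True
        show "z n j = 1 * real (j $ i) + 0 * (\<Sum>l\<in>-{i}. real (j $ l)) + - n' n \<and> 0 < z n j \<and>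
          (\<forall>l. 1 * (real (j $ l) - real n) \<le> z n j) \<and> \<beta> * z n j \<le> a * y n j + (a * T + \<beta>) * z n j"
          by (simp add: z_def)
      qed (use assms True in auto)
    next
      case False
      show ?thesis
      proof (rule bound[of a "1 - T" y 1 "\<lambda>n. - (1 - T) * real n"])
        fix n i and j :: "nat ^ 'd" assume j: "j \<notin> sparse_index n T" "j $ i = linf j"
        have "y n j = (1 - T) * real (j $ i) + 1 * (\<Sum>l\<in>-{i}. real (j $ l)) + - (1 - T) * real n"
          using l1_split[of j i] j(2) by (simp add: y_def algebra_simps)
        moreover have "(1 - T) * (real (j $ l) - real n) \<le> y n j" for l
        proof -
          have "(1 - T) * real (j $ l) \<le> (1 - T) * real (linf j)"
            using le_linf[of j l] assms by (intro mult_left_mono) auto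
          then show ?thesis using linf_le_l1[of j] by (simp add: y_def algebra_simps)
        qed
        moreover have "0 \<le> (a * T + \<beta>) * z n j" using z_pos[OF j(1)] assms by simp
        ultimately show "y n j = (1 - T) * real (j $ i) + 1 * (\<Sum>l\<in>-{i}. real (j $ l)) + - (1 - T) * real n \<and>
          0 < y n j \<and> (\<forall>l. (1 - T) * (real (j $ l) - real n) \<le> y n j) \<and> a * y n j \<le> a * y n j + (a * T + \<beta>) * z n j"
          using y_pos[OF j(1)] by simp
      qed (use assms False in auto)
    qed
    then obtain C where C: "0 \<le> C" "\<And>n. 1 \<le> n \<Longrightarrow> nnsum (\<lambda>j :: nat ^ 'd. ?f n j) \<le> ennreal (C * real n ^ (CARD('d) - 1))"
      by blast
    show ?thesis
    proof (intro exI[of _ "C powr \<sigma>"] conjI allI impI)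
      fix n :: nat assume n: "1 \<le> n"
      have "lnorm \<sigma> (\<lambda>j :: nat ^ 'd. if j \<in> sparse_index n T then 0
            else ennreal (lev a \<beta> j))
        = lnorm \<sigma> (\<lambda>j :: nat ^ 'd. ennreal (2 powr (- E * real n)) * (if j \<in> sparse_index n T then 0
            else ennreal (2 powr (- (a * y n j + (a * T + \<beta>) * z n j)))))"
        by (intro arg_cong[of _ _ "lnorm \<sigma>"] ext)
           (simp add: exp_eq[of _ n] powr_add[symmetric] flip: ennreal_mult')
      also have "\<dots> = ennreal (2 powr (- E * real n)) * lnorm \<sigma> (\<lambda>j :: nat ^ 'd. if j \<in> sparse_index n T then 0
            else ennreal (2 powr (- (a * y n j + (a * T + \<beta>) * z n j))))"
        by (rule lnorm_cmult)
      also have "lnorm \<sigma> (\<lambda>j :: nat ^ 'd. if j \<in> sparse_index n T then 0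
            else ennreal (2 powr (- (a * y n j + (a * T + \<beta>) * z n j))))
          = epow (nnsum (\<lambda>j :: nat ^ 'd. ?f n j)) \<sigma>"
        using \<sigma> by (auto simp: lnorm_def epow_ennreal powr_powr intro!: arg_cong[of _ _ "\<lambda>x. epow x \<sigma>"] nn_integral_cong)
      also have "\<dots> \<le> epow (ennreal (C * real n ^ (CARD('d) - 1))) \<sigma>"
        using \<sigma> n by (intro epow_mono C(2)) auto
      also have "\<dots> = ennreal (C powr \<sigma> * real n powr ((real CARD('d) - 1) * \<sigma>))"
      proof -
        have "real n ^ (CARD('d) - 1) = real n powr (real CARD('d) - 1)"
          using n d by (simp add: powr_realpow[symmetric] of_nat_diff d_def)
        then show ?thesis using C(1) n by (simp add: epow_ennreal powr_mult powr_powr)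
      qed
      also have "ennreal (2 powr (- E * real n)) * \<dots> 
          = ennreal (C powr \<sigma> * (2 powr (- E * real n) * real n powr ((real CARD('d) - 1) * \<sigma>)))"
        by (simp add: mult_ac flip: ennreal_mult')
      finally show "lnorm \<sigma> (\<lambda>j :: nat ^ 'd. if j \<in> sparse_index n T then 0
            else ennreal (lev a \<beta> j))
          \<le> ennreal (C powr \<sigma> * (2 powr (- E * real n) * real n powr ((real CARD('d) - 1) * \<sigma>)))"
        by (simp add: mult_left_mono)
    qed simp
  qed
qed

text \<open>For a T + \<beta> < 0 the extremal levels are the corners: outside the index set the
  exponent exceeds its corner value (a + \<beta>) n by at least e times the l1 distance Y + |M - n|
  to a corner, M being the maximal coordinate and Y the sum of the others.\<close>

lemma lnorm_corner_case:
  fixes a \<beta> \<sigma> T :: real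
  assumes "0 \<le> \<sigma>" "0 < a" "0 < a + \<beta>" "T < 1" "a * T + \<beta> < 0"
  shows "\<exists>C\<ge>0. \<forall>n. lnorm \<sigma> (\<lambda>j :: nat ^ 'd. if j \<in> sparse_index n T then 0
            else ennreal (lev a \<beta> j))
          \<le> ennreal (C * 2 powr (- (a + \<beta>) * real n))"
proof -
  define \<delta> where "\<delta> = - (a * T + \<beta>)"
  \<comment> \<open>For M >= n the bounds a and a + \<beta> suffice. For M < n, being outside the
    index set forces Y > (1 - T) (n - M); spending (a - e) Y on this leaves n - M with the factor
    \<delta> - e (1 - T), which has to be at least e.\<close>
  define e where "e = min (min a (a + \<beta>)) (\<delta> / (2 - T))"
  have e: "0 < e" "e \<le> a" "e \<le> a + \<beta>" "e * (2 - T) \<le> \<delta>"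
  proof -
    have 1: "0 < 2 - T" "0 < \<delta>" using assms by (auto simp: \<delta>_def)
    then show "0 < e" using assms by (simp add: e_def)
    show "e \<le> a" "e \<le> a + \<beta>" by (auto simp: e_def)
    have "e \<le> \<delta> / (2 - T)" by (simp add: e_def)
    then show "e * (2 - T) \<le> \<delta>" using 1 by (simp add: pos_le_divide_eq)
  qed
  define Y where "Y i j = (\<Sum>l\<in>-{i}. real (j $ l))" for i and j :: "nat ^ 'd"
  have key: "(a + \<beta>) * real n + e * (Y i j + \<bar>real (j $ i) - real n\<bar>) \<le> a * l1 j + \<beta> * real (linf j)"
    if j: "j \<notin> sparse_index n T" and i: "j $ i = linf j" for n i and j :: "nat ^ 'd"
  proof -
    define M where "M = real (linf j)"
    have l1: "l1 j = M + Y i j" using l1_split[of j i] i by (simp add: Y_def M_def)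
    have Y0: "0 \<le> Y i j" by (simp add: Y_def sum_nonneg)
    have eY: "e * Y i j \<le> a * Y i j" using e Y0 by (intro mult_right_mono) auto
    show ?thesis
    proof (cases "real n \<le> M")
      case True
      have "e * (M - real n) \<le> (a + \<beta>) * (M - real n)"
        using e True by (intro mult_right_mono) auto
      with eY True show ?thesis by (simp add: l1 i M_def[symmetric] algebra_simps)
    next
      case False
      have "(1 - T) * (real n - M) \<le> Y i j"
        using j unfolding sparse_index_iff l1 M_def[symmetric] by (simp add: algebra_simps)
      then have 1: "(a - e) * ((1 - T) * (real n - M)) \<le> (a - e) * Y i j"
        using e by (intro mult_left_mono) auto
      have 2: "e * (2 - T) * (real n - M) \<le> \<delta> * (real n - M)"
        using e False by (intro mult_right_mono) auto
      from 1 2 False show ?thesis by (simp add: l1 i M_def[symmetric] \<delta>_def algebra_simps)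
    qed
  qed
  define W where "W n j = (if j \<in> sparse_index n T then 0
      else ennreal (2 powr (- (a * l1 j + \<beta> * real (linf j) - (a + \<beta>) * real n))))" for n and j :: "nat ^ 'd"
  have eq: "lnorm \<sigma> (\<lambda>j :: nat ^ 'd. if j \<in> sparse_index n T then 0
            else ennreal (lev a \<beta> j))
        = ennreal (2 powr (- (a + \<beta>) * real n)) * lnorm \<sigma> (W n)" for n
  proof -
    have "(\<lambda>j :: nat ^ 'd. if j \<in> sparse_index n T then 0
            else ennreal (lev a \<beta> j))
        = (\<lambda>j. ennreal (2 powr (- (a + \<beta>) * real n)) * W n j)"
      by (auto simp: W_def fun_eq_iff powr_add[symmetric] algebra_simps simp flip: ennreal_mult')
    then show ?thesis by (simp only: lnorm_cmult)
  qed
  have W: "\<exists>i. W n j \<le> ennreal (2 powr (- e * (Y i j + \<bar>real (j $ i) - real n\<bar>)))" for n j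
  proof -
    obtain i where i: "j $ i = linf j" using linf_attained by blast
    have "W n j \<le> ennreal (2 powr (- e * (Y i j + \<bar>real (j $ i) - real n\<bar>)))"
      using key[of j n i] i by (auto simp: W_def intro!: ennreal_leI)
    then show ?thesis ..
  qed
  have "\<exists>C\<ge>0. \<forall>n. lnorm \<sigma> (W n) \<le> ennreal C"
  proof (cases "\<sigma> = 0")
    case True
    have "W n j \<le> 1" for n j
    proof -
      obtain i where "W n j \<le> ennreal (2 powr (- e * (Y i j + \<bar>real (j $ i) - real n\<bar>)))"
        using W by blast
      also have "\<dots> \<le> ennreal (2 powr 0)"
        using e by (intro ennreal_leI powr_mono) (auto simp: Y_def intro!: mult_nonneg_nonneg add_nonneg_nonneg sum_nonneg)
      finally show ?thesis by simp
    qed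
    then show ?thesis using True by (intro exI[of _ 1]) (auto simp: lnorm_0 intro!: SUP_least)
  next
    case False
    with assms have \<sigma>: "0 < \<sigma>" by simp
    obtain C where C: "0 \<le> C" "\<And>n. \<And>F :: nat ^ 'd \<Rightarrow> ennreal.
      (\<forall>j. F j \<noteq> 0 \<longrightarrow> (\<exists>i. F j \<le> ennreal (2 powr (- (e / \<sigma>) * (Y i j + \<bar>real (j $ i) - real n\<bar>))))) \<Longrightarrow>
      nnsum F \<le> ennreal C"
      using nnsum_corner_le[where 'd = 'd, of "e / \<sigma>"] e \<sigma> unfolding Y_def by (auto 0 3)
    have "lnorm \<sigma> (W n) \<le> ennreal (C powr \<sigma>)" for n
    proof -
      have "\<exists>i. epow (W n j) (1 / \<sigma>) \<le> ennreal (2 powr (- (e / \<sigma>) * (Y i j + \<bar>real (j $ i) - real n\<bar>)))" for j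
      proof -
        obtain i where "W n j \<le> ennreal (2 powr (- e * (Y i j + \<bar>real (j $ i) - real n\<bar>)))"
          using W by blast
        then have "epow (W n j) (1 / \<sigma>) \<le> epow (ennreal (2 powr (- e * (Y i j + \<bar>real (j $ i) - real n\<bar>)))) (1 / \<sigma>)"
          using \<sigma> by (intro epow_mono) auto
        then show ?thesis by (auto simp: epow_ennreal powr_powr intro: exI[of _ i])
      qed
      then have "nnsum (\<lambda>j. epow (W n j) (1 / \<sigma>)) \<le> ennreal C" by (intro C(2)[of _ n]) auto
      then have "epow (nnsum (\<lambda>j. epow (W n j) (1 / \<sigma>))) \<sigma> \<le> epow (ennreal C) \<sigma>"
        using \<sigma> by (intro epow_mono) auto
      then show ?thesis using C(1) \<sigma> by (simp add: lnorm_def epow_ennreal)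
    qed
    then show ?thesis by (intro exI[of _ "C powr \<sigma>"]) auto
  qed
  then obtain C where C: "0 \<le> C" "\<And>n. lnorm \<sigma> (W n) \<le> ennreal C" by blast
  show ?thesis
  proof (intro exI[of _ C] conjI allI)
    fix n
    have "ennreal (2 powr (- (a + \<beta>) * real n)) * lnorm \<sigma> (W n) \<le> ennreal (2 powr (- (a + \<beta>) * real n)) * ennreal C"
      by (intro mult_left_mono C(2)) auto
    then show "lnorm \<sigma> (\<lambda>j :: nat ^ 'd. if j \<in> sparse_index n T then 0
            else ennreal (lev a \<beta> j))
          \<le> ennreal (C * 2 powr (- (a + \<beta>) * real n))"
      unfolding eq using C(1) by (simp add: mult.commute ennreal_mult)
  qed (rule C(1))
qed

text \<open>The threshold for T is the sign of a T + \<beta>; for a = 0 this is \<beta>, positive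
  because a + \<beta> > 0.\<close>

lemma lnorm_weight_le_Omega_mix:
  fixes \<alpha> \<beta> \<gamma> \<sigma> T :: real
  defines "a \<equiv> \<alpha> - \<gamma> - \<sigma>"
  assumes "0 \<le> \<sigma>" "0 \<le> a" "0 < a + \<beta>" "T < 1"
  shows "\<exists>C\<ge>0. \<forall>n\<ge>1. lnorm \<sigma> (\<lambda>j :: nat ^ 'd. if j \<in> sparse_index n T then 0
            else ennreal (lev a \<beta> j))
          \<le> ennreal (C * Omega_mix CARD('d) \<alpha> \<beta> \<gamma> \<sigma> T n)"
proof (cases "a = 0 \<or> T \<ge> - \<beta> / a")
  case True
  then have "0 \<le> a * T + \<beta>"
  proof (cases "a = 0")
    case True
    then show ?thesis using assms(4) by simp
  next
    case False
    with True assms(3) have "0 < a" "- \<beta> / a \<le> T" by auto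
    then have "- \<beta> \<le> T * a" by (simp only: pos_divide_le_eq)
    then show ?thesis by (simp add: mult.commute)
  qed
  from lnorm_diagonal_case[where 'd = 'd, OF assms(2-5) this] show ?thesis
    using True unfolding Omega_mix_def Let_def a_def[symmetric] by (simp add: a_def algebra_simps)
next
  case False
  then have "0 < a" using assms(3) by linarith
  moreover have "a * T + \<beta> < 0"
  proof -
    have "T < - \<beta> / a" using False by simp
    then have "T * a < - \<beta>" using \<open>0 < a\<close> by (simp only: pos_less_divide_eq)
    then show ?thesis by (simp add: mult.commute)
  qed
  ultimately have "0 < a" "a * T + \<beta> < 0" .
  from lnorm_corner_case[where 'd = 'd, OF assms(2) this(1) assms(4,5) this(2)] show ?thesis
    using False unfolding Omega_mix_def Let_def a_def[symmetric] by (auto simp: a_def algebra_simps)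
qed

section \<open>Fourier coefficients on the torus\<close>

lemma has_bochner_integral_exp_period:
  fixes m :: int
  shows "has_bochner_integral lborel (\<lambda>t. indicator {0..2*pi} t *\<^sub>R exp (\<i> * of_real (of_int m * t)))
    (if m = 0 then 2 * of_real pi else 0)"
proof (cases "m = 0")
  case True
  have "has_bochner_integral lborel (\<lambda>t. indicator {0..2*pi} t *\<^sub>R (1 :: complex)) (of_real (2 * pi) - of_real 0)"
  proof (rule has_bochner_integral_FTC_Icc)
    show "(of_real has_vector_derivative (1 :: complex)) (at x within {0..2 * pi})" for x
      by (rule has_vector_derivative_of_real[OF DERIV_ident, unfolded of_real_1])
  qed auto
  with True show ?thesis by simp
next
  case False
  define F where "F t = exp (\<i> * of_real (of_int m * t)) / (\<i> * of_int m)" for t :: real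
  have "has_bochner_integral lborel (\<lambda>t. indicator {0..2*pi} t *\<^sub>R exp (\<i> * of_real (of_int m * t)))
    (F (2 * pi) - F 0)"
  proof (rule has_bochner_integral_FTC_Icc)
    fix x :: real
    have "((\<lambda>z. exp (\<i> * (of_int m * z)) / (\<i> * of_int m)) has_field_derivative exp (\<i> * (of_int m * of_real x)))
        (at (of_real x))"
      using False by (auto intro!: derivative_eq_intros simp: mult_ac)
    from has_vector_derivative_real_field[OF this]
    show "(F has_vector_derivative exp (\<i> * of_real (of_int m * x))) (at x within {0..2 * pi})"
      by (simp add: F_def[abs_def])
  qed (auto intro!: continuous_intros)
  moreover have "exp (\<i> * of_real (of_int m * (2 * pi))) = 1"
  proof -
    have eq: "\<i> * of_real (of_int m * (2 * pi)) = 2 * of_int m * of_real pi * \<i>" by simp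
    show ?thesis unfolding eq using exp_integer_2pi[of "of_int m"] by simp
  qed
  ultimately show ?thesis using False by (simp add: F_def)
qed

lemma absolutely_integrable_exp_torus:
  "(\<lambda>x. exp (\<i> * of_real (\<xi> \<bullet> x))) absolutely_integrable_on (torus_cell :: 'a :: euclidean_space set)"
  unfolding torus_cell_def by (intro absolutely_integrable_continuous continuous_intros)

text \<open>Writing Lebesgue measure as a product over the basis turns the integral into a product
  of period integrals, one of which vanishes unless \<xi> = 0.\<close>

lemma integral_exp_torus:
  fixes \<xi> :: "'a :: euclidean_space"
  assumes "\<And>b. b \<in> Basis \<Longrightarrow> \<xi> \<bullet> b \<in> \<int>"
  shows "integral torus_cell (\<lambda>x. exp (\<i> * of_real (\<xi> \<bullet> x)))
    = (if \<xi> = 0 then (2 * of_real pi) ^ DIM('a) else 0)"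
proof -
  have "\<exists>m :: int. \<xi> \<bullet> b = of_int m" if "b \<in> Basis" for b
    using assms[OF that] by (auto elim: Ints_cases)
  then obtain m :: "'a \<Rightarrow> int" where m: "\<And>b. b \<in> Basis \<Longrightarrow> \<xi> \<bullet> b = of_int (m b)" by metis
  interpret product_sigma_finite "\<lambda>_ :: 'a. lborel :: real measure" by unfold_locales
  define h where "h b t = indicator {0..2*pi} t *\<^sub>R exp (\<i> * of_real (of_int (m b) * t))" for b and t :: real
  have h: "has_bochner_integral lborel (h b) (if m b = 0 then 2 * of_real pi else 0)" for b
    unfolding h_def[abs_def] by (rule has_bochner_integral_exp_period)
  let ?f = "\<lambda>x :: 'a. indicator torus_cell x *\<^sub>R exp (\<i> * of_real (\<xi> \<bullet> x))"
  have int: "set_integrable lborel (torus_cell :: 'a set) (\<lambda>x. exp (\<i> * of_real (\<xi> \<bullet> x)))"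
    unfolding torus_cell_def set_integrable_def
    by (intro borel_integrable_compact compact_cbox continuous_intros)
  have "integral torus_cell (\<lambda>x. exp (\<i> * of_real (\<xi> \<bullet> x))) = (\<integral>x. ?f x \<partial>lborel)"
    using set_borel_integral_eq_integral(2)[OF int] by (simp add: set_lebesgue_integral_def)
  also have "\<dots> = (\<integral>f. ?f (\<Sum>b\<in>Basis. f b *\<^sub>R b) \<partial>(\<Pi>\<^sub>M b\<in>Basis. lborel))"
    by (subst lborel_eq, rule integral_distr) (auto simp: torus_cell_def)
  also have "\<dots> = (\<integral>f. (\<Prod>b\<in>Basis. h b (f b)) \<partial>(\<Pi>\<^sub>M b\<in>Basis. lborel))"
  proof (rule Bochner_Integration.integral_cong[OF refl])
    fix f :: "'a \<Rightarrow> real"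
    let ?x = "\<Sum>b\<in>Basis. f b *\<^sub>R b :: 'a"
    have "\<xi> \<bullet> ?x = (\<Sum>b\<in>Basis. of_int (m b) * f b)"
      unfolding inner_sum_right by (intro sum.cong) (auto simp: m)
    then have 1: "exp (\<i> * of_real (\<xi> \<bullet> ?x)) = (\<Prod>b\<in>Basis. exp (\<i> * of_real (of_int (m b) * f b)))"
      by (simp add: sum_distrib_left exp_sum)
    have "?x \<in> torus_cell \<longleftrightarrow> (\<forall>b\<in>Basis. f b \<in> {0..2*pi})"
      by (auto simp: torus_cell_def mem_box)
    then have 2: "indicator torus_cell ?x = (\<Prod>b\<in>Basis. indicator {0..2*pi} (f b) :: real)"
      by (auto simp: indicator_def prod_zero_iff)
    show "?f ?x = (\<Prod>b\<in>Basis. h b (f b))"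
      unfolding 1 2 h_def by (simp add: scaleR_conv_of_real prod.distrib)
  qed
  also have "\<dots> = (\<Prod>b\<in>Basis. \<integral>t. h b t \<partial>lborel)"
    by (rule product_integral_prod) (use h in \<open>auto intro: has_bochner_integral_integrable simp: has_bochner_integral_iff\<close>)
  also have "\<dots> = (\<Prod>b\<in>Basis. if m b = 0 then 2 * of_real pi else 0)"
    using h by (simp add: has_bochner_integral_iff)
  also have "\<dots> = (if \<xi> = 0 then (2 * of_real pi) ^ DIM('a) else 0)"
  proof -
    have "\<xi> = 0 \<longleftrightarrow> (\<forall>b\<in>Basis. m b = 0)"
      unfolding euclidean_eq_iff[of \<xi> 0] by (simp add: m)
    then show ?thesis by auto
  qed
  finally show ?thesis .
qed

lemma integrable_fourier_integrand:
  fixes f :: "'a :: euclidean_space \<Rightarrow> complex"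
  assumes "f absolutely_integrable_on torus_cell"
  shows "(\<lambda>x. f x * exp (- (\<i> * of_real (\<xi> \<bullet> x)))) integrable_on torus_cell"
proof -
  let ?e = "\<lambda>x :: 'a. exp (- (\<i> * of_real (\<xi> \<bullet> x)))"
  have S: "(torus_cell :: 'a set) \<in> sets lebesgue" by (simp add: torus_cell_def)
  have m: "?e \<in> borel_measurable (lebesgue_on torus_cell)"
    using S by (intro continuous_imp_measurable_on_sets_lebesgue continuous_intros)
  have b: "bounded (?e ` torus_cell)"
    by (auto simp: bounded_iff norm_exp intro!: exI[of _ 1])
  have "(\<lambda>x. ?e x * f x) absolutely_integrable_on torus_cell"
    by (rule absolutely_integrable_bounded_measurable_product[OF bilinear_times m S b assms])
  then show ?thesis by (simp add: mult.commute absolutely_integrable_on_def)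
qed

section \<open>Linearity of the Fourier coefficients\<close>

lemma fourier_coeff_diff:
  assumes "f absolutely_integrable_on torus_cell" "g absolutely_integrable_on torus_cell"
  shows "fourier_coeff (\<lambda>x. f x - g x) \<xi> = fourier_coeff f \<xi> - fourier_coeff g \<xi>"
  using integral_diff[OF assms[THEN integrable_fourier_integrand], of \<xi> \<xi>]
  by (simp add: fourier_coeff_def left_diff_distrib diff_divide_distrib)

lemma fourier_coeff_sum:
  assumes "\<And>i. i \<in> I \<Longrightarrow> f i absolutely_integrable_on torus_cell" "finite I"
  shows "(\<lambda>x. \<Sum>i\<in>I. f i x) absolutely_integrable_on torus_cell"
    "fourier_coeff (\<lambda>x. \<Sum>i\<in>I. f i x) \<xi> = (\<Sum>i\<in>I. fourier_coeff (f i) \<xi>)"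
proof -
  show "(\<lambda>x. \<Sum>i\<in>I. f i x) absolutely_integrable_on torus_cell"
    using assms by (intro absolutely_integrable_sum) auto
  have "integral torus_cell (\<lambda>x. \<Sum>i\<in>I. f i x * exp (- (\<i> * of_real (\<xi> \<bullet> x))))
      = (\<Sum>i\<in>I. integral torus_cell (\<lambda>x. f i x * exp (- (\<i> * of_real (\<xi> \<bullet> x)))))"
    using assms by (intro integral_sum integrable_fourier_integrand) auto
  then show "fourier_coeff (\<lambda>x. \<Sum>i\<in>I. f i x) \<xi> = (\<Sum>i\<in>I. fourier_coeff (f i) \<xi>)"
    by (simp add: fourier_coeff_def sum_distrib_right sum_divide_distrib)
qed

lemma fourier_coeff_cmult:
  assumes "f absolutely_integrable_on torus_cell"
  shows "(\<lambda>x. c * f x) absolutely_integrable_on torus_cell"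
    "fourier_coeff (\<lambda>x. c * f x) \<xi> = c * fourier_coeff f \<xi>"
proof -
  show "(\<lambda>x. c * f x) absolutely_integrable_on torus_cell"
    using assms by (rule set_integrable_mult_right)
  show "fourier_coeff (\<lambda>x. c * f x) \<xi> = c * fourier_coeff f \<xi>"
    by (simp add: fourier_coeff_def mult.assoc)
qed

lemma real_vec_eq_iff: "real_vec k = real_vec l \<longleftrightarrow> k = l"
  by (simp add: real_vec_def vec_eq_iff)

lemma fourier_coeff_exp:
  "fourier_coeff (\<lambda>x. exp (\<i> * of_real (real_vec l \<bullet> x))) (real_vec k) = (if l = k then 1 else 0)"
proof -
  have "fourier_coeff (\<lambda>x. exp (\<i> * of_real (real_vec l \<bullet> x))) (real_vec k)
      = integral torus_cell (\<lambda>x. exp (\<i> * of_real ((real_vec l - real_vec k) \<bullet> x))) / (2 * of_real pi) ^ CARD('a)"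
    unfolding fourier_coeff_def
    by (simp add: exp_add[symmetric] inner_diff_left algebra_simps)
  also have "\<dots> = (if l = k then 1 else 0)"
  proof (subst integral_exp_torus)
    fix b :: "real ^ 'a" assume "b \<in> Basis"
    then obtain i where "b = axis i 1" by (auto simp: Basis_vec_def)
    then show "(real_vec l - real_vec k) \<bullet> b \<in> \<int>" by (simp add: inner_axis real_vec_def)
  qed (simp add: real_vec_eq_iff)
  finally show ?thesis .
qed

section \<open>Dyadic frequency sets\<close>

text \<open>Doubling removes the power 2^(j-1), which is 1/2 for j = 0, and leaves integer
  inequalities; in particular \<open>freqs 0\<close> contains only 0.\<close>

lemma mem_freqs_iff: "k \<in> freqs j \<longleftrightarrow> - (2 ^ j) \<le> 2 * k \<and> 2 * k < 2 ^ j"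
proof -
  have "(2 :: real) powi (int j - 1) = 2 ^ j / 2"
    by (simp add: power_int_diff)
  then have "k \<in> freqs j \<longleftrightarrow> - (2 ^ j) \<le> 2 * real_of_int k \<and> 2 * real_of_int k < 2 ^ j"
    by (auto simp: freqs_def)
  also have "\<dots> \<longleftrightarrow> real_of_int (- (2 ^ j)) \<le> real_of_int (2 * k) \<and> real_of_int (2 * k) < real_of_int (2 ^ j)"
    by simp
  finally show ?thesis by (simp only: of_int_le_iff of_int_less_iff)
qed

lemma finite_freqs: "finite (freqs j)"
  by (rule finite_subset[of _ "{- (2 ^ j)..2 ^ j}"]) (auto simp: mem_freqs_iff)

lemma freqs_Suc: "k \<in> freqs j \<Longrightarrow> k \<in> freqs (Suc j)"
  by (auto simp: mem_freqs_iff)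

lemma freqs_mono: "k \<in> freqs i \<Longrightarrow> i \<le> j \<Longrightarrow> k \<in> freqs j"
  by (induction j) (auto simp: le_Suc_eq intro: freqs_Suc)

text \<open>\<open>freqs j\<close> is a half-open interval of length 2^j, so two of its members
  differ by less than 2^j. Together with \<open>freqs_residue\<close> this makes it a complete
  system of residues modulo 2^j.\<close>

lemma freqs_unique:
  assumes "l \<in> freqs j" "l' \<in> freqs j" "2 ^ j dvd k - l" "2 ^ j dvd k - l'"
  shows "l = l'"
proof (rule ccontr)
  assume "l \<noteq> l'"
  have "2 ^ j dvd l - l'" using dvd_diff[OF assms(4,3)] by simp
  with \<open>l \<noteq> l'\<close> have "2 ^ j \<le> \<bar>l - l'\<bar>" using dvd_imp_le_int[of "l - l'" "2 ^ j"] by simp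
  with assms(1,2) show False by (auto simp: mem_freqs_iff)
qed

lemma freqs_residue: "\<exists>l\<in>freqs j. 2 ^ j dvd k - l"
proof -
  \<comment> \<open>Half the period, which is 0 for j = 0; shifting by h centres the residues about
    0.\<close>
  define h :: int where "h = 2 ^ j div 2"
  define l where "l = (k + h) mod 2 ^ j - h"
  have h: "2 * h \<le> 2 ^ j" "2 ^ j \<le> 2 * h + 1" by (auto simp: h_def)
  have p: "2 * h = 2 ^ j \<or> j = 0" by (cases j) (auto simp: h_def)
  have "0 \<le> (k + h) mod 2 ^ j" "(k + h) mod 2 ^ j < 2 ^ j" by auto
  with h p have "l \<in> freqs j" by (auto simp: l_def mem_freqs_iff h_def)
  moreover have "k - l = (k + h) - (k + h) mod 2 ^ j" by (simp add: l_def)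
  then have "2 ^ j dvd k - l" by (simp add: minus_mod_eq_mult_div)
  ultimately show ?thesis by blast
qed

lemma card_freqs_le: "card (freqs j) \<le> 2 ^ j"
proof -
  have "inj_on (\<lambda>l. l mod 2 ^ j) (freqs j)"
  proof (rule inj_onI)
    fix l l' assume "l \<in> freqs j" "l' \<in> freqs j" "l mod 2 ^ j = l' mod 2 ^ j"
    then show "l = l'" by (intro freqs_unique[of l j l' l]) (auto simp: mod_eq_dvd_iff)
  qed
  then have "card (freqs j) = card ((\<lambda>l. l mod 2 ^ j) ` freqs j)" by (simp add: card_image)
  also have "\<dots> \<le> card {0..<(2 :: int) ^ j}" by (rule card_mono) auto
  also have "\<dots> = 2 ^ j" by (simp add: nat_power_eq)
  finally show ?thesis .
qed

definition ang :: "int \<Rightarrow> real" where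
  "ang k = 1 + \<bar>real_of_int k\<bar>"

text \<open>The quantity r that decides between the two regimes of an entry. The shift by one in
  \<open>ang\<close> keeps it positive at frequency 0 and matches the Wiener weights.\<close>

definition rat :: "nat \<Rightarrow> int \<Rightarrow> real" where
  "rat j k = ang k / 2 ^ j"

lemma ang_ge_1: "1 \<le> ang k"
  by (simp add: ang_def)

lemma rat_pos: "0 < rat j k"
  using ang_ge_1[of k] by (simp add: rat_def)

lemma ang_le_of_freqs:
  assumes "l \<in> freqs j"
  shows "ang l \<le> 2 ^ j"
proof (cases j)
  case 0
  with assms show ?thesis by (auto simp: mem_freqs_iff ang_def)
next
  case (Suc i)
  have "1 + \<bar>l\<bar> \<le> 2 ^ j"
    using assms one_le_power[of "2 :: int" i] by (auto simp: mem_freqs_iff Suc)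
  then have "real_of_int (1 + \<bar>l\<bar>) \<le> real_of_int (2 ^ j)" by (simp only: of_int_le_iff)
  then show ?thesis by (simp add: ang_def)
qed

text \<open>Origin of the threshold 1/4: a frequency missed on level j has modulus at least half of
  2^j, that is, a quarter of the next power.\<close>

lemma rat_ge_of_not_freqs:
  assumes "k \<notin> freqs j"
  shows "1 / 4 \<le> rat (Suc j) k"
proof -
  have "2 ^ j \<le> 2 * \<bar>k\<bar>" using assms by (auto simp: mem_freqs_iff)
  then have "real_of_int (2 ^ j) \<le> real_of_int (2 * \<bar>k\<bar>)" by (simp only: of_int_le_iff)
  then show ?thesis by (simp add: rat_def ang_def field_simps)
qed

lemma rat_Suc: "rat j k = 2 * rat (Suc j) k"
  by (simp add: rat_def)

text \<open>With j0 the dyadic level of k, min r (1/r) is at most 2^(1 - |j - j0|), and the series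
  over j is geometric on both sides. Rounding the logarithm in j0 costs the factor
  \<open>2 powr g\<close>; the bound does not depend on k.\<close>

lemma nnsum_min_rat_le:
  assumes "0 < g"
  shows "nnsum (\<lambda>j. ennreal (min (rat j k) (1 / rat j k) powr g)) \<le> ennreal (2 powr g * (2 / (1 - 2 powr (- g))))"
proof -
  define j0 where "j0 = nat \<lfloor>log 2 (ang k)\<rfloor>"
  have "0 \<le> log 2 (ang k)" using ang_ge_1[of k] by simp
  then have "real j0 \<le> log 2 (ang k)" "log 2 (ang k) < real j0 + 1" unfolding j0_def by linarith+
  then have j0: "2 powr real j0 \<le> ang k" "ang k < 2 powr (real j0 + 1)"
    using ang_ge_1[of k] by (auto simp: le_log_iff log_less_iff)
  have "min (rat j k) (1 / rat j k) powr g \<le> 2 powr g * 2 powr (- g * \<bar>real j - real j0\<bar>)" for j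
  proof -
    have r: "rat j k = ang k * 2 powr (- real j)"
      by (simp add: rat_def powr_minus powr_realpow divide_simps)
    have "rat j k \<le> 2 powr (real j0 + 1) * 2 powr (- real j)"
      unfolding r using j0 by (intro mult_right_mono) auto
    then have 1: "rat j k \<le> 2 powr (1 - (real j - real j0))" by (simp add: powr_add[symmetric] algebra_simps)
    have "2 powr (- real j) * 2 powr real j0 \<le> rat j k"
      unfolding r mult.commute[of "ang k"] using j0 by (intro mult_left_mono) auto
    then have "2 powr (- (real j - real j0)) \<le> rat j k" by (simp add: powr_add[symmetric] algebra_simps)
    then have "1 / rat j k \<le> 1 / 2 powr (- (real j - real j0))"
      by (intro divide_left_mono) (auto intro!: mult_pos_pos rat_pos)
    also have "\<dots> = 2 powr (real j - real j0)" by (simp add: powr_diff)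
    also have "\<dots> \<le> 2 powr (1 - (real j0 - real j))" by (intro powr_mono) auto
    finally have 2: "1 / rat j k \<le> 2 powr (1 - (real j0 - real j))" .
    from 1 2 have "min (rat j k) (1 / rat j k) \<le> 2 powr (1 - \<bar>real j - real j0\<bar>)"
      by (cases "j0 \<le> j") (auto simp: min_def)
    then have "min (rat j k) (1 / rat j k) powr g \<le> (2 powr (1 - \<bar>real j - real j0\<bar>)) powr g"
      using assms rat_pos[of j k] by (intro powr_mono2) (auto simp: less_imp_le)
    also have "\<dots> = 2 powr g * 2 powr (- g * \<bar>real j - real j0\<bar>)"
      by (simp add: powr_powr powr_add[symmetric] algebra_simps)
    finally show ?thesis .
  qed
  then have "nnsum (\<lambda>j. ennreal (min (rat j k) (1 / rat j k) powr g))
      \<le> nnsum (\<lambda>j. ennreal (2 powr g) * ennreal (2 powr (- g * \<bar>real j - real j0\<bar>)))"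
    by (intro nn_integral_mono) (auto simp flip: ennreal_mult intro!: ennreal_leI)
  also have "\<dots> = ennreal (2 powr g) * nnsum (\<lambda>j. ennreal (2 powr (- g * \<bar>real j - real j0\<bar>)))"
    by (rule nn_integral_cmult) auto
  also have "\<dots> \<le> ennreal (2 powr g) * ennreal (2 / (1 - 2 powr (- g)))"
    by (intro mult_left_mono nnsum_powr_abs_le assms) auto
  finally show ?thesis using assms by (simp flip: ennreal_mult')
qed

lemma nnsum_int_powr_finite:
  assumes "0 < e"
  shows "\<exists>C\<ge>0. nnsum (\<lambda>\<mu> :: int. ennreal ((1 + \<bar>real_of_int \<mu>\<bar>) powr (- (1 + e)))) \<le> ennreal C"
proof -
  define g where "g n = (1 + real n) powr (- (1 + e))" for n
  have "summable (\<lambda>n. real n powr (- (1 + e)))" using assms by (simp add: summable_real_powr_iff)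
  then have s: "summable g"
    using summable_Suc_iff[of "\<lambda>n. real n powr (- (1 + e))"] by (simp add: g_def[abs_def] add.commute)
  have "nnsum (\<lambda>\<mu> :: int. ennreal ((1 + \<bar>real_of_int \<mu>\<bar>) powr (- (1 + e))))
      \<le> nnsum (\<lambda>\<mu> :: int. (if 0 \<le> \<mu> then ennreal (g (nat \<mu>)) else 0) + (if \<mu> < 0 then ennreal (g (nat (- \<mu>))) else 0))"
    by (intro nn_integral_mono) (auto simp: g_def)
  also have "\<dots> = nnsum (\<lambda>\<mu> :: int. (if 0 \<le> \<mu> then ennreal (g (nat \<mu>)) else 0))
      + nnsum (\<lambda>\<mu> :: int. (if \<mu> < 0 then ennreal (g (nat (- \<mu>))) else 0))"
    by (rule nn_integral_add) auto
  also have "\<dots> \<le> nnsum (\<lambda>n. ennreal (g n)) + nnsum (\<lambda>n. ennreal (g n))"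
    by (intro add_mono nnsum_inj_le[of nat "{0..}"] nnsum_inj_le[of "\<lambda>\<mu>. nat (- \<mu>)" "{..<0}"])
       (auto simp: inj_on_def)
  also have "nnsum (\<lambda>n. ennreal (g n)) = ennreal (suminf g)"
    by (rule nnsum_ennreal_suminf[OF s]) (simp add: g_def)
  also have "ennreal (suminf g) + ennreal (suminf g) = ennreal (2 * suminf g)"
    using suminf_nonneg[OF s] by (simp add: g_def flip: ennreal_plus)
  finally show ?thesis using suminf_nonneg[OF s] by (intro exI[of _ "2 * suminf g"]) (auto simp: g_def)
qed

text \<open>For |\<mu>| >= 2 the frequency is at least 2^j (|\<mu>| - 1/2) in modulus, so r grows
  linearly in \<mu>; for |\<mu>| <= 1 the 1 in the maximum is enough.\<close>

lemma max_rat_ge: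
  assumes "l \<in> freqs j"
  shows "(1 + \<bar>real_of_int \<mu>\<bar>) / 4 \<le> max 1 (rat j (l + 2 ^ j * \<mu>))"
proof (cases "\<bar>\<mu>\<bar> \<le> 1")
  case True
  then have "real_of_int \<bar>\<mu>\<bar> \<le> 1" by (simp only: of_int_le_1_iff)
  then show ?thesis by (simp add: max_def)
next
  case False
  have "2 * \<bar>l\<bar> \<le> 2 ^ j" using assms by (auto simp: mem_freqs_iff)
  then have "real_of_int (2 * \<bar>l\<bar>) \<le> real_of_int (2 ^ j)" by (simp only: of_int_le_iff)
  then have l: "\<bar>real_of_int l\<bar> \<le> 2 ^ j / 2" by simp
  have m: "2 \<le> \<bar>real_of_int \<mu>\<bar>" using False by linarith
  have "2 ^ j * ((1 + \<bar>real_of_int \<mu>\<bar>) / 4) \<le> 2 ^ j * (\<bar>real_of_int \<mu>\<bar> - 1 / 2)"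
    using m by (intro mult_left_mono) auto
  also have "\<dots> \<le> \<bar>2 ^ j * real_of_int \<mu>\<bar> - \<bar>real_of_int l\<bar>"
    using l by (simp add: abs_mult algebra_simps)
  also have "\<dots> \<le> ang (l + 2 ^ j * \<mu>)" by (simp add: ang_def)
  finally have "(1 + \<bar>real_of_int \<mu>\<bar>) / 4 \<le> rat j (l + 2 ^ j * \<mu>)"
    by (simp add: rat_def field_simps)
  then show ?thesis by simp
qed

lemma max_powr_le_one: "0 \<le> c \<Longrightarrow> max 1 x powr (- c) \<le> (1 :: real)"
  using powr_mono[of "- c" 0 "max 1 x"] by (auto simp: max_def split: if_splits)

text \<open>Along a residue class the family is comparable to (1 + |\<mu>|)^(-(w + e)); raising it
  to the power 1/w gives the exponent 1 + e/w > 1 of a convergent series. For w = 0 the family is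
  simply bounded.\<close>

lemma lnorm_max_rat_progression:
  assumes "0 \<le> w" "0 < e"
  shows "\<exists>C\<ge>0. \<forall>j. \<forall>l\<in>freqs j.
    lnorm w (\<lambda>\<mu>. ennreal (max 1 (rat j (l + 2 ^ j * \<mu>)) powr (- (w + e)))) \<le> ennreal C"
proof (cases "w = 0")
  case True
  have "ennreal (max 1 x powr (- e)) \<le> ennreal 1" for x
    using assms by (intro ennreal_leI max_powr_le_one) auto
  then show ?thesis using True
    by (intro exI[of _ 1] conjI ballI allI) (simp_all add: lnorm_0 SUP_le_iff)
next
  case False
  with assms have w: "0 < w" by simp
  obtain C where C: "0 \<le> C" "nnsum (\<lambda>\<mu> :: int. ennreal ((1 + \<bar>real_of_int \<mu>\<bar>) powr (- (1 + e / w)))) \<le> ennreal C"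
    using nnsum_int_powr_finite[of "e / w"] w assms by auto
  have "lnorm w (\<lambda>\<mu>. ennreal (max 1 (rat j (l + 2 ^ j * \<mu>)) powr (- (w + e)))) \<le> ennreal (4 powr (w + e) * C powr w)"
    if l: "l \<in> freqs j" for j l
  proof -
    have pt: "max 1 (rat j (l + 2 ^ j * \<mu>)) powr (- (w + e)) \<le> 4 powr (w + e) * (1 + \<bar>real_of_int \<mu>\<bar>) powr (- (w + e))" for \<mu>
    proof -
      have "max 1 (rat j (l + 2 ^ j * \<mu>)) powr (- (w + e)) \<le> ((1 + \<bar>real_of_int \<mu>\<bar>) / 4) powr (- (w + e))"
        using max_rat_ge[OF l] w assms by (intro powr_mono2') auto
      also have "\<dots> = 4 powr (w + e) * (1 + \<bar>real_of_int \<mu>\<bar>) powr (- (w + e))"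
      proof -
        have "(x / 4) powr (- t) = 4 powr t * x powr (- t)" if "0 \<le> x" for x t :: real
          using that by (simp add: powr_divide powr_minus divide_simps)
        from this[of "1 + \<bar>real_of_int \<mu>\<bar>" "w + e"] show ?thesis by simp
      qed
      finally show ?thesis .
    qed
    have "lnorm w (\<lambda>\<mu>. ennreal (max 1 (rat j (l + 2 ^ j * \<mu>)) powr (- (w + e))))
      \<le> lnorm w (\<lambda>\<mu>. ennreal (4 powr (w + e)) * ennreal ((1 + \<bar>real_of_int \<mu>\<bar>) powr (- (w + e))))"
      using pt w by (intro lnorm_mono) (auto simp flip: ennreal_mult intro!: ennreal_leI)
    also have "\<dots> = ennreal (4 powr (w + e)) * lnorm w (\<lambda>\<mu> :: int. ennreal ((1 + \<bar>real_of_int \<mu>\<bar>) powr (- (w + e))))"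
      by (rule lnorm_cmult)
    also have "lnorm w (\<lambda>\<mu> :: int. ennreal ((1 + \<bar>real_of_int \<mu>\<bar>) powr (- (w + e))))
        = epow (nnsum (\<lambda>\<mu> :: int. ennreal ((1 + \<bar>real_of_int \<mu>\<bar>) powr (- (1 + e / w))))) w"
      using w by (simp add: lnorm_def epow_ennreal powr_powr diff_divide_distrib)
    also have "\<dots> \<le> epow (ennreal C) w" using w by (intro epow_mono C) auto
    also have "\<dots> = ennreal (C powr w)" using C by (simp add: epow_ennreal)
    finally show ?thesis by (simp add: mult_left_mono flip: ennreal_mult)
  qed
  then show ?thesis by (intro exI[of _ "4 powr (w + e) * C powr w"]) auto
qed

text \<open>Sums the previous bound over at most 2^j residue classes; the power w of their number is
  the factor \<open>2 powr (w * real j)\<close>. Used with w = \<sigma>, it is how \<sigma> enters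
  the exponent of the rate.\<close>

lemma lnorm_max_rat:
  assumes "0 \<le> w" "0 < e"
  shows "\<exists>C\<ge>0. \<forall>j. lnorm w (\<lambda>k. ennreal (max 1 (rat j k) powr (- (w + e)))) \<le> ennreal (C * 2 powr (w * real j))"
proof (cases "w = 0")
  case True
  have "ennreal (max 1 x powr (- e)) \<le> ennreal 1" for x
    using assms by (intro ennreal_leI max_powr_le_one) auto
  then show ?thesis using True
    by (intro exI[of _ 1] conjI ballI allI) (simp_all add: lnorm_0 SUP_le_iff)
next
  case False
  with assms have w: "0 < w" by simp
  obtain C where C: "0 \<le> C" "\<And>j l. l \<in> freqs j \<Longrightarrow> 
    lnorm w (\<lambda>\<mu>. ennreal (max 1 (rat j (l + 2 ^ j * \<mu>)) powr (- (w + e)))) \<le> ennreal C"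
    using lnorm_max_rat_progression[OF assms] by blast
  define g where "g j k = epow (ennreal (max 1 (rat j k) powr (- (w + e)))) (1 / w)" for j k
  have g: "nnsum (\<lambda>\<mu>. g j (l + 2 ^ j * \<mu>)) \<le> ennreal (C powr (1 / w))" if "l \<in> freqs j" for j l
  proof -
    have "epow (nnsum (\<lambda>\<mu>. g j (l + 2 ^ j * \<mu>))) w \<le> ennreal C"
      using C(2)[OF that] w by (simp add: lnorm_def g_def)
    then have "epow (epow (nnsum (\<lambda>\<mu>. g j (l + 2 ^ j * \<mu>))) w) (1 / w) \<le> epow (ennreal C) (1 / w)"
      using w by (intro epow_mono) auto
    then show ?thesis using w C(1) by (simp add: epow_epow epow_ennreal)
  qed
  have "nnsum (g j) \<le> ennreal (2 ^ j * C powr (1 / w))" for j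
  proof -
    have "nnsum (g j) \<le> nnsum (\<lambda>k. \<Sum>l\<in>freqs j. if 2 ^ j dvd k - l then g j k else 0)"
    proof (rule nn_integral_mono)
      fix k
      obtain l where l: "l \<in> freqs j" "2 ^ j dvd k - l" using freqs_residue by blast
      then have "g j k = (if 2 ^ j dvd k - l then g j k else 0)" by simp
      also have "\<dots> \<le> (\<Sum>l\<in>freqs j. if 2 ^ j dvd k - l then g j k else 0)"
        using l by (intro member_le_sum) (auto simp: finite_freqs)
      finally show "g j k \<le> (\<Sum>l\<in>freqs j. if 2 ^ j dvd k - l then g j k else 0)" .
    qed
    also have "\<dots> = (\<Sum>l\<in>freqs j. nnsum (\<lambda>k. if 2 ^ j dvd k - l then g j k else 0))"
      by (rule nn_integral_sum) auto
    also have "\<dots> \<le> (\<Sum>l\<in>freqs j. ennreal (C powr (1 / w)))"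
    proof (rule sum_mono)
      fix l assume l: "l \<in> freqs j"
      have "nnsum (\<lambda>k. if 2 ^ j dvd k - l then g j k else 0) \<le> nnsum (\<lambda>\<mu>. g j (l + 2 ^ j * \<mu>))"
      proof (rule nnsum_inj_le[of "\<lambda>k. (k - l) div 2 ^ j" "{k. 2 ^ j dvd k - l}"])
        show "inj_on (\<lambda>k. (k - l) div 2 ^ j) {k. 2 ^ j dvd k - l}"
          by (auto simp: inj_on_def elim!: dvdE)
      qed auto
      also have "\<dots> \<le> ennreal (C powr (1 / w))" by (rule g[OF l])
      finally show "nnsum (\<lambda>k. if 2 ^ j dvd k - l then g j k else 0) \<le> ennreal (C powr (1 / w))" .
    qed
    also have "\<dots> = ennreal (real (card (freqs j)) * C powr (1 / w))"
      by (simp add: ennreal_mult ennreal_of_nat_eq_real_of_nat)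
    also have "\<dots> \<le> ennreal (2 ^ j * C powr (1 / w))"
    proof (intro ennreal_leI mult_right_mono)
      have "real (card (freqs j)) \<le> real (2 ^ j)" using card_freqs_le[of j] by (simp only: of_nat_le_iff)
      then show "real (card (freqs j)) \<le> 2 ^ j" by simp
    qed simp
    finally show ?thesis .
  qed
  then have "epow (nnsum (g j)) w \<le> epow (ennreal (2 ^ j * C powr (1 / w))) w" for j
    using w by (intro epow_mono) auto
  moreover have "epow (ennreal (2 ^ j * C powr (1 / w))) w = ennreal (C * 2 powr (w * real j))" for j
  proof -
    have "(2 ^ j * C powr (1 / w)) powr w = (2 powr real j) powr w * (C powr (1 / w)) powr w"
      using C(1) by (simp add: powr_mult powr_realpow)
    also have "\<dots> = C * 2 powr (w * real j)"
      using w C(1) by (simp add: powr_powr mult.commute)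
    finally show ?thesis by (simp add: epow_ennreal)
  qed
  moreover have "lnorm w (\<lambda>k. ennreal (max 1 (rat j k) powr (- (w + e)))) = epow (nnsum (g j)) w" for j
    using w by (simp add: lnorm_def g_def[abs_def])
  ultimately show ?thesis using C(1) by (intro exI[of _ C]) auto
qed

text \<open>A constant in place of Minkowski's inequality: a + b is at most twice the maximum, and
  for u > 0 the power 1/u of the maximum is at most the sum of the powers, which costs another
  factor 2.\<close>

lemma lnorm_add_le:
  assumes "0 \<le> u" "u \<le> 1"
  shows "lnorm u (\<lambda>k. a k + b k) \<le> 4 * (lnorm u a + lnorm u b)"
proof -
  have le: "x + y \<le> 2 * max x y" for x y :: ennreal
    unfolding mult_2 by (intro add_mono) auto
  have max_le: "max x y \<le> x + y" for x y :: ennreal by (auto simp: max_def)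
  have "lnorm u (\<lambda>k. a k + b k) \<le> lnorm u (\<lambda>k. 2 * max (a k) (b k))"
    using assms le by (intro lnorm_mono) auto
  also have "\<dots> = 2 * lnorm u (\<lambda>k. max (a k) (b k))" by (rule lnorm_cmult)
  also have "lnorm u (\<lambda>k. max (a k) (b k)) \<le> 2 * (lnorm u a + lnorm u b)"
  proof (cases "u = 0")
    case True
    have "max (a k) (b k) \<le> lnorm u a + lnorm u b" for k
      using le_lnorm[of u a k] le_lnorm[of u b k] assms by (auto simp: max_def intro: add_increasing add_increasing2)
    then have "lnorm u (\<lambda>k. max (a k) (b k)) \<le> lnorm u a + lnorm u b"
      by (simp add: True lnorm_0 SUP_least)
    also have "\<dots> \<le> 2 * (lnorm u a + lnorm u b)" by (simp add: mult_2)
    finally show ?thesis .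
  next
    case False
    with assms have u: "0 < u" by simp
    define X Y where "X = nnsum (\<lambda>k. epow (a k) (1 / u))" and "Y = nnsum (\<lambda>k. epow (b k) (1 / u))"
    have "nnsum (\<lambda>k. epow (max (a k) (b k)) (1 / u)) \<le> nnsum (\<lambda>k. epow (a k) (1 / u) + epow (b k) (1 / u))"
      by (intro nn_integral_mono) (auto simp: max_def)
    also have "\<dots> = X + Y" unfolding X_def Y_def by (rule nn_integral_add) auto
    also have "\<dots> \<le> 2 * max X Y" by (rule le)
    finally have "lnorm u (\<lambda>k. max (a k) (b k)) \<le> epow (2 * max X Y) u"
      using u by (simp add: lnorm_def epow_mono)
    also have "\<dots> = epow 2 u * epow (max X Y) u" by (rule epow_mult)
    also have "\<dots> \<le> 2 * (epow X u + epow Y u)"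
    proof (rule mult_mono)
      have "epow 2 u = ennreal (2 powr u)" using epow_ennreal[of 2 u] by simp
      also have "\<dots> \<le> ennreal (2 powr 1)" using assms by (intro ennreal_leI powr_mono) auto
      finally show "epow 2 u \<le> 2" by simp
      show "epow (max X Y) u \<le> epow X u + epow Y u" by (auto simp: max_def)
    qed auto
    also have "epow X u + epow Y u = lnorm u a + lnorm u b" using u by (simp add: lnorm_def X_def Y_def)
    finally show ?thesis .
  qed
  also have "2 * (2 * (lnorm u a + lnorm u b)) = 4 * (lnorm u a + lnorm u b)"
    by (simp add: mult.assoc[symmetric])
  finally show ?thesis by (simp add: mult_left_mono)
qed

section \<open>Univariate coefficients of the level differences\<close>

text \<open>\<open>F j l\<close> and \<open>P j k\<close> stand for the Fourier coefficients of \<open>\<phi>\<^sub>j\<close> and of the distributions;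
  \<open>qc F P j l k\<close> is the \<open>l\<close>-th coefficient of the image of the \<open>k\<close>-th exponential under the
  operator of level \<open>j\<close>.\<close>

definition qc :: "(nat \<Rightarrow> int \<Rightarrow> complex) \<Rightarrow> (nat \<Rightarrow> int \<Rightarrow> complex) \<Rightarrow> nat \<Rightarrow> int \<Rightarrow> int \<Rightarrow> complex" where
  "qc F P j l k = (if l \<in> freqs j \<and> 2 ^ j dvd k - l then F j l * P j k else 0)"

definition ec :: "(nat \<Rightarrow> int \<Rightarrow> complex) \<Rightarrow> (nat \<Rightarrow> int \<Rightarrow> complex) \<Rightarrow> nat \<Rightarrow> int \<Rightarrow> int \<Rightarrow> complex" where
  "ec F P j l k = qc F P j l k - (if j = 0 then 0 else qc F P (j - 1) l k)"

text \<open>The size that an entry of \<^const>\<open>ec\<close> is allowed to have; the excess is bounded in norm.\<close>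

definition vfac :: "real \<Rightarrow> real \<Rightarrow> nat \<Rightarrow> int \<Rightarrow> real" where
  "vfac s \<kappa> j k = (if rat j k < 1 then rat j k powr s else rat j k powr \<kappa>)"

lemma vfac_pos: "0 < vfac s \<kappa> j k"
  using rat_pos[of j k] by (simp add: vfac_def)

abbreviation aprod where
  "aprod F P j l k \<equiv> \<Prod>i\<in>UNIV. norm (ec F P (j $ i) (l $ i) (k $ i))"

lemma sum_ec: "(\<Sum>j\<le>n. ec F P j l k) = qc F P n l k"
  by (induction n) (auto simp: ec_def)

lemma ec_support: "l \<notin> freqs j \<Longrightarrow> ec F P j l k = 0"
  using freqs_mono[of l "j - 1" j] by (auto simp: ec_def qc_def)

text \<open>For given k only its representatives on the levels j and j - 1 can occur as l. This is
  the price of the indicator when the norm over l is taken inside.\<close>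

lemma lnorm_ec_support_le:
  assumes "0 \<le> u" "u \<le> 1"
  shows "lnorm u (\<lambda>l. if ec F P j l k = 0 then 0 else 1) \<le> 2"
proof -
  obtain l1 l2 where l: "l1 \<in> freqs j" "2 ^ j dvd k - l1" "l2 \<in> freqs (j - 1)" "2 ^ (j - 1) dvd k - l2"
    using freqs_residue by meson
  have "ec F P j l k = 0" if "l \<notin> {l1, l2}" for l
    using that freqs_unique[of l j l1 k] freqs_unique[of l "j - 1" l2 k] l by (auto simp: ec_def qc_def)
  then have "lnorm 1 (\<lambda>l. if ec F P j l k = 0 then 0 else 1)
      = (\<Sum>l\<in>{l1, l2}. if ec F P j l k = 0 then 0 else 1)"
    unfolding lnorm_1 by (intro nnsum_finite_support) auto
  also have "\<dots> \<le> (\<Sum>l\<in>{l1, l2}. 1)" by (intro sum_mono) auto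
  also have "\<dots> = of_nat (card {l1, l2})" by simp
  also have "\<dots> \<le> 2" by (cases "l1 = l2") auto
  finally show ?thesis using lnorm_antimono[OF assms] order_trans by blast
qed

text \<open>Reduces the operators to two arrays of coefficients, with u = 1/q and hence 1 - u =
  1/q'. The assumption \<open>P_le\<close> is the common form of the two alternatives of the
  theorem: a bound on residue classes, damped by the exponent \<kappa>.\<close>

locale quasi_coeffs =
  fixes F P :: "nat \<Rightarrow> int \<Rightarrow> complex" and u \<kappa> s C2 C3 C4 :: real
  assumes u: "0 \<le> u" "u \<le> 1" and \<kappa>: "0 \<le> \<kappa>" and s: "0 < s" and C: "0 \<le> C2" "0 \<le> C3" "0 \<le> C4"
    and F_le: "\<And>j l. norm (F j l) \<le> C2"
    and FP_le: "\<And>j l. l \<in> freqs j \<Longrightarrow> norm (1 - F j l * P j l) \<le> C3 * \<bar>real_of_int l / 2 ^ j\<bar> powr s"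
    and P_le: "\<And>j l. l \<in> freqs j \<Longrightarrow>
      lnorm (1 - u) (\<lambda>\<mu>. ennreal (norm (P j (l + 2 ^ j * \<mu>)) * max 1 (rat j (l + 2 ^ j * \<mu>)) powr (- \<kappa>))) \<le> ennreal C4"
begin

text \<open>The damped coefficients of the residue class of l, extended by zero to all k, so that
  row bounds can be added.\<close>

definition hi :: "nat \<Rightarrow> int \<Rightarrow> int \<Rightarrow> real" where
  "hi j l k = (if l \<in> freqs j \<and> 2 ^ j dvd k - l then norm (P j k) * max 1 (rat j k) powr (- \<kappa>) else 0)"

lemma hi_nonneg: "0 \<le> hi j l k"
  by (simp add: hi_def)

lemma lnorm_hi: "lnorm (1 - u) (\<lambda>k. ennreal (hi j l k)) \<le> ennreal C4"
proof (cases "l \<in> freqs j")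
  case False
  then show ?thesis using u by (simp add: hi_def lnorm_zero)
next
  case True
  have inj: "inj_on (\<lambda>k. (k - l) div 2 ^ j) {k. 2 ^ j dvd k - l}"
    by (auto simp: inj_on_def elim!: dvdE)
  define g where "g \<mu> = ennreal (norm (P j (l + 2 ^ j * \<mu>)) * max 1 (rat j (l + 2 ^ j * \<mu>)) powr (- \<kappa>))" for \<mu>
  have eq: "ennreal (hi j l k) = g ((k - l) div 2 ^ j)" if "2 ^ j dvd k - l" for k
    using that True by (simp add: hi_def g_def)
  have "lnorm (1 - u) (\<lambda>k. ennreal (hi j l k)) \<le> lnorm (1 - u) g"
  proof (cases "u = 1")
    case True
    have "ennreal (hi j l k) \<le> (SUP \<mu>. g \<mu>)" for k
      using eq[of k] by (cases "2 ^ j dvd k - l") (auto simp: hi_def intro: SUP_upper)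
    then show ?thesis using True by (auto simp: lnorm_0 intro: SUP_least)
  next
    case False
    have "nnsum (\<lambda>k. epow (ennreal (hi j l k)) (1 / (1 - u))) \<le> nnsum (\<lambda>\<mu>. epow (g \<mu>) (1 / (1 - u)))"
      by (rule nnsum_inj_le[OF inj]) (auto simp: eq, simp add: hi_def)
    then show ?thesis using False u by (simp add: lnorm_def epow_mono)
  qed
  also have "\<dots> \<le> ennreal C4" unfolding g_def by (rule P_le[OF True])
  finally show ?thesis .
qed

text \<open>\<open>Ka\<close> collects the reproduction errors of the levels j and j - 1, the latter
  with twice the ratio. In \<open>Kb\<close>, \<open>4 powr s\<close> bounds 1 / r^s for r >= 1/4,
  and \<open>2 powr \<kappa>\<close> pays for measuring the damping with the ratio of level j -
  1.\<close>

definition Ka where "Ka = C3 * (1 + 2 powr s)"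
definition Kb where "Kb = 4 powr s * C2 * 2 powr \<kappa>"

text \<open>A frequency k in \<open>freqs (j - 1)\<close> represents itself on both levels, so only
  l = k survives and the entry is a difference of two reproduction errors, small by cancellation. In
  the other case, which includes j = 0, r is at least 1/4 and the two terms of the entry are bounded
  separately.\<close>

lemma ec_div_vfac_le:
  "norm (ec F P j l k) / vfac s \<kappa> j k
     \<le> (if k = l then Ka else 0) + (Kb * hi j l k + Kb * (if j = 0 then 0 else hi (j - 1) l k))"
proof -
  have K: "0 \<le> Ka" "0 \<le> Kb" using C by (auto simp: Ka_def Kb_def)
  define R where "R = Kb * hi j l k + Kb * (if j = 0 then 0 else hi (j - 1) l k)"
  have R: "0 \<le> R" using K by (simp add: R_def hi_nonneg)
  show ?thesis
  proof (cases "j \<noteq> 0 \<and> k \<in> freqs (j - 1)")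
    case True
    then obtain i where i: "j = Suc i" "k \<in> freqs i" by (cases j) auto
    have kj: "k \<in> freqs j" using freqs_Suc i by simp
    show ?thesis
    proof (cases "k = l")
      case False
      have "ec F P j l k = 0"
        using False freqs_unique[of l j k k] freqs_unique[of l i k k] i kj by (auto simp: ec_def qc_def)
      then show ?thesis using False R unfolding R_def[symmetric] by simp
    next
      case True
      have "rat j k < 1"
        using ang_le_of_freqs[OF i(2)] by (simp add: rat_def i(1) field_simps) (smt (verit) zero_less_power)
      then have v: "vfac s \<kappa> j k = rat j k powr s" by (simp add: vfac_def)
      have "ec F P j l k = (1 - F i k * P i k) - (1 - F j k * P j k)"
        using i kj True by (simp add: ec_def qc_def)
      then have "norm (ec F P j l k) \<le> norm (1 - F i k * P i k) + norm (1 - F j k * P j k)"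
        by (simp only: norm_triangle_ineq4)
      also have "\<dots> \<le> C3 * \<bar>real_of_int k / 2 ^ i\<bar> powr s + C3 * \<bar>real_of_int k / 2 ^ j\<bar> powr s"
        by (intro add_mono FP_le i kj)
      also have "\<bar>real_of_int k / 2 ^ i\<bar> = 2 * \<bar>real_of_int k / 2 ^ j\<bar>" by (simp add: i(1))
      also have "C3 * (2 * \<bar>real_of_int k / 2 ^ j\<bar>) powr s + C3 * \<bar>real_of_int k / 2 ^ j\<bar> powr s
          = Ka * \<bar>real_of_int k / 2 ^ j\<bar> powr s"
        by (simp only: powr_mult Ka_def) (simp add: algebra_simps)
      also have "\<dots> \<le> Ka * rat j k powr s"
        using K s by (intro mult_left_mono powr_mono2) (auto simp: rat_def ang_def divide_right_mono)
      finally have "norm (ec F P j l k) / vfac s \<kappa> j k \<le> Ka"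
        using vfac_pos[of s \<kappa> j k] by (simp add: v divide_le_eq)
      then show ?thesis using True R unfolding R_def[symmetric] by simp
    qed
  next
    case False
    have r: "1 / 4 \<le> rat j k"
    proof (cases j)
      case 0
      then show ?thesis using ang_ge_1[of k] by (simp add: rat_def)
    next
      case (Suc i)
      with False have "k \<notin> freqs i" by simp
      then show ?thesis using rat_ge_of_not_freqs Suc by simp
    qed
    have v: "1 / vfac s \<kappa> j k \<le> 4 powr s * max 1 (rat j k) powr (- \<kappa>)"
    proof (cases "rat j k < 1")
      case True
      have "1 / rat j k powr s = (1 / rat j k) powr s" using rat_pos[of j k] by (simp add: powr_divide)
      also have "\<dots> \<le> 4 powr s"
        using r s rat_pos[of j k] by (intro powr_mono2) (auto simp: field_simps)
      finally show ?thesis using True by (simp add: vfac_def max_def)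
    next
      case False
      have "1 \<le> 4 powr s" using s by (intro ge_one_powr_ge_zero) auto
      then have "1 * rat j k powr (- \<kappa>) \<le> 4 powr s * rat j k powr (- \<kappa>)" by (intro mult_right_mono) auto
      with False show ?thesis by (simp add: vfac_def max_def powr_minus_divide)
    qed
    have qb: "norm (qc F P i l k) / vfac s \<kappa> j k \<le> Kb * hi i l k" if i: "i = j \<or> j = Suc i" for i
    proof (cases "l \<in> freqs i \<and> 2 ^ i dvd k - l")
      case True
      have "max 1 (rat i k) / 2 \<le> max 1 (rat j k)"
        using i rat_Suc[of i k] rat_pos[of j k] by auto
      then have "max 1 (rat j k) powr (- \<kappa>) \<le> (max 1 (rat i k) / 2) powr (- \<kappa>)"
        using \<kappa> by (intro powr_mono2') auto
      also have "\<dots> = 2 powr \<kappa> * max 1 (rat i k) powr (- \<kappa>)"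
        by (simp add: powr_divide powr_minus_divide)
      finally have m: "max 1 (rat j k) powr (- \<kappa>) \<le> 2 powr \<kappa> * max 1 (rat i k) powr (- \<kappa>)" .
      have "norm (qc F P i l k) / vfac s \<kappa> j k = norm (F i l) * norm (P i k) * (1 / vfac s \<kappa> j k)"
        using True by (simp add: qc_def norm_mult)
      also have "\<dots> \<le> C2 * norm (P i k) * (4 powr s * max 1 (rat j k) powr (- \<kappa>))"
        using v F_le[of i l] C vfac_pos[of s \<kappa> j k] by (intro mult_mono) auto
      also have "\<dots> \<le> C2 * norm (P i k) * (4 powr s * (2 powr \<kappa> * max 1 (rat i k) powr (- \<kappa>)))"
        using m C by (intro mult_left_mono) auto
      also have "\<dots> = Kb * hi i l k" using True by (simp add: hi_def Kb_def)
      finally show ?thesis .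
    qed (use K hi_nonneg in \<open>auto simp: qc_def intro!: mult_nonneg_nonneg\<close>)
    have "norm (ec F P j l k) / vfac s \<kappa> j k \<le> R"
    proof (cases j)
      case 0
      then show ?thesis using qb[of j] by (simp add: ec_def R_def)
    next
      case (Suc i)
      have "norm (ec F P j l k) / vfac s \<kappa> j k \<le> (norm (qc F P j l k) + norm (qc F P i l k)) / vfac s \<kappa> j k"
        using vfac_pos[of s \<kappa> j k] by (intro divide_right_mono) (auto simp: ec_def Suc norm_triangle_ineq4)
      also have "\<dots> \<le> R" using qb[of j] qb[of i] by (simp add: add_divide_distrib R_def Suc)
      finally show ?thesis .
    qed
    then show ?thesis using K unfolding R_def[symmetric] by auto
  qed
qed

text \<open>Each factor 4 comes from one use of \<open>lnorm_add_le\<close>, on the diagonal term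
  and the two damped rows.\<close>

definition KA where "KA = 4 * (Ka + 4 * (Kb * C4 + Kb * C4))"

lemma KA_nonneg: "0 \<le> KA"
  using C by (simp add: KA_def Ka_def Kb_def)

lemma lnorm_ec_div_vfac_le:
  "lnorm (1 - u) (\<lambda>k. ennreal (norm (ec F P j l k) / vfac s \<kappa> j k)) \<le> (if l \<in> freqs j then ennreal KA else 0)"
proof (cases "l \<in> freqs j")
  case False
  then show ?thesis using u by (simp add: ec_support lnorm_zero)
next
  case True
  have K: "0 \<le> Ka" "0 \<le> Kb" using C by (auto simp: Ka_def Kb_def)
  have u': "0 \<le> 1 - u" "1 - u \<le> 1" using u by auto
  let ?a = "\<lambda>k. ennreal (if k = l then Ka else 0)" and ?b = "\<lambda>k. ennreal Kb * ennreal (hi j l k)"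
    and ?c = "\<lambda>k. ennreal Kb * ennreal (if j = 0 then 0 else hi (j - 1) l k)"
  have "lnorm (1 - u) (\<lambda>k. ennreal (norm (ec F P j l k) / vfac s \<kappa> j k)) \<le> lnorm (1 - u) (\<lambda>k. ?a k + (?b k + ?c k))"
    using ec_div_vfac_le[of j l] u' K
    by (intro lnorm_mono) (auto simp: hi_nonneg simp flip: ennreal_mult ennreal_plus intro!: ennreal_leI)
  also have "\<dots> \<le> 4 * (lnorm (1 - u) ?a + lnorm (1 - u) (\<lambda>k. ?b k + ?c k))"
    by (rule lnorm_add_le[OF u'])
  also have "\<dots> \<le> 4 * (lnorm (1 - u) ?a + 4 * (lnorm (1 - u) ?b + lnorm (1 - u) ?c))"
    by (intro mult_left_mono add_left_mono lnorm_add_le u') auto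
  also have "\<dots> \<le> 4 * (ennreal Ka + 4 * (ennreal Kb * ennreal C4 + ennreal Kb * ennreal C4))"
  proof (intro mult_left_mono add_mono)
    have "lnorm (1 - u) ?a \<le> lnorm 1 ?a" by (rule lnorm_antimono[OF u'])
    also have "\<dots> = (\<Sum>k\<in>{l}. ennreal (if k = l then Ka else 0))"
      unfolding lnorm_1 by (rule nnsum_finite_support) auto
    also have "\<dots> = ennreal Ka" by simp
    finally show "lnorm (1 - u) ?a \<le> ennreal Ka" .
    show "lnorm (1 - u) ?b \<le> ennreal Kb * ennreal C4"
      unfolding lnorm_cmult by (intro mult_left_mono lnorm_hi) auto
    show "lnorm (1 - u) ?c \<le> ennreal Kb * ennreal C4"
      unfolding lnorm_cmult using lnorm_hi u' by (cases "j = 0") (auto intro!: mult_left_mono simp: lnorm_zero)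
  qed auto
  also have "\<dots> = ennreal KA"
    unfolding KA_def using K C by (simp flip: ennreal_mult ennreal_plus ennreal_numeral)
  finally show ?thesis using True by simp
qed

end

section \<open>Multivariate weights\<close>

definition angv :: "int ^ 'd \<Rightarrow> real" where
  "angv k = 1 + norm (real_vec k)"

lemma ang_le_angv: "ang (k $ i) \<le> angv k"
  using component_le_norm_cart[of "real_vec k" i] by (simp add: ang_def angv_def real_vec_def)

lemma angv_ge_1: "1 \<le> angv k"
  by (simp add: angv_def)

lemma angv_le_sum: "angv (k :: int ^ 'd) \<le> (\<Sum>i\<in>UNIV. ang (k $ i))"
proof -
  have "norm (real_vec k) \<le> (\<Sum>i\<in>UNIV. \<bar>real_of_int (k $ i)\<bar>)"
    using norm_le_l1_cart[of "real_vec k"] by (simp add: real_vec_def)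
  moreover have "1 \<le> real CARD('d)"
    using zero_less_card_finite[where 'a='d] by linarith
  ultimately show ?thesis unfolding angv_def ang_def sum.distrib sum_constant by linarith
qed

text \<open>The factor \<open>v1\<close> makes the sum over the frequencies finite, \<open>v2\<close> the sum over the levels.\<close>

definition v1 :: "real \<Rightarrow> nat \<Rightarrow> int \<Rightarrow> real" where
  "v1 c j k = max 1 (rat j k) powr (- c)"

definition v2 :: "real \<Rightarrow> nat \<Rightarrow> int \<Rightarrow> real" where
  "v2 \<delta> j k = min (rat j k) (1 / rat j k) powr \<delta>"

lemma prod_ge_one_member:
  fixes f :: "'a \<Rightarrow> real"
  assumes "finite A" "i \<in> A" "\<And>x. x \<in> A \<Longrightarrow> 1 \<le> f x"
  shows "f i \<le> prod f A"
proof -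
  have "prod f A = f i * prod f (A - {i})" using assms by (intro prod.remove) auto
  moreover have "1 \<le> prod f (A - {i})" using assms by (intro prod_ge_1) auto
  moreover have "0 \<le> f i" using assms by (meson order_trans zero_le_one)
  ultimately show ?thesis using mult_left_mono[of 1 "prod f (A - {i})" "f i"] by simp
qed

text \<open>Replaces the isotropic weight of k by that of j at the cost of factors in the single
  ratios. For \<beta> >= 0, \<open>angv k\<close> is at least 2^(linf j) times the ratio in a
  coordinate attaining the maximum; for \<beta> < 0 it is at most d 2^(linf j) times the product of
  max 1 r over the coordinates.\<close>

lemma isotropic_weight_le:
  fixes k :: "int ^ 'd"
  shows "angv k powr (- \<beta>) \<le> real CARD('d) powr \<bar>\<beta>\<bar> * 2 powr (- \<beta> * real (linf j)) *
    (\<Prod>i\<in>UNIV. if 0 \<le> \<beta> then max 1 (1 / rat (j $ i) (k $ i)) powr \<beta> else max 1 (rat (j $ i) (k $ i)) powr (- \<beta>))"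
proof -
  let ?m = "\<Prod>i\<in>UNIV. max 1 (1 / rat (j $ i) (k $ i))" and ?M = "\<Prod>i\<in>UNIV. max 1 (rat (j $ i) (k $ i))"
  let ?b = "\<Prod>i\<in>UNIV. max 1 (1 / rat (j $ i) (k $ i)) powr \<beta>"
  define d where "d = real CARD('d)"
  have d: "1 \<le> d" unfolding d_def using zero_less_card_finite[where 'a='d] by linarith
  show ?thesis
  proof (cases "0 \<le> \<beta>")
    case True
    obtain i where i: "j $ i = linf j" using linf_attained by blast
    have "2 powr real (linf j) * (1 / angv k) \<le> 1 / rat (j $ i) (k $ i)"
      using ang_le_angv[of k i] ang_ge_1[of "k $ i"] i
      by (simp add: rat_def powr_realpow) (intro divide_left_mono mult_pos_pos, auto)
    also have "\<dots> \<le> max 1 (1 / rat (j $ i) (k $ i))" by simp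
    also have "\<dots> \<le> ?m"
      by (rule prod_ge_one_member[where f = "\<lambda>i. max 1 (1 / rat (j $ i) (k $ i))"]) auto
    finally have "(2 powr real (linf j) * (1 / angv k)) powr \<beta> \<le> ?m powr \<beta>"
      using True angv_ge_1[of k] by (intro powr_mono2) auto
    also have "\<dots> = ?b"
      by (rule prod_powr_distrib)
    finally have 1: "2 powr (\<beta> * real (linf j)) * angv k powr (- \<beta>) \<le> ?b"
      using angv_ge_1[of k] by (simp add: powr_mult powr_powr powr_divide powr_minus_divide mult.commute)
    have "angv k powr (- \<beta>) = 2 powr (- \<beta> * real (linf j)) * (2 powr (\<beta> * real (linf j)) * angv k powr (- \<beta>))"
      by (simp add: mult.assoc[symmetric] powr_add[symmetric])
    also have "\<dots> \<le> 2 powr (- \<beta> * real (linf j)) * ?b"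
      by (intro mult_left_mono 1) auto
    also have "\<dots> = 1 * (2 powr (- \<beta> * real (linf j)) * ?b)" by simp
    also have "\<dots> \<le> d powr \<bar>\<beta>\<bar> * (2 powr (- \<beta> * real (linf j)) * ?b)"
      using d by (intro mult_right_mono ge_one_powr_ge_zero mult_nonneg_nonneg prod_nonneg) auto
    finally show ?thesis using True by (simp add: d_def mult.assoc)
  next
    case False
    have "angv k \<le> (\<Sum>i\<in>(UNIV :: 'd set). 2 powr real (linf j) * ?M)"
    proof (rule order_trans[OF angv_le_sum], rule sum_mono)
      fix i :: 'd
      have "ang (k $ i) = 2 ^ (j $ i) * rat (j $ i) (k $ i)" by (simp add: rat_def)
      also have "\<dots> \<le> 2 powr real (linf j) * ?M"
      proof (rule mult_mono)
        show "2 ^ (j $ i) \<le> 2 powr real (linf j)"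
          using le_linf[of j i] by (simp add: powr_realpow power_increasing)
        have "rat (j $ i) (k $ i) \<le> max 1 (rat (j $ i) (k $ i))" by simp
        also have "\<dots> \<le> ?M"
          by (rule prod_ge_one_member[where f = "\<lambda>i. max 1 (rat (j $ i) (k $ i))"]) auto
        finally show "rat (j $ i) (k $ i) \<le> ?M" .
      qed (use rat_pos[of "j $ i" "k $ i"] in auto)
      finally show "ang (k $ i) \<le> 2 powr real (linf j) * ?M" .
    qed
    then have "angv k \<le> d * (2 powr real (linf j) * ?M)"
      by (simp add: d_def)
    then have "angv k powr (- \<beta>) \<le> (d * (2 powr real (linf j) * ?M)) powr (- \<beta>)"
      using False angv_ge_1[of k] by (intro powr_mono2) auto
    also have "\<dots> = d powr (- \<beta>) * (2 powr (- \<beta> * real (linf j)) * (\<Prod>i\<in>UNIV. max 1 (rat (j $ i) (k $ i)) powr (- \<beta>)))"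
      using d by (simp add: powr_mult powr_powr prod_powr_distrib prod_nonneg mult.commute)
    finally show ?thesis using False by (simp add: d_def mult.assoc)
  qed
qed

text \<open>Compares powers of r. For r < 1 the total exponent is s - \<alpha> - max 0 \<beta>, at
  least \<delta>, and \<open>v1\<close> is 1. For r >= 1 it is \<kappa> - \<alpha> - min 0 \<beta>,
  at most -\<sigma> - 2 \<delta>, of which \<open>v1\<close> takes \<sigma> + \<delta> and
  \<open>v2\<close> takes \<delta>.\<close>

lemma univariate_weight_le:
  assumes "0 < \<delta>" "\<kappa> + \<sigma> + 2 * \<delta> \<le> min (\<alpha> + \<beta>) \<alpha>" "max (\<alpha> + \<beta>) \<alpha> + \<delta> \<le> s"
  shows "vfac s \<kappa> j k * 2 powr (\<gamma> * real j) * ang k powr (- \<alpha>) *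
      (if 0 \<le> \<beta> then max 1 (1 / rat j k) powr \<beta> else max 1 (rat j k) powr (- \<beta>))
    \<le> 2 powr (- (\<alpha> - \<gamma>) * real j) * (v1 (\<sigma> + \<delta>) j k * v2 \<delta> j k)"
proof -
  define r where "r = rat j k"
  have r: "0 < r" by (simp add: r_def rat_pos)
  have "ang k = r * 2 powr real j" by (simp add: r_def rat_def powr_realpow)
  then have a: "ang k powr (- \<alpha>) = r powr (- \<alpha>) * 2 powr (- \<alpha> * real j)"
    using r by (simp add: powr_mult powr_powr mult.commute)
  let ?b = "if 0 \<le> \<beta> then max 1 (1 / r) powr \<beta> else max 1 r powr (- \<beta>)"
  have "vfac s \<kappa> j k * r powr (- \<alpha>) * ?b \<le> v1 (\<sigma> + \<delta>) j k * v2 \<delta> j k"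
  proof (cases "r < 1")
    case True
    have R: "v1 (\<sigma> + \<delta>) j k * v2 \<delta> j k = r powr \<delta>"
      using True r mult_strict_mono[of r 1 r 1] by (simp add: v1_def v2_def r_def[symmetric] max_def min_def field_simps)
    have b: "?b = r powr (- max 0 \<beta>)"
      using True r by (auto simp: max_def powr_divide powr_minus_divide)
    have "vfac s \<kappa> j k * r powr (- \<alpha>) * ?b = r powr (s - \<alpha> - max 0 \<beta>)"
      unfolding b using True by (simp add: vfac_def r_def[symmetric] powr_add[symmetric])
    also have "\<dots> \<le> r powr \<delta>" using True r assms by (intro powr_mono') auto
    finally show ?thesis by (simp add: R)
  next
    case False
    then have r1: "1 \<le> r" by simp
    have m: "min r (1 / r) = 1 / r" using r1 mult_mono[of 1 r 1 r] by (auto simp: min_def field_simps)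
    have R: "v1 (\<sigma> + \<delta>) j k * v2 \<delta> j k = r powr (- \<sigma> - 2 * \<delta>)"
    proof -
      have "v2 \<delta> j k = r powr (- \<delta>)"
        using r by (simp add: v2_def r_def[symmetric] m powr_divide powr_minus_divide)
      moreover have "v1 (\<sigma> + \<delta>) j k = r powr (- (\<sigma> + \<delta>))"
        using r1 by (simp add: v1_def r_def[symmetric] max_def)
      ultimately have "v1 (\<sigma> + \<delta>) j k * v2 \<delta> j k = r powr (- (\<sigma> + \<delta>) + - \<delta>)"
        by (simp only: powr_add)
      also have "- (\<sigma> + \<delta>) + - \<delta> = - \<sigma> - 2 * \<delta>" by simp
      finally show ?thesis .
    qed
    have b: "?b = r powr (- min 0 \<beta>)"
      using r1 r by (auto simp: max_def min_def)
    have "vfac s \<kappa> j k * r powr (- \<alpha>) * ?b = r powr (\<kappa> - \<alpha> - min 0 \<beta>)"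
      unfolding b using False by (simp add: vfac_def r_def[symmetric] powr_add[symmetric])
    also have "\<dots> \<le> r powr (- \<sigma> - 2 * \<delta>)" using r1 assms by (intro powr_mono) auto
    finally show ?thesis by (simp add: R)
  qed
  then have "2 powr (- (\<alpha> - \<gamma>) * real j) * (vfac s \<kappa> j k * r powr (- \<alpha>) * ?b) \<le> 2 powr (- (\<alpha> - \<gamma>) * real j) * (v1 (\<sigma> + \<delta>) j k * v2 \<delta> j k)"
    by (intro mult_left_mono) auto
  note le = this
  have e: "2 powr (- (\<alpha> - \<gamma>) * real j) = 2 powr (\<gamma> * real j) * 2 powr (- \<alpha> * real j)"
    by (simp add: powr_add[symmetric] algebra_simps)
  have "2 powr (\<gamma> * real j) * 2 powr (- \<alpha> * real j) * (vfac s \<kappa> j k * r powr (- \<alpha>) * ?b)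
      \<le> 2 powr (- (\<alpha> - \<gamma>) * real j) * (v1 (\<sigma> + \<delta>) j k * v2 \<delta> j k)"
    using le unfolding e .
  then show ?thesis unfolding a r_def[symmetric] by (simp only: mult_ac)
qed

lemma multivariate_weight_le:
  fixes j :: "nat ^ 'd" and k :: "int ^ 'd"
  assumes "0 < \<delta>" "\<kappa> + \<sigma> + 2 * \<delta> \<le> min (\<alpha> + \<beta>) \<alpha>" "max (\<alpha> + \<beta>) \<alpha> + \<delta> \<le> s"
  shows "(\<Prod>i\<in>UNIV. vfac s \<kappa> (j $ i) (k $ i) * 2 powr (\<gamma> * real (j $ i)))
    \<le> (real CARD('d) powr \<bar>\<beta>\<bar> * lev (\<alpha> - \<gamma>) \<beta> j) *
      ((\<Prod>i\<in>UNIV. v1 (\<sigma> + \<delta>) (j $ i) (k $ i)) * ((\<Prod>i\<in>UNIV. v2 \<delta> (j $ i) (k $ i)) *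
      ((\<Prod>i\<in>UNIV. ang (k $ i) powr \<alpha>) * angv k powr \<beta>)))"
proof -
  define D where "D = real CARD('d) powr \<bar>\<beta>\<bar>"
  define b where "b i = (if 0 \<le> \<beta> then max 1 (1 / rat (j $ i) (k $ i)) powr \<beta> else max 1 (rat (j $ i) (k $ i)) powr (- \<beta>))" for i
  define V where "V = (\<Prod>i\<in>UNIV. vfac s \<kappa> (j $ i) (k $ i) * 2 powr (\<gamma> * real (j $ i)))"
  define A where "A = (\<Prod>i\<in>UNIV. ang (k $ i) powr \<alpha>) * angv k powr \<beta>"
  have nz: "ang (k $ i) \<noteq> 0" "angv k \<noteq> 0" for i
    using ang_ge_1[of "k $ i"] angv_ge_1[of k] by linarith+
  have pos: "0 < A"
    unfolding A_def by (intro mult_pos_pos prod_pos) (auto simp: nz)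
  have nn: "0 \<le> vfac s \<kappa> (j $ i) (k $ i) * 2 powr (\<gamma> * real (j $ i)) * ang (k $ i) powr (- \<alpha>)" for i
    using vfac_pos[of s \<kappa> "j $ i" "k $ i"] by auto
  have V0: "0 \<le> V * (\<Prod>i\<in>UNIV. ang (k $ i) powr (- \<alpha>))"
    unfolding V_def prod.distrib[symmetric] using nn by (intro prod_nonneg) auto
  have "A * ((\<Prod>i\<in>UNIV. ang (k $ i) powr (- \<alpha>)) * angv k powr (- \<beta>)) = (\<Prod>i\<in>UNIV. ang (k $ i) powr \<alpha> * ang (k $ i) powr (- \<alpha>)) * (angv k powr \<beta> * angv k powr (- \<beta>))"
    by (simp add: A_def prod.distrib mult_ac)
  also have "\<dots> = 1"
    by (simp add: powr_add[symmetric] nz)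
  finally have one: "A * ((\<Prod>i\<in>UNIV. ang (k $ i) powr (- \<alpha>)) * angv k powr (- \<beta>)) = 1" .
  have "V * (\<Prod>i\<in>UNIV. ang (k $ i) powr (- \<alpha>)) * angv k powr (- \<beta>)
    \<le> V * (\<Prod>i\<in>UNIV. ang (k $ i) powr (- \<alpha>)) * (D * 2 powr (- \<beta> * real (linf j)) * prod b UNIV)"
    using isotropic_weight_le[of k \<beta> j] V0 unfolding D_def b_def by (intro mult_left_mono) auto
  also have "\<dots> = D * 2 powr (- \<beta> * real (linf j)) *
     (\<Prod>i\<in>UNIV. vfac s \<kappa> (j $ i) (k $ i) * 2 powr (\<gamma> * real (j $ i)) * ang (k $ i) powr (- \<alpha>) * b i)"
    by (simp add: V_def prod.distrib mult_ac)
  also have "\<dots> \<le> D * 2 powr (- \<beta> * real (linf j)) *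
     (\<Prod>i\<in>UNIV. 2 powr (- (\<alpha> - \<gamma>) * real (j $ i)) * (v1 (\<sigma> + \<delta>) (j $ i) (k $ i) * v2 \<delta> (j $ i) (k $ i)))"
    using univariate_weight_le[OF assms] nn unfolding b_def
    by (intro mult_left_mono prod_mono conjI) (auto simp: D_def intro!: mult_nonneg_nonneg)
  also have "\<dots> = D * lev (\<alpha> - \<gamma>) \<beta> j *
      ((\<Prod>i\<in>UNIV. v1 (\<sigma> + \<delta>) (j $ i) (k $ i)) * (\<Prod>i\<in>UNIV. v2 \<delta> (j $ i) (k $ i)))"
  proof -
    have "(\<Prod>i\<in>UNIV. 2 powr (- (\<alpha> - \<gamma>) * real (j $ i))) = 2 powr (\<Sum>i\<in>UNIV. - (\<alpha> - \<gamma>) * real (j $ i))"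
      by (rule powr_sum[symmetric]) auto
    also have "\<dots> = 2 powr (- (\<alpha> - \<gamma>) * l1 j)"
      by (simp only: l1_def sum_distrib_left)
    finally have e: "(\<Prod>i\<in>UNIV. 2 powr (- (\<alpha> - \<gamma>) * real (j $ i))) = 2 powr (- (\<alpha> - \<gamma>) * l1 j)" .
    have "lev (\<alpha> - \<gamma>) \<beta> j = 2 powr (- \<beta> * real (linf j)) * 2 powr (- (\<alpha> - \<gamma>) * l1 j)"
      by (simp add: powr_add[symmetric] algebra_simps)
    then show ?thesis unfolding prod.distrib e by (simp only: mult_ac)
  qed
  finally have "A * (V * (\<Prod>i\<in>UNIV. ang (k $ i) powr (- \<alpha>)) * angv k powr (- \<beta>))
    \<le> A * (D * lev (\<alpha> - \<gamma>) \<beta> j *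
      ((\<Prod>i\<in>UNIV. v1 (\<sigma> + \<delta>) (j $ i) (k $ i)) * (\<Prod>i\<in>UNIV. v2 \<delta> (j $ i) (k $ i))))"
    using pos by (intro mult_left_mono) auto
  moreover have "A * (V * (\<Prod>i\<in>UNIV. ang (k $ i) powr (- \<alpha>)) * angv k powr (- \<beta>)) = V"
    using one by (metis mult.assoc mult.left_commute mult.right_neutral)
  ultimately show ?thesis unfolding V_def[symmetric] A_def[symmetric] D_def[symmetric] by (simp only: mult_ac)
qed

text \<open>The factor \<open>2 powr (\<sigma> * l1 j)\<close>, the number of residue classes to the
  power \<sigma>, later lowers the level weight from \<alpha> - \<gamma> to \<alpha> - \<gamma> -
  \<sigma>.\<close>

lemma lnorm_v1_prod_le:
  assumes "0 \<le> \<sigma>" "0 < \<delta>"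
  shows "\<exists>C\<ge>0. \<forall>j :: nat ^ 'd. lnorm \<sigma> (\<lambda>k :: int ^ 'd. ennreal (\<Prod>i\<in>UNIV. v1 (\<sigma> + \<delta>) (j $ i) (k $ i)))
    \<le> ennreal (C * 2 powr (\<sigma> * l1 j))"
proof -
  obtain C where C: "0 \<le> C" "\<And>j. lnorm \<sigma> (\<lambda>k. ennreal (v1 (\<sigma> + \<delta>) j k)) \<le> ennreal (C * 2 powr (\<sigma> * real j))"
    using lnorm_max_rat[OF assms] unfolding v1_def by blast
  have "lnorm \<sigma> (\<lambda>k :: int ^ 'd. ennreal (\<Prod>i\<in>UNIV. v1 (\<sigma> + \<delta>) (j $ i) (k $ i))) \<le> ennreal (C ^ CARD('d) * 2 powr (\<sigma> * l1 j))"
    for j :: "nat ^ 'd"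
  proof -
    have "lnorm \<sigma> (\<lambda>k :: int ^ 'd. ennreal (\<Prod>i\<in>UNIV. v1 (\<sigma> + \<delta>) (j $ i) (k $ i)))
        = lnorm \<sigma> (\<lambda>k :: int ^ 'd. \<Prod>i\<in>UNIV. ennreal (v1 (\<sigma> + \<delta>) (j $ i) (k $ i)))"
      by (subst prod_ennreal) (auto simp: v1_def)
    also have "\<dots> \<le> (\<Prod>i\<in>UNIV. lnorm \<sigma> (\<lambda>k. ennreal (v1 (\<sigma> + \<delta>) (j $ i) k)))"
      by (rule lnorm_prod_le[OF assms(1)])
    also have "\<dots> \<le> (\<Prod>i\<in>UNIV. ennreal (C * 2 powr (\<sigma> * real (j $ i))))"
      by (intro prod_mono_ennreal C(2))
    also have "\<dots> = ennreal (\<Prod>i\<in>UNIV. C * 2 powr (\<sigma> * real (j $ i)))"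
      using C(1) by (intro prod_ennreal) auto
    also have "(\<Prod>i\<in>UNIV. C * 2 powr (\<sigma> * real (j $ i))) = C ^ CARD('d) * 2 powr (\<sigma> * l1 j)"
      by (simp add: prod.distrib l1_def sum_distrib_left powr_sum)
    finally show ?thesis .
  qed
  then show ?thesis using C(1) by (intro exI[of _ "C ^ CARD('d)"]) auto
qed

lemma lnorm_v2_prod_le:
  assumes "0 < \<delta>"
  shows "\<exists>C\<ge>0. \<forall>w k. 0 \<le> w \<longrightarrow> w \<le> 1 \<longrightarrow>
    lnorm w (\<lambda>j :: nat ^ 'd. ennreal (\<Prod>i\<in>UNIV. v2 \<delta> (j $ i) (k $ i))) \<le> ennreal C"
proof -
  define C where "C = 2 powr \<delta> * (2 / (1 - 2 powr (- \<delta>)))"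
  have C: "0 \<le> C" using assms by (simp add: C_def less_imp_le powr_less_one)
  have "lnorm w (\<lambda>j :: nat ^ 'd. ennreal (\<Prod>i\<in>UNIV. v2 \<delta> (j $ i) (k $ i))) \<le> ennreal (C ^ CARD('d))"
    if w: "0 \<le> w" "w \<le> 1" for w k
  proof -
    have "lnorm w (\<lambda>j :: nat ^ 'd. ennreal (\<Prod>i\<in>UNIV. v2 \<delta> (j $ i) (k $ i)))
        = lnorm w (\<lambda>j :: nat ^ 'd. \<Prod>i\<in>UNIV. ennreal (v2 \<delta> (j $ i) (k $ i)))"
      by (subst prod_ennreal) (auto simp: v2_def)
    also have "\<dots> \<le> (\<Prod>i\<in>UNIV. lnorm w (\<lambda>j. ennreal (v2 \<delta> j (k $ i))))"
      by (rule lnorm_prod_le[OF w(1)])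
    also have "\<dots> \<le> (\<Prod>i\<in>(UNIV :: 'd set). ennreal C)"
    proof (rule prod_mono_ennreal)
      fix i
      have "lnorm w (\<lambda>j. ennreal (v2 \<delta> j (k $ i))) \<le> lnorm 1 (\<lambda>j. ennreal (v2 \<delta> j (k $ i)))"
        by (rule lnorm_antimono[OF w])
      also have "\<dots> \<le> ennreal C"
        unfolding lnorm_1 v2_def C_def by (rule nnsum_min_rat_le[OF assms])
      finally show "lnorm w (\<lambda>j. ennreal (v2 \<delta> j (k $ i))) \<le> ennreal C" .
    qed
    also have "\<dots> = ennreal (C ^ CARD('d))" using C by (simp add: ennreal_power)
    finally show ?thesis .
  qed
  then show ?thesis using C by (intro exI[of _ "C ^ CARD('d)"]) auto
qed

section \<open>The main operator estimate\<close>

context quasi_coeffs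
begin

text \<open>An entry vanishes unless each l_i lies in \<open>freqs\<close> of its level, where the
  ratio of l_i is at most 1. Its power \<gamma> then decays geometrically as the level grows, so for
  \<gamma> > 0 the sum over levels converges uniformly in l.\<close>

lemma lnorm_output_level_le:
  assumes "0 < \<gamma>"
  shows "\<exists>K\<ge>0. \<forall>l :: int ^ 'd. lnorm (1 - u) (\<lambda>z :: (nat ^ 'd) \<times> (int ^ 'd).
      \<Prod>i\<in>UNIV. ennreal (norm (ec F P (fst z $ i) (l $ i) (snd z $ i)) / vfac s \<kappa> (fst z $ i) (snd z $ i)) *
        ennreal (rat (fst z $ i) (l $ i) powr \<gamma>)) \<le> ennreal K"
proof -
  define K where "K = KA * (2 powr \<gamma> * (2 / (1 - 2 powr (- \<gamma>))))"
  have K: "0 \<le> K" using assms KA_nonneg by (simp add: K_def less_imp_le powr_less_one)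
  have u': "0 \<le> 1 - u" "1 - u \<le> 1" using u by auto
  have "lnorm (1 - u) (\<lambda>z :: (nat ^ 'd) \<times> (int ^ 'd).
      \<Prod>i\<in>UNIV. ennreal (norm (ec F P (fst z $ i) (l $ i) (snd z $ i)) / vfac s \<kappa> (fst z $ i) (snd z $ i)) *
        ennreal (rat (fst z $ i) (l $ i) powr \<gamma>)) \<le> ennreal (K ^ CARD('d))" for l :: "int ^ 'd"
  proof -
    let ?g = "\<lambda>j k :: int ^ 'd. \<Prod>i\<in>UNIV. ennreal (norm (ec F P (j $ i) (l $ i) (k $ i)) / vfac s \<kappa> (j $ i) (k $ i)) * ennreal (rat (j $ i) (l $ i) powr \<gamma>)"
    define t where "t i j = ennreal (rat j (l $ i) powr \<gamma>) * (if l $ i \<in> freqs j then ennreal KA else 0)" for i j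
    have "lnorm (1 - u) (\<lambda>z :: (nat ^ 'd) \<times> (int ^ 'd).
      ?g (fst z) (snd z))
      = lnorm (1 - u) (\<lambda>j :: nat ^ 'd. lnorm (1 - u) (\<lambda>k :: int ^ 'd.
      ?g j k))"
      by (rule lnorm_fubini[symmetric])
    also have "\<dots> \<le> lnorm (1 - u) (\<lambda>j :: nat ^ 'd. \<Prod>i\<in>UNIV. t i (j $ i))"
    proof (rule lnorm_mono[OF _ u'(1)])
      fix j :: "nat ^ 'd"
      have "lnorm (1 - u) (\<lambda>k :: int ^ 'd.
        ?g j k)
        \<le> (\<Prod>i\<in>UNIV. lnorm (1 - u) (\<lambda>k. ennreal (norm (ec F P (j $ i) (l $ i) k) / vfac s \<kappa> (j $ i) k) *
        ennreal (rat (j $ i) (l $ i) powr \<gamma>)))"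
        by (rule lnorm_prod_le[OF u'(1)])
      also have "\<dots> \<le> (\<Prod>i\<in>UNIV. t i (j $ i))"
        unfolding mult.commute[of _ "ennreal (rat _ _ powr \<gamma>)"] lnorm_cmult t_def
        by (intro prod_mono_ennreal mult_left_mono lnorm_ec_div_vfac_le) auto
      finally show "lnorm (1 - u) (\<lambda>k :: int ^ 'd.
        ?g j k) \<le> (\<Prod>i\<in>UNIV. t i (j $ i))" .
    qed
    also have "\<dots> \<le> (\<Prod>i\<in>UNIV. lnorm (1 - u) (t i))"
      by (rule lnorm_prod_le[OF u'(1)])
    also have "\<dots> \<le> (\<Prod>i\<in>(UNIV :: 'd set). ennreal K)"
    proof (rule prod_mono_ennreal)
      fix i :: 'd
      have "lnorm (1 - u) (t i) \<le> lnorm 1 (t i)" by (rule lnorm_antimono[OF u'])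
      also have "\<dots> \<le> nnsum (\<lambda>j. ennreal KA * ennreal (min (rat j (l $ i)) (1 / rat j (l $ i)) powr \<gamma>))"
        unfolding lnorm_1
      proof (rule nn_integral_mono)
        fix j
        show "t i j \<le> ennreal KA * ennreal (min (rat j (l $ i)) (1 / rat j (l $ i)) powr \<gamma>)"
        proof (cases "l $ i \<in> freqs j")
          case True
          have r: "0 < rat j (l $ i)" "rat j (l $ i) \<le> 1"
            using ang_le_of_freqs[OF True] rat_pos by (auto simp: rat_def)
          then have "rat j (l $ i) * rat j (l $ i) \<le> 1" using mult_mono[of "rat j (l $ i)" 1 "rat j (l $ i)" 1] by simp
          with r have "min (rat j (l $ i)) (1 / rat j (l $ i)) = rat j (l $ i)"
            by (simp add: min_def field_simps)
          then show ?thesis using True by (simp add: t_def mult.commute)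
        qed (simp add: t_def)
      qed
      also have "\<dots> = ennreal KA * nnsum (\<lambda>j. ennreal (min (rat j (l $ i)) (1 / rat j (l $ i)) powr \<gamma>))"
        by (rule nn_integral_cmult) auto
      also have "\<dots> \<le> ennreal KA * ennreal (2 powr \<gamma> * (2 / (1 - 2 powr (- \<gamma>))))"
        by (intro mult_left_mono nnsum_min_rat_le assms) auto
      also have "\<dots> = ennreal K" unfolding K_def using KA_nonneg by (simp only: ennreal_mult')
      finally show "lnorm (1 - u) (t i) \<le> ennreal K" .
    qed
    also have "\<dots> = ennreal (K ^ CARD('d))" using K by (simp add: ennreal_power)
    finally show ?thesis .
  qed
  then show ?thesis using K by (intro exI[of _ "K ^ CARD('d)"]) auto
qed

lemma lnorm_block_sum_le:
  fixes \<alpha> \<beta> \<gamma> \<sigma> \<delta> w :: real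
  assumes "0 < \<gamma>" "0 \<le> \<sigma>" "0 \<le> w" "u = \<sigma> + w"
    and \<delta>: "0 < \<delta>" "\<kappa> + \<sigma> + 2 * \<delta> \<le> min (\<alpha> + \<beta>) \<alpha>" "max (\<alpha> + \<beta>) \<alpha> + \<delta> \<le> s"
  shows "\<exists>K\<ge>0. \<forall>(x :: int ^ 'd \<Rightarrow> real) J. (\<forall>k. 0 \<le> x k) \<longrightarrow>
    lnorm u (\<lambda>l. ennreal (\<Prod>i\<in>UNIV. ang (l $ i) powr \<gamma>) * nnsum (\<lambda>z. if fst z \<in> J
        then ennreal (aprod F P (fst z) l (snd z) * x (snd z)) else 0))
    \<le> ennreal K * lnorm \<sigma> (\<lambda>j. if j \<in> J then ennreal (lev (\<alpha> - \<gamma> - \<sigma>) \<beta> j) else 0) *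
      lnorm w (\<lambda>k. ennreal ((\<Prod>i\<in>UNIV. ang (k $ i) powr \<alpha>) * angv k powr \<beta> * x k))"
proof -
  obtain K1 where K1: "0 \<le> K1" "\<And>l :: int ^ 'd. lnorm (1 - u) (\<lambda>z :: (nat ^ 'd) \<times> (int ^ 'd).
      \<Prod>i\<in>UNIV. ennreal (norm (ec F P (fst z $ i) (l $ i) (snd z $ i)) / vfac s \<kappa> (fst z $ i) (snd z $ i)) *
        ennreal (rat (fst z $ i) (l $ i) powr \<gamma>)) \<le> ennreal K1"
    using lnorm_output_level_le[OF assms(1)] by blast
  obtain K2 where K2: "0 \<le> K2" "\<And>j :: nat ^ 'd. lnorm \<sigma> (\<lambda>k :: int ^ 'd. ennreal (\<Prod>i\<in>UNIV. v1 (\<sigma> + \<delta>) (j $ i) (k $ i)))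
    \<le> ennreal (K2 * 2 powr (\<sigma> * l1 j))"
    using lnorm_v1_prod_le[OF assms(2) \<delta>(1)] by blast
  obtain K3 where K3: "0 \<le> K3" "\<And>w (k :: int ^ 'd). 0 \<le> w \<Longrightarrow> w \<le> 1 \<Longrightarrow>
    lnorm w (\<lambda>j :: nat ^ 'd. ennreal (\<Prod>i\<in>UNIV. v2 \<delta> (j $ i) (k $ i))) \<le> ennreal K3"
    using lnorm_v2_prod_le[where 'd = 'd, OF \<delta>(1)] by blast
  define D where "D = real CARD('d) powr \<bar>\<beta>\<bar>"
  define K where "K = K1 * 2 ^ CARD('d) * D * K2 * K3"
  have D: "0 \<le> D" by (simp add: D_def)
  have w: "0 \<le> w" "w \<le> 1" using assms u by auto
  have "lnorm u (\<lambda>l. ennreal (\<Prod>i\<in>UNIV. ang (l $ i) powr \<gamma>) * nnsum (\<lambda>z. if fst z \<in> J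
        then ennreal (aprod F P (fst z) l (snd z) * x (snd z)) else 0))
    \<le> ennreal K * lnorm \<sigma> (\<lambda>j. if j \<in> J then ennreal (lev (\<alpha> - \<gamma> - \<sigma>) \<beta> j) else 0) *
      lnorm w (\<lambda>k. ennreal ((\<Prod>i\<in>UNIV. ang (k $ i) powr \<alpha>) * angv k powr \<beta> * x k))"
    if x: "\<forall>k. 0 \<le> x k" for x :: "int ^ 'd \<Rightarrow> real" and J
  proof -
    let ?w = "\<lambda>j. if j \<in> J then ennreal (lev (\<alpha> - \<gamma> - \<sigma>) \<beta> j) else 0"
    \<comment> \<open>The output weight is split as ang(l)^\<gamma> = r^\<gamma> 2^(\<gamma> j) in
      each variable, r being the ratio of l_i: the first factor stays with the normalized entry in
      \<open>A\<close>, the second goes to the weight \<open>B\<close>, which is free of l.\<close>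
    define A where "A l z = (\<Prod>i\<in>UNIV. ennreal (norm (ec F P (fst z $ i) (l $ i) (snd z $ i)) / vfac s \<kappa> (fst z $ i) (snd z $ i)) *
        ennreal (rat (fst z $ i) (l $ i) powr \<gamma>))" for l :: "int ^ 'd" and z :: "(nat ^ 'd) \<times> (int ^ 'd)"
    define B where "B z = (if fst z \<in> J then
        ennreal ((\<Prod>i\<in>UNIV. vfac s \<kappa> (fst z $ i) (snd z $ i) * 2 powr (\<gamma> * real (fst z $ i))) * x (snd z)) else 0)"
      for z :: "(nat ^ 'd) \<times> (int ^ 'd)"
    \<comment> \<open>Inserting the indicator changes no term, since \<open>A\<close> vanishes with
      the entry. It keeps the norm over l finite after \<open>B\<close> has been pulled out.\<close>
    define I where "I l z = (\<Prod>i\<in>UNIV. if ec F P (fst z $ i) (l $ i) (snd z $ i) = 0 then 0 else 1 :: ennreal)"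
      for l :: "int ^ 'd" and z :: "(nat ^ 'd) \<times> (int ^ 'd)"
    define W where "W z = (if fst z \<in> J then ennreal (lev (\<alpha> - \<gamma>) \<beta> (fst z)) else 0)
        * ennreal (\<Prod>i\<in>UNIV. v1 (\<sigma> + \<delta>) (fst z $ i) (snd z $ i))"
      for z :: "(nat ^ 'd) \<times> (int ^ 'd)"
    define G where "G k = ennreal ((\<Prod>i\<in>UNIV. ang (k $ i) powr \<alpha>) * angv k powr \<beta> * x k)" for k
    define H where "H z = G (snd z) * ennreal (\<Prod>i\<in>UNIV. v2 \<delta> (fst z $ i) (snd z $ i))"
      for z :: "(nat ^ 'd) \<times> (int ^ 'd)"
    have split: "ennreal (\<Prod>i\<in>UNIV. ang (l $ i) powr \<gamma>) * (if fst z \<in> J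
        then ennreal (aprod F P (fst z) l (snd z) * x (snd z)) else 0)
      = A l z * (I l z * B z)" for l z
    proof (cases "fst z \<in> J \<and> (\<forall>i. ec F P (fst z $ i) (l $ i) (snd z $ i) \<noteq> 0)")
      case False
      show ?thesis
      proof (cases "fst z \<in> J")
        case True
        with False obtain i where i: "ec F P (fst z $ i) (l $ i) (snd z $ i) = 0" by blast
        then have P0: "aprod F P (fst z) l (snd z) = 0" by (intro prod_zero) auto
        have I0: "I l z = 0" unfolding I_def using i by (intro prod_zero) auto
        show ?thesis unfolding P0 I0 by simp
      qed (simp add: B_def)
    next
      case True
      have v: "0 < vfac s \<kappa> j k" for j k by (rule vfac_pos)
      have "A l z = ennreal (\<Prod>i\<in>UNIV. norm (ec F P (fst z $ i) (l $ i) (snd z $ i)) / vfac s \<kappa> (fst z $ i) (snd z $ i) *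
        rat (fst z $ i) (l $ i) powr \<gamma>)"
        unfolding A_def using v by (subst prod_ennreal[symmetric]) (auto simp: less_imp_le simp flip: ennreal_mult)
      then have "A l z * (I l z * B z) = ennreal ((\<Prod>i\<in>UNIV. norm (ec F P (fst z $ i) (l $ i) (snd z $ i)) / vfac s \<kappa> (fst z $ i) (snd z $ i) *
        rat (fst z $ i) (l $ i) powr \<gamma>) * ((\<Prod>i\<in>UNIV. vfac s \<kappa> (fst z $ i) (snd z $ i) * 2 powr (\<gamma> * real (fst z $ i))) * x (snd z)))"
        using True v x by (simp add: I_def B_def less_imp_le prod_nonneg ennreal_mult')
      also have "(\<Prod>i\<in>UNIV. norm (ec F P (fst z $ i) (l $ i) (snd z $ i)) / vfac s \<kappa> (fst z $ i) (snd z $ i) *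
        rat (fst z $ i) (l $ i) powr \<gamma>) * ((\<Prod>i\<in>UNIV. vfac s \<kappa> (fst z $ i) (snd z $ i) * 2 powr (\<gamma> * real (fst z $ i))) * x (snd z))
        = (\<Prod>i\<in>UNIV. ang (l $ i) powr \<gamma>) * (aprod F P (fst z) l (snd z) * x (snd z))"
      proof -
        have key: "e / v * rat j l powr \<gamma> * (v * 2 powr (\<gamma> * real j)) = ang l powr \<gamma> * e" if "0 < v" for e v j l
          using that ang_ge_1[of l] by (simp add: rat_def powr_divide powr_powr mult.commute flip: powr_realpow)
        have "(\<Prod>i\<in>UNIV. norm (ec F P (fst z $ i) (l $ i) (snd z $ i)) / vfac s \<kappa> (fst z $ i) (snd z $ i) *
          rat (fst z $ i) (l $ i) powr \<gamma>) * (\<Prod>i\<in>UNIV. vfac s \<kappa> (fst z $ i) (snd z $ i) * 2 powr (\<gamma> * real (fst z $ i)))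
          = (\<Prod>i\<in>UNIV. ang (l $ i) powr \<gamma> * norm (ec F P (fst z $ i) (l $ i) (snd z $ i)))"
          unfolding prod.distrib[symmetric] by (intro prod.cong refl key v)
        then show ?thesis unfolding prod.distrib mult.assoc[symmetric] by (simp only:)
      qed
      also have "ennreal \<dots> = ennreal (\<Prod>i\<in>UNIV. ang (l $ i) powr \<gamma>) *
          ennreal (aprod F P (fst z) l (snd z) * x (snd z))"
        by (rule ennreal_mult') (auto intro: prod_nonneg)
      finally show ?thesis using True by (simp only: if_True)
    qed
    have "lnorm u (\<lambda>l. ennreal (\<Prod>i\<in>UNIV. ang (l $ i) powr \<gamma>) * nnsum (\<lambda>z. if fst z \<in> J
        then ennreal (aprod F P (fst z) l (snd z) * x (snd z)) else 0))
      = lnorm u (\<lambda>l. lnorm 1 (\<lambda>z. A l z * (I l z * B z)))"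
      by (subst nn_integral_cmult[symmetric]) (auto simp: split lnorm_1)
    \<comment> \<open>First use of Hoelder's inequality, over the pairs (j,k) with l fixed and
      parameters 1 - u and u.\<close>
    also have "\<dots> \<le> lnorm u (\<lambda>l. ennreal K1 * lnorm u (\<lambda>z. I l z * B z))"
    proof (rule lnorm_mono[OF _ u(1)])
      fix l :: "int ^ 'd"
      have "lnorm 1 (\<lambda>z. A l z * (I l z * B z)) \<le> lnorm (1 - u) (A l) * lnorm u (\<lambda>z. I l z * B z)"
        using lnorm_Hoelder[of "1 - u" u "A l" "\<lambda>z. I l z * B z"] u by simp
      also have "\<dots> \<le> ennreal K1 * lnorm u (\<lambda>z. I l z * B z)"
        unfolding A_def by (intro mult_right_mono K1(2)) auto
      finally show "lnorm 1 (\<lambda>z. A l z * (I l z * B z)) \<le> ennreal K1 * lnorm u (\<lambda>z. I l z * B z)" .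
    qed
    \<comment> \<open>Both norms now have the parameter u and may be exchanged, so that l occurs
      only in the indicator.\<close>
    also have "\<dots> = ennreal K1 * lnorm u (\<lambda>z. B z * lnorm u (\<lambda>l. I l z))"
      unfolding lnorm_cmult lnorm_swap[of u "\<lambda>l z. I l z * B z"] by (simp only: mult.commute[of _ "B _"] lnorm_cmult)
    also have "\<dots> \<le> ennreal K1 * lnorm u (\<lambda>z. ennreal (2 ^ CARD('d) * D) * (W z * H z))"
    proof (intro mult_left_mono lnorm_mono u(1))
      fix z :: "(nat ^ 'd) \<times> (int ^ 'd)"
      have "lnorm u (\<lambda>l. I l z) \<le> (\<Prod>i\<in>UNIV. lnorm u (\<lambda>l. if ec F P (fst z $ i) l (snd z $ i) = 0 then 0 else 1))"
        unfolding I_def by (rule lnorm_prod_le[OF u(1)])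
      also have "\<dots> \<le> (\<Prod>i\<in>(UNIV :: 'd set). 2)"
        by (intro prod_mono_ennreal lnorm_ec_support_le u)
      also have "\<dots> = ennreal (2 ^ CARD('d))" by (simp add: ennreal_power[symmetric])
      finally have I: "lnorm u (\<lambda>l. I l z) \<le> ennreal (2 ^ CARD('d))" .
      have BW: "B z \<le> ennreal D * (W z * H z)"
      proof (cases "fst z \<in> J")
        case True
        let ?v1 = "\<Prod>i\<in>UNIV. v1 (\<sigma> + \<delta>) (fst z $ i) (snd z $ i)" and ?v2 = "\<Prod>i\<in>UNIV. v2 \<delta> (fst z $ i) (snd z $ i)"
        let ?g = "(\<Prod>i\<in>UNIV. ang (snd z $ i) powr \<alpha>) * angv (snd z) powr \<beta>"
        let ?e = "lev (\<alpha> - \<gamma>) \<beta> (fst z)"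
        have nn: "0 \<le> ?v1" "0 \<le> ?v2" "0 \<le> ?g" by (auto simp: v1_def v2_def intro!: prod_nonneg mult_nonneg_nonneg)
        have "B z \<le> ennreal ((D * ?e) * (?v1 * (?v2 * ?g)) * x (snd z))"
          using multivariate_weight_le[OF \<delta>, of "fst z" "snd z" \<gamma>] x True
          by (auto simp: B_def D_def intro!: ennreal_leI mult_right_mono)
        also have "\<dots> = ennreal D * (W z * H z)"
        proof -
          have gx: "0 \<le> ?g * x (snd z)" using nn(3) x by (intro mult_nonneg_nonneg[of ?g]) auto
          define a b where "a = ?e * ?v1" and "b = ?g * x (snd z) * ?v2"
          have ab: "0 \<le> a" "0 \<le> b"
            using nn(1) mult_nonneg_nonneg[OF gx nn(2)] by (auto simp only: a_def b_def intro!: mult_nonneg_nonneg powr_ge_zero)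
          have W: "W z = ennreal a"
            unfolding W_def if_P[OF True] a_def by (rule ennreal_mult[symmetric, OF powr_ge_zero nn(1)])
          have H: "H z = ennreal b"
            unfolding H_def G_def b_def by (rule ennreal_mult[symmetric, OF gx nn(2)])
          have "ennreal D * (W z * H z) = ennreal (D * (a * b))"
            unfolding W H using ab D by (simp add: ennreal_mult)
          then show ?thesis by (simp only: a_def b_def mult_ac)
        qed
        finally show ?thesis .
      qed (simp add: B_def)
      have "B z * lnorm u (\<lambda>l. I l z) \<le> ennreal D * (W z * H z) * ennreal (2 ^ CARD('d))"
        by (rule mult_mono[OF BW I]) auto
      then show "B z * lnorm u (\<lambda>l. I l z) \<le> ennreal (2 ^ CARD('d) * D) * (W z * H z)"
        using D by (simp add: ennreal_mult mult_ac)
    qed auto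
    also have "\<dots> = ennreal K1 * (ennreal (2 ^ CARD('d) * D) * lnorm (\<sigma> + w) (\<lambda>z. W z * H z))"
      by (simp only: lnorm_cmult assms(4))
    \<comment> \<open>Second use, with parameters \<sigma> and w: \<open>W\<close> carries the level
      weight and the decay in the frequency, \<open>H\<close> the weighted coefficients and the
      decay in the level.\<close>
    also have "\<dots> \<le> ennreal K1 * (ennreal (2 ^ CARD('d) * D) * (lnorm \<sigma> W * lnorm w H))"
      by (intro mult_left_mono lnorm_Hoelder assms) auto
    also have "\<dots> \<le> ennreal K1 * (ennreal (2 ^ CARD('d) * D) *
      ((ennreal K2 * lnorm \<sigma> ?w) *
       (ennreal K3 * lnorm w G)))"
    proof (intro mult_left_mono mult_mono)
      have "lnorm \<sigma> W = lnorm \<sigma> (\<lambda>j. lnorm \<sigma> (\<lambda>k.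
          (if j \<in> J then ennreal (lev (\<alpha> - \<gamma>) \<beta> j) else 0)
        * ennreal (\<Prod>i\<in>UNIV. v1 (\<sigma> + \<delta>) (j $ i) (k $ i))))"
        unfolding W_def[abs_def] by (rule lnorm_fubini[symmetric])
      also have "\<dots> \<le> lnorm \<sigma> (\<lambda>j. ennreal K2 * (if j \<in> J then ennreal (lev (\<alpha> - \<gamma> - \<sigma>) \<beta> j) else 0))"
      proof (rule lnorm_mono[OF _ assms(2)])
        fix j :: "nat ^ 'd"
        have e: "lev (\<alpha> - \<gamma>) \<beta> j * (K2 * 2 powr (\<sigma> * l1 j))
          = K2 * lev (\<alpha> - \<gamma> - \<sigma>) \<beta> j"
          by (simp add: mult.left_commute[of _ K2] powr_add[symmetric] algebra_simps)
        have "lnorm \<sigma> (\<lambda>k.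
          (if j \<in> J then ennreal (lev (\<alpha> - \<gamma>) \<beta> j) else 0)
        * ennreal (\<Prod>i\<in>UNIV. v1 (\<sigma> + \<delta>) (j $ i) (k $ i)))
          \<le> (if j \<in> J then ennreal (lev (\<alpha> - \<gamma>) \<beta> j) else 0) * ennreal (K2 * 2 powr (\<sigma> * l1 j))"
          unfolding lnorm_cmult by (intro mult_left_mono K2(2)) auto
        also have "\<dots> = ennreal K2 * (if j \<in> J then ennreal (lev (\<alpha> - \<gamma> - \<sigma>) \<beta> j) else 0)"
          using e K2(1) by (auto simp flip: ennreal_mult)
        finally show "lnorm \<sigma> (\<lambda>k.
          (if j \<in> J then ennreal (lev (\<alpha> - \<gamma>) \<beta> j) else 0)
        * ennreal (\<Prod>i\<in>UNIV. v1 (\<sigma> + \<delta>) (j $ i) (k $ i)))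
          \<le> ennreal K2 * (if j \<in> J then ennreal (lev (\<alpha> - \<gamma> - \<sigma>) \<beta> j) else 0)" .
      qed
      also have "\<dots> = ennreal K2 * lnorm \<sigma> ?w"
        by (rule lnorm_cmult)
      finally show "lnorm \<sigma> W \<le> \<dots>" .
      \<comment> \<open>For \<open>H\<close> the order is reversed: with k fixed, the norm over the
        levels is bounded by \<open>v2\<close>, uniformly in k, and the weighted norm of the
        coefficients remains.\<close>
      have "lnorm w H = lnorm w (\<lambda>j. lnorm w (\<lambda>k. G k * ennreal (\<Prod>i\<in>UNIV. v2 \<delta> (j $ i) (k $ i))))"
        unfolding H_def[abs_def] by (rule lnorm_fubini[symmetric])
      also have "\<dots> = lnorm w (\<lambda>k. G k * lnorm w (\<lambda>j. ennreal (\<Prod>i\<in>UNIV. v2 \<delta> (j $ i) (k $ i))))"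
        by (subst lnorm_swap) (simp only: lnorm_cmult)
      also have "\<dots> \<le> lnorm w (\<lambda>k. ennreal K3 * G k)"
        unfolding mult.commute[of "ennreal K3"] by (intro lnorm_mono mult_left_mono K3(2) w) auto
      also have "\<dots> = ennreal K3 * lnorm w G" by (rule lnorm_cmult)
      finally show "lnorm w H \<le> ennreal K3 * lnorm w G" .
    qed auto
    also have "\<dots> = ennreal K * lnorm \<sigma> ?w * lnorm w G"
      unfolding K_def using K1(1) K2(1) K3(1) D by (simp add: ennreal_mult mult_ac)
    finally show ?thesis unfolding G_def[abs_def] .
  qed
  moreover have "0 \<le> K" using K1(1) K2(1) K3(1) D by (simp add: K_def)
  ultimately show ?thesis by blast
qed

end

section \<open>Coefficients of the sparse grid operator\<close>

lemma infsum_finite_sum: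
  fixes g :: "'i \<Rightarrow> 'k \<Rightarrow> complex"
  assumes "finite I" "\<And>i. i \<in> I \<Longrightarrow> g i summable_on A"
  shows "(\<lambda>k. \<Sum>i\<in>I. g i k) summable_on A" "(\<Sum>\<^sub>\<infinity>k\<in>A. \<Sum>i\<in>I. g i k) = (\<Sum>i\<in>I. infsum (g i) A)"
proof -
  have "((\<lambda>k. \<Sum>i\<in>I. g i k) has_sum (\<Sum>i\<in>I. infsum (g i) A)) A"
    using assms
  proof (induction I rule: finite_induct)
    case (insert i I)
    then show ?case by (simp add: has_sum_add)
  qed simp
  then show "(\<lambda>k. \<Sum>i\<in>I. g i k) summable_on A" "(\<Sum>\<^sub>\<infinity>k\<in>A. \<Sum>i\<in>I. g i k) = (\<Sum>i\<in>I. infsum (g i) A)"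
    by (auto simp: has_sum_imp_summable infsumI)
qed

section \<open>Multivariate operators as products of univariate matrices\<close>

text \<open>Level \<open>-1\<close> included, as in \<^const>\<open>quasi_prod\<close>.\<close>

definition qz :: "(nat \<Rightarrow> int \<Rightarrow> complex) \<Rightarrow> (nat \<Rightarrow> int \<Rightarrow> complex) \<Rightarrow> int \<Rightarrow> int \<Rightarrow> int \<Rightarrow> complex" where
  "qz F P j l k = (if j < 0 then 0 else qc F P (nat j) l k)"

abbreviation qprod where
  "qprod F P j l k \<equiv> \<Prod>i\<in>UNIV. qz F P (j $ i) (l $ i) (k $ i)"

abbreviation eprod where
  "eprod F P j l k \<equiv> \<Prod>i\<in>UNIV. ec F P (j $ i) (l $ i) (k $ i)"

lemma ec_conv_qz: "ec F P j l k = qz F P (int j) l k - qz F P (int j - 1) l k"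
  by (cases j) (auto simp: ec_def qz_def nat_add_distrib)

lemma finite_vec_choices:
  assumes "\<And>i :: 'd :: finite. finite (A i)"
  shows "finite {l :: 'a ^ 'd. \<forall>i. l $ i \<in> A i}"
proof (rule finite_subset)
  show "{l :: 'a ^ 'd. \<forall>i. l $ i \<in> A i} \<subseteq> vec_lambda ` PiE UNIV A"
    by (auto intro!: image_eqI[of _ _ "vec_nth _"])
  show "finite (vec_lambda ` PiE UNIV A)" using assms by (intro finite_imageI finite_PiE) auto
qed

lemma sum_prod_vec_choices:
  fixes g :: "'d :: finite \<Rightarrow> 'a \<Rightarrow> 'b :: comm_semiring_1"
  assumes "\<And>i. finite (A i)"
  shows "(\<Sum>x\<in>{x :: 'a ^ 'd. \<forall>i. x $ i \<in> A i}. \<Prod>i\<in>UNIV. g i (x $ i)) = (\<Prod>i\<in>UNIV. sum (g i) (A i))"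
proof -
  have "(\<Prod>i\<in>UNIV. sum (g i) (A i)) = (\<Sum>h\<in>PiE UNIV A. \<Prod>i\<in>UNIV. g i (h i))"
    using assms by (subst prod_sum_PiE) auto
  also have "\<dots> = (\<Sum>x\<in>{x :: 'a ^ 'd. \<forall>i. x $ i \<in> A i}. \<Prod>i\<in>UNIV. g i (x $ i))"
    by (rule sum.reindex_bij_witness[of _ vec_nth vec_lambda]) auto
  finally show ?thesis ..
qed

text \<open>Only k congruent to l modulo the power of two in every variable give a nonzero product,
  and h below parametrizes exactly these. The substitution is valid for \<open>infsum\<close>
  whether or not the series converges, both sides having the same default value.\<close>

lemma fourier_coeff_quasi_prod:
  fixes j :: "int ^ 'd" and \<phi> :: "nat \<Rightarrow> real \<Rightarrow> complex"
    and \<psi> :: "nat \<Rightarrow> (real \<Rightarrow> complex) \<Rightarrow> complex"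
  defines "F \<equiv> \<lambda>j l. fourier_coeff (\<phi> j) (of_int l)" and "P \<equiv> \<lambda>j l. distr_coeff (\<psi> j) l"
  shows "quasi_prod \<phi> \<psi> j f absolutely_integrable_on torus_cell"
    "fourier_coeff (quasi_prod \<phi> \<psi> j f) (real_vec l) =
      (\<Sum>\<^sub>\<infinity>k. qprod F P j l k * fourier_coeff f (real_vec k))"
proof -
  define c where "c l = (\<Prod>i\<in>UNIV. F (nat (j $ i)) (l $ i)) *
        (\<Sum>\<^sub>\<infinity>\<mu> :: int ^ 'd. fourier_coeff f (real_vec (\<chi> i. l $ i + 2 ^ nat (j $ i) * \<mu> $ i)) *
           (\<Prod>i\<in>UNIV. P (nat (j $ i)) (l $ i + 2 ^ nat (j $ i) * \<mu> $ i)))" for l :: "int ^ 'd"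
  define L where "L = {l :: int ^ 'd. \<forall>i. l $ i \<in> freqs (nat (j $ i))}"
  have L: "finite L" unfolding L_def by (rule finite_vec_choices) (rule finite_freqs)
  let ?e = "\<lambda>l x. exp (\<i> * of_real (real_vec l \<bullet> x))"
  have int: "(\<lambda>x. c l * ?e l x) absolutely_integrable_on torus_cell" for l
    by (rule fourier_coeff_cmult(1)[OF absolutely_integrable_exp_torus])
  have "quasi_prod \<phi> \<psi> j f absolutely_integrable_on torus_cell \<and>
    fourier_coeff (quasi_prod \<phi> \<psi> j f) (real_vec l) =
      (\<Sum>\<^sub>\<infinity>k. qprod F P j l k * fourier_coeff f (real_vec k))"
  proof (cases "\<exists>i. j $ i < 0")
    case True
    then have Z: "qprod F P j l k = 0" for k
      by (auto intro!: prod_zero simp: qz_def)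
    have Q: "quasi_prod \<phi> \<psi> j f = (\<lambda>x. 0)" using True by (auto simp: quasi_prod_def fun_eq_iff)
    show ?thesis unfolding Q Z by (simp add: fourier_coeff_def)
  next
    case False
    then have nn: "0 \<le> j $ i" for i by (simp add: not_less)
    have qz: "qz F P (j $ i) l k = qc F P (nat (j $ i)) l k" for i l k using nn[of i] by (simp add: qz_def)
    have eq: "quasi_prod \<phi> \<psi> j f = (\<lambda>x. \<Sum>l\<in>L. c l * ?e l x)"
      using False by (auto simp: quasi_prod_def fun_eq_iff L_def c_def F_def P_def)
    have "fourier_coeff (quasi_prod \<phi> \<psi> j f) (real_vec l) = (\<Sum>l'\<in>L. c l' * (if l' = l then 1 else 0))"
      unfolding eq fourier_coeff_sum(2)[OF int L] fourier_coeff_cmult(2)[OF absolutely_integrable_exp_torus]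
        fourier_coeff_exp ..
    also have "\<dots> = (if l \<in> L then c l else 0)"
      using L by (simp add: if_distrib cong: if_cong)
    also have "\<dots> = (\<Sum>\<^sub>\<infinity>k. qprod F P j l k * fourier_coeff f (real_vec k))"
    proof (cases "l \<in> L")
      case False
      then have Z: "qprod F P j l k = 0" for k
        by (auto intro!: prod_zero simp: qz qc_def L_def)
      show ?thesis using False unfolding Z by simp
    next
      case True
      define h where "h \<mu> = (\<chi> i. l $ i + 2 ^ nat (j $ i) * \<mu> $ i)" for \<mu> :: "int ^ 'd"
      define g where "g k = qprod F P j l k * fourier_coeff f (real_vec k)" for k
      have inj: "inj h" by (auto simp: inj_def h_def vec_eq_iff)
      have "infsum g UNIV = infsum g (range h)"
      proof (rule infsum_cong_neutral)
        fix k assume "k \<in> UNIV - range h"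
        moreover have "h (\<chi> i. (k $ i - l $ i) div 2 ^ nat (j $ i)) = k" if "\<forall>i. 2 ^ nat (j $ i) dvd k $ i - l $ i"
          using that by (auto simp: h_def vec_eq_iff)
        ultimately have "\<not> (\<forall>i. 2 ^ nat (j $ i) dvd k $ i - l $ i)" by (metis DiffD2 rangeI)
        then have Z: "qprod F P j l k = 0"
          by (auto intro!: prod_zero simp: qz qc_def)
        show "g k = 0" unfolding g_def Z by simp
      qed auto
      also have "\<dots> = infsum (g \<circ> h) UNIV" by (rule infsum_reindex[OF inj])
      also have "\<dots> = (\<Sum>\<^sub>\<infinity>\<mu>. (\<Prod>i\<in>UNIV. F (nat (j $ i)) (l $ i)) * (fourier_coeff f (real_vec (h \<mu>)) *
          (\<Prod>i\<in>UNIV. P (nat (j $ i)) (h \<mu> $ i))))"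
      proof (rule infsum_cong)
        fix \<mu>
        have "(\<Prod>i\<in>UNIV. qz F P (j $ i) (l $ i) (h \<mu> $ i)) = (\<Prod>i\<in>UNIV. F (nat (j $ i)) (l $ i) * P (nat (j $ i)) (h \<mu> $ i))"
          using True by (intro prod.cong) (auto simp: qz qc_def L_def h_def)
        then show "(g \<circ> h) \<mu> = (\<Prod>i\<in>UNIV. F (nat (j $ i)) (l $ i)) * (fourier_coeff f (real_vec (h \<mu>)) *
          (\<Prod>i\<in>UNIV. P (nat (j $ i)) (h \<mu> $ i)))"
          by (simp add: g_def prod.distrib)
      qed
      also have "\<dots> = c l" unfolding c_def infsum_cmult_right' by (simp add: h_def)
      finally show ?thesis using True unfolding g_def[abs_def] by simp
    qed
    finally show ?thesis using fourier_coeff_sum(1)[OF int L] by (simp add: eq)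
  qed
  then show "quasi_prod \<phi> \<psi> j f absolutely_integrable_on torus_cell"
    "fourier_coeff (quasi_prod \<phi> \<psi> j f) (real_vec l) =
      (\<Sum>\<^sub>\<infinity>k. qprod F P j l k * fourier_coeff f (real_vec k))" by auto
qed

text \<open>An operator of a given level is the finite sum of its level differences, so summability
  passes from the blocks to the products. This permits splitting the sum over the sets S in
  \<open>eta\<close>.\<close>

lemma prod_qc_summable:
  fixes l :: "int ^ 'd"
  assumes "\<And>j :: nat ^ 'd. (\<lambda>k. eprod F P j l k * x k) summable_on UNIV"
  shows "(\<lambda>k. qprod F P j l k * x k) summable_on UNIV"
proof (cases "\<exists>i. j $ i < 0")
  case True
  then have Z: "qprod F P j l k = 0" for k
    by (auto intro!: prod_zero simp: qz_def)
  show ?thesis unfolding Z by simp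
next
  case False
  then have nn: "0 \<le> j $ i" for i by (simp add: not_less)
  have qz: "qz F P (j $ i) l k = qc F P (nat (j $ i)) l k" for i l k using nn[of i] by (simp add: qz_def)
  have "qprod F P j l k * x k
      = (\<Sum>j'\<in>{j' :: nat ^ 'd. \<forall>i. j' $ i \<in> {..nat (j $ i)}}. eprod F P j' l k * x k)" for k
    by (simp add: sum_prod_vec_choices[of "\<lambda>i. {..nat (j $ i)}" "\<lambda>i m. ec F P m (l $ i) (k $ i)", simplified] sum_ec qz
        flip: sum_distrib_right)
  moreover have "finite {j' :: nat ^ 'd. \<forall>i. j' $ i \<in> {..nat (j $ i)}}" by (rule finite_vec_choices) auto
  ultimately show ?thesis
    using infsum_finite_sum(1)[of "{j' :: nat ^ 'd. \<forall>i. j' $ i \<in> {..nat (j $ i)}}"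
        "\<lambda>j' k. eprod F P j' l k * x k" UNIV] assms by simp
qed

lemma fourier_coeff_eta:
  fixes j :: "nat ^ 'd" and \<phi> :: "nat \<Rightarrow> real \<Rightarrow> complex"
    and \<psi> :: "nat \<Rightarrow> (real \<Rightarrow> complex) \<Rightarrow> complex"
  defines "F \<equiv> \<lambda>j l. fourier_coeff (\<phi> j) (of_int l)" and "P \<equiv> \<lambda>j l. distr_coeff (\<psi> j) l"
  assumes "\<And>j :: nat ^ 'd. (\<lambda>k. eprod F P j l k * fourier_coeff f (real_vec k)) summable_on UNIV"
  shows "fourier_coeff (eta \<phi> \<psi> j f) (real_vec l) =
      (\<Sum>\<^sub>\<infinity>k. eprod F P j l k * fourier_coeff f (real_vec k))"
proof -
  define J where "J S = (\<chi> i. int (j $ i) - (if i \<in> S then 1 else 0))" for S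
  define g where "g S k = (\<Prod>i\<in>UNIV. qz F P (J S $ i) (l $ i) (k $ i)) * fourier_coeff f (real_vec k)" for S k
  have g: "g S summable_on UNIV" for S unfolding g_def by (rule prod_qc_summable[OF assms(3)])
  have "fourier_coeff (eta \<phi> \<psi> j f) (real_vec l)
      = fourier_coeff (\<lambda>x. \<Sum>S\<in>UNIV. (-1) ^ card S * quasi_prod \<phi> \<psi> (J S) f x) (real_vec l)"
    unfolding eta_def[abs_def] J_def ..
  also have "\<dots> = (\<Sum>S\<in>UNIV. fourier_coeff (\<lambda>x. (-1) ^ card S * quasi_prod \<phi> \<psi> (J S) f x) (real_vec l))"
    by (intro fourier_coeff_sum(2) fourier_coeff_cmult(1) fourier_coeff_quasi_prod(1)) auto
  also have "\<dots> = (\<Sum>S\<in>UNIV. (-1) ^ card S * infsum (g S) UNIV)"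
    unfolding fourier_coeff_cmult(2)[OF fourier_coeff_quasi_prod(1)] fourier_coeff_quasi_prod(2) g_def F_def P_def ..
  also have "\<dots> = (\<Sum>S\<in>UNIV. infsum (\<lambda>k. (-1) ^ card S * g S k) UNIV)"
    by (simp only: infsum_cmult_right')
  also have "\<dots> = (\<Sum>\<^sub>\<infinity>k. \<Sum>S\<in>UNIV. (-1) ^ card S * g S k)"
    by (rule infsum_finite_sum(2)[symmetric]) (auto intro!: summable_on_cmult_right g)
  also have "\<dots> = (\<Sum>\<^sub>\<infinity>k. eprod F P j l k * fourier_coeff f (real_vec k))"
  \<comment> \<open>The alternating sum over S is the product of the differences multiplied out,
    with S the variables taking the lower level.\<close>
  proof (rule infsum_cong)
    fix k
    have "(\<Prod>i\<in>UNIV. qz F P (J S $ i) (l $ i) (k $ i))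
        = (\<Prod>i\<in>S. qz F P (int (j $ i) - 1) (l $ i) (k $ i)) * (\<Prod>i\<in>UNIV - S. qz F P (int (j $ i)) (l $ i) (k $ i))" for S
      by (subst prod.subset_diff[of S UNIV]) (auto simp: J_def mult.commute intro!: arg_cong2[of _ _ _ _ "(*)"] prod.cong)
    then show "(\<Sum>S\<in>UNIV. (-1) ^ card S * g S k) = eprod F P j l k * fourier_coeff f (real_vec k)"
      unfolding ec_conv_qz g_def
      by (subst prod_diff_conv_sum) (auto simp: sum_distrib_right mult.assoc)
  qed
  finally show ?thesis .
qed

lemma eta_integrable: "eta \<phi> \<psi> j f absolutely_integrable_on torus_cell"
  unfolding eta_def[abs_def]
  by (intro fourier_coeff_sum(1) fourier_coeff_cmult(1) fourier_coeff_quasi_prod(1)) auto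

section \<open>Telescoping over all levels\<close>

context quasi_coeffs
begin

lemma qc_diagonal_tendsto: "(\<lambda>n. qc F P n l l) \<longlonglongrightarrow> 1"
proof -
  have ev: "eventually (\<lambda>n. l \<in> freqs n) sequentially"
  proof -
    have "l \<in> freqs n" if "nat (2 * \<bar>l\<bar> + 1) \<le> n" for n
    proof -
      have "int n < 2 ^ n" using of_nat_less_two_power[of n, where 'a = int] by simp
      moreover have "2 * \<bar>l\<bar> + 1 \<le> int n" using that by linarith
      ultimately show ?thesis unfolding mem_freqs_iff by linarith
    qed
    then show ?thesis by (auto simp: eventually_sequentially)
  qed
  have "(\<lambda>n. C3 * (\<bar>real_of_int l\<bar> powr s * (2 powr (- s)) ^ n)) \<longlonglongrightarrow> C3 * (\<bar>real_of_int l\<bar> powr s * 0)"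
    using s by (intro tendsto_intros LIMSEQ_power_zero) (simp add: powr_less_one)
  then have lim: "(\<lambda>n. C3 * (\<bar>real_of_int l\<bar> powr s * (2 powr (- s)) ^ n)) \<longlonglongrightarrow> 0" by simp
  have "(\<lambda>n. 1 - qc F P n l l) \<longlonglongrightarrow> 0"
  proof (rule Lim_null_comparison[OF _ lim], use ev in eventually_elim)
    fix n assume n: "l \<in> freqs n"
    have "norm (1 - qc F P n l l) \<le> C3 * \<bar>real_of_int l / 2 ^ n\<bar> powr s"
      using FP_le[OF n] n by (simp add: qc_def)
    also have "\<bar>real_of_int l / 2 ^ n\<bar> powr s = \<bar>real_of_int l\<bar> powr s * (2 powr (- s)) ^ n"
      by (simp add: abs_divide powr_divide powr_powr powr_minus_divide power_divide mult.commute flip: powr_realpow)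
    finally show "norm (1 - qc F P n l l) \<le> C3 * (\<bar>real_of_int l\<bar> powr s * (2 powr (- s)) ^ n)" .
  qed
  then have "(\<lambda>n. 1 - (1 - qc F P n l l)) \<longlonglongrightarrow> 1 - 0" by (intro tendsto_intros)
  then show ?thesis by simp
qed

lemma qc_off_diagonal:
  assumes "l \<noteq> k"
  shows "eventually (\<lambda>n. qc F P n l k = 0) sequentially"
proof -
  have "qc F P n l k = 0" if "nat \<bar>k - l\<bar> \<le> n" for n
  proof -
    have "int n < 2 ^ n" using of_nat_less_two_power[of n, where 'a = int] by simp
    with that have "\<bar>k - l\<bar> < 2 ^ n" by linarith
    then have "\<not> 2 ^ n dvd k - l" using assms dvd_imp_le_int[of "k - l" "2 ^ n"] by auto
    then show ?thesis by (simp add: qc_def)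
  qed
  then show ?thesis by (auto simp: eventually_sequentially)
qed

text \<open>The boxes \<open>B n\<close> exhaust the finite sets of levels, so a summable family can
  be summed along them. Over a box the sum factorizes and telescopes to a product of entries of
  level n, which tend to 1 on the diagonal and vanish for large n off it.\<close>

lemma infsum_levels:
  fixes l k :: "int ^ 'd"
  assumes "(\<lambda>j :: nat ^ 'd. eprod F P j l k * c) summable_on UNIV"
  shows "(\<Sum>\<^sub>\<infinity>j :: nat ^ 'd. eprod F P j l k * c) = (if k = l then c else 0)"
proof -
  define g where "g j = eprod F P j l k * c" for j :: "nat ^ 'd"
  define B where "B n = {j :: nat ^ 'd. \<forall>i. j $ i \<in> {..n}}" for n
  have B: "finite (B n)" for n unfolding B_def by (rule finite_vec_choices) auto
  have lim: "filterlim B (finite_subsets_at_top UNIV) sequentially"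
    unfolding filterlim_finite_subsets_at_top
  proof (intro allI impI)
    fix X :: "(nat ^ 'd) set" assume X: "finite X \<and> X \<subseteq> UNIV"
    define N where "N = Max (insert 0 (linf ` X))"
    have "X \<subseteq> B n" if n: "N \<le> n" for n
    proof
      fix j assume "j \<in> X"
      then have "linf j \<le> N" using X by (auto simp: N_def intro!: Max_ge)
      then show "j \<in> B n" using le_linf[of j] n by (auto simp: B_def intro: order_trans)
    qed
    then show "\<forall>\<^sub>F n in sequentially. finite (B n) \<and> X \<subseteq> B n \<and> B n \<subseteq> UNIV"
      using B by (auto simp: eventually_sequentially)
  qed
  have "(g has_sum infsum g UNIV) UNIV" using assms unfolding g_def by (rule has_sum_infsum)
  then have "(sum g \<longlongrightarrow> infsum g UNIV) (finite_subsets_at_top UNIV)" by (simp add: has_sum_def)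
  from filterlim_compose[OF this lim] have 1: "(\<lambda>n. sum g (B n)) \<longlonglongrightarrow> infsum g UNIV" .
  have sum: "sum g (B n) = (\<Prod>i\<in>UNIV. qc F P n (l $ i) (k $ i)) * c" for n
    unfolding g_def B_def
    by (simp add: sum_prod_vec_choices[of "\<lambda>i. {..n}" "\<lambda>i m. ec F P m (l $ i) (k $ i)", simplified] sum_ec
        flip: sum_distrib_right)
  have 2: "(\<lambda>n. sum g (B n)) \<longlonglongrightarrow> (if k = l then c else 0)"
  proof (cases "k = l")
    case True
    have "(\<lambda>n. (\<Prod>i\<in>UNIV. qc F P n (l $ i) (l $ i)) * c) \<longlonglongrightarrow> (\<Prod>i\<in>(UNIV :: 'd set). 1) * c"
      by (intro tendsto_mult tendsto_prod qc_diagonal_tendsto tendsto_const)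
    then show ?thesis using True by (simp add: sum)
  next
    case False
    then obtain i where "l $ i \<noteq> k $ i" by (metis vec_eq_iff)
    from qc_off_diagonal[OF this] have "eventually (\<lambda>n. sum g (B n) = 0) sequentially"
      by eventually_elim (auto simp: sum intro: prod_zero)
    then show ?thesis using False by (simp add: tendsto_eventually)
  qed
  show ?thesis using LIMSEQ_unique[OF 1 2] unfolding g_def[abs_def] .
qed

text \<open>Absolute summability over the pairs (j,k) gives the total two readings: it is x l when
  the levels are summed first, and it splits into the levels in \<Delta> and the rest. The error
  coefficient is therefore the rest, bounded by the sum of its moduli.\<close>

lemma error_coefficient_le:
  fixes l :: "int ^ 'd" and x :: "int ^ 'd \<Rightarrow> complex"
  defines "g \<equiv> \<lambda>z :: (nat ^ 'd) \<times> (int ^ 'd). eprod F P (fst z) l (snd z) * x (snd z)"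
  assumes fin: "nnsum (\<lambda>z. ennreal (norm (g z))) < top" and "finite \<Delta>"
  shows "\<And>j. (\<lambda>k. g (j, k)) summable_on UNIV"
    "ennreal (norm (x l - (\<Sum>j\<in>\<Delta>. \<Sum>\<^sub>\<infinity>k. g (j, k)))) \<le> nnsum (\<lambda>z. if fst z \<in> - \<Delta> then ennreal (norm (g z)) else 0)"
proof -
  have abs: "(\<lambda>z. norm (g z)) summable_on UNIV"
    using fin nnsum_ennreal_infsum[of "\<lambda>z. norm (g z)"] by (auto split: if_splits)
  then have sum: "g summable_on UNIV" by (rule abs_summable_summable)
  then have sub: "g summable_on A" for A by (rule summable_on_subset_banach) simp
  have sumP: "(\<lambda>(j, k). g (j, k)) summable_on (UNIV \<times> UNIV)" using sum by simp
  show row: "(\<lambda>k. g (j, k)) summable_on UNIV" for j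
    using summable_on_SigmaD1[OF sumP, of j] by simp
  have col: "(\<lambda>j. g (j, k)) summable_on UNIV" for k
  proof -
    have "(g \<circ> prod.swap) summable_on UNIV"
      using sum by (subst summable_on_reindex[symmetric]) (auto simp: inj_on_def)
    then have "(\<lambda>(k, j). g (j, k)) summable_on (UNIV \<times> UNIV)"
      by (simp add: o_def prod.swap_def case_prod_unfold)
    from summable_on_SigmaD1[OF this, of k] show ?thesis by simp
  qed
  have "infsum g UNIV = (\<Sum>\<^sub>\<infinity>j. \<Sum>\<^sub>\<infinity>k. g (j, k))"
    using infsum_Sigma_banach[of g UNIV "\<lambda>_. UNIV"] sum by simp
  also have "\<dots> = (\<Sum>\<^sub>\<infinity>k. \<Sum>\<^sub>\<infinity>j. g (j, k))"
    using sumP by (rule infsum_swap_banach)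
  \<comment> \<open>With the levels summed first, each frequency k contributes by telescoping only
    at k = l.\<close>
  also have "\<dots> = (\<Sum>\<^sub>\<infinity>k. if k = l then x k else 0)"
    using infsum_levels[of l _ "x _"] col by (intro infsum_cong) (simp add: g_def)
  also have "\<dots> = (\<Sum>\<^sub>\<infinity>k\<in>{l}. x k)" by (rule infsum_cong_neutral) auto
  also have "\<dots> = x l" by simp
  finally have tot: "infsum g UNIV = x l" .
  have "(UNIV :: ((nat ^ 'd) \<times> (int ^ 'd)) set) = (\<Delta> \<times> UNIV) \<union> ((- \<Delta>) \<times> UNIV)" by auto
  then have "infsum g UNIV = infsum g ((\<Delta> \<times> UNIV) \<union> ((- \<Delta>) \<times> UNIV))" by (rule arg_cong)
  also have "\<dots> = infsum g (\<Delta> \<times> UNIV) + infsum g ((- \<Delta>) \<times> UNIV)"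
    by (rule infsum_Un_disjoint[OF sub sub]) auto
  finally have "infsum g UNIV = infsum g (\<Delta> \<times> UNIV) + infsum g ((- \<Delta>) \<times> UNIV)" .
  moreover have "infsum g (\<Delta> \<times> UNIV) = (\<Sum>j\<in>\<Delta>. \<Sum>\<^sub>\<infinity>k. g (j, k))"
    using infsum_Sigma_banach[where f = g and A = \<Delta> and B = "\<lambda>_. UNIV", OF sub] assms(3) by simp
  ultimately have eq: "x l - (\<Sum>j\<in>\<Delta>. \<Sum>\<^sub>\<infinity>k. g (j, k)) = infsum g ((- \<Delta>) \<times> UNIV)"
    using tot by (simp add: algebra_simps)
  have abs': "(\<lambda>z. norm (g z)) summable_on ((- \<Delta>) \<times> UNIV)" using abs by (rule summable_on_subset_banach) simp
  have "norm (infsum g ((- \<Delta>) \<times> UNIV)) \<le> (\<Sum>\<^sub>\<infinity>z\<in>(- \<Delta>) \<times> UNIV. norm (g z))"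
    by (rule norm_infsum_bound[OF abs'])
  also have "\<dots> = (\<Sum>\<^sub>\<infinity>z. if fst z \<in> - \<Delta> then norm (g z) else 0)"
    by (rule infsum_cong_neutral) auto
  finally have "ennreal (norm (x l - (\<Sum>j\<in>\<Delta>. \<Sum>\<^sub>\<infinity>k. g (j, k)))) \<le> ennreal (\<Sum>\<^sub>\<infinity>z. if fst z \<in> - \<Delta> then norm (g z) else 0)"
    unfolding eq by (rule ennreal_leI)
  also have "\<dots> = nnsum (\<lambda>z. ennreal (if fst z \<in> - \<Delta> then norm (g z) else 0))"
  proof -
    have "(\<lambda>z. norm (g z)) summable_on ((- \<Delta>) \<times> UNIV) \<longleftrightarrow>
      (\<lambda>z. if fst z \<in> - \<Delta> then norm (g z) else 0) summable_on UNIV"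
      by (rule summable_on_cong_neutral) auto
    with abs' have "(\<lambda>z. if fst z \<in> - \<Delta> then norm (g z) else 0) summable_on UNIV" by simp
    then show ?thesis by (subst nnsum_ennreal_infsum) auto
  qed
  also have "\<dots> = nnsum (\<lambda>z. if fst z \<in> - \<Delta> then ennreal (norm (g z)) else 0)"
    by (intro nn_integral_cong) auto
  finally show "ennreal (norm (x l - (\<Sum>j\<in>\<Delta>. \<Sum>\<^sub>\<infinity>k. g (j, k)))) \<le> nnsum (\<lambda>z. if fst z \<in> - \<Delta> then ennreal (norm (g z)) else 0)" .
qed

end

section \<open>The approximation theorem\<close>

lemma mixed_wiener_norm_eq:
  assumes "1 \<le> q"
  shows "mixed_wiener_norm q \<gamma> (f :: real ^ 'd \<Rightarrow> complex)
    = lnorm (recip q) (\<lambda>l. ennreal (\<Prod>i\<in>UNIV. ang (l $ i) powr \<gamma>) * ennreal (norm (fourier_coeff f (real_vec l))))"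
proof -
  have "mixed_wiener_norm q \<gamma> f = lnorm (recip q) (\<lambda>k. ennreal (norm ((\<Prod>j\<in>UNIV. (1 + \<bar>real_of_int (k $ j)\<bar>) powr \<gamma>) *
      (1 + norm (real_vec k)) powr 0 * norm (fourier_coeff f (real_vec k)))))"
    unfolding mixed_wiener_norm_def wiener_norm_def by (rule lq_norm_eq_lnorm[OF assms])
  also have "\<dots> = lnorm (recip q) (\<lambda>l. ennreal (\<Prod>i\<in>UNIV. ang (l $ i) powr \<gamma>) * ennreal (norm (fourier_coeff f (real_vec l))))"
  proof (intro arg_cong[of _ _ "lnorm (recip q)"] ext)
    fix k :: "int ^ 'd"
    have "1 + norm (real_vec k) \<noteq> 0" by (smt (verit) norm_ge_zero)
    then show "ennreal (norm ((\<Prod>j\<in>UNIV. (1 + \<bar>real_of_int (k $ j)\<bar>) powr \<gamma>) *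
      (1 + norm (real_vec k)) powr 0 * norm (fourier_coeff f (real_vec k))))
      = ennreal (\<Prod>i\<in>UNIV. ang (k $ i) powr \<gamma>) * ennreal (norm (fourier_coeff f (real_vec k)))"
      by (simp add: ang_def abs_mult abs_prod ennreal_mult prod_nonneg)
  qed
  finally show ?thesis .
qed

lemma wiener_norm_eq:
  assumes "1 \<le> p"
  shows "wiener_norm p \<alpha> \<beta> (f :: real ^ 'd \<Rightarrow> complex)
    = lnorm (recip p) (\<lambda>k. ennreal ((\<Prod>i\<in>UNIV. ang (k $ i) powr \<alpha>) * angv k powr \<beta> * norm (fourier_coeff f (real_vec k))))"
proof -
  have "wiener_norm p \<alpha> \<beta> f = lnorm (recip p) (\<lambda>k. ennreal (norm ((\<Prod>j\<in>UNIV. (1 + \<bar>real_of_int (k $ j)\<bar>) powr \<alpha>) *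
      (1 + norm (real_vec k)) powr \<beta> * norm (fourier_coeff f (real_vec k)))))"
    unfolding wiener_norm_def by (rule lq_norm_eq_lnorm[OF assms])
  then show ?thesis by (simp add: ang_def angv_def abs_mult abs_prod)
qed

lemma wiener_norm_antimono:
  assumes "1 \<le> p" "1 \<le> q" "recip q \<le> recip p"
  shows "wiener_norm q \<alpha> \<beta> (f :: real ^ 'd \<Rightarrow> complex) \<le> wiener_norm p \<alpha> \<beta> f"
  unfolding wiener_norm_eq[OF assms(1)] wiener_norm_eq[OF assms(2)]
  using recip_bounds(1)[OF assms(2)] assms(3) by (rule lnorm_antimono)

lemma (in quasi_coeffs) sparse_grid_error_le:
  fixes \<phi> :: "nat \<Rightarrow> real \<Rightarrow> complex" and \<psi> :: "nat \<Rightarrow> (real \<Rightarrow> complex) \<Rightarrow> complex"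
  assumes FP: "F = (\<lambda>j l. fourier_coeff (\<phi> j) (of_int l))" "P = (\<lambda>j l. distr_coeff (\<psi> j) l)"
    and pq: "1 \<le> p" "1 \<le> q" "u = recip q" "0 \<le> \<sigma>" "u = \<sigma> + recip p"
    and \<gamma>: "0 < \<gamma>" and T: "T < 1" and a: "\<gamma> + \<sigma> \<le> \<alpha>" "\<gamma> - \<beta> + \<sigma> < \<alpha>"
    and \<kappa>\<sigma>: "\<kappa> + \<sigma> < min (\<alpha> + \<beta>) \<alpha>" and s_gt: "max (\<alpha> + \<beta>) \<alpha> < s"
  shows "\<exists>C\<ge>0. \<forall>f \<in> (wiener_space p \<alpha> \<beta> :: (real ^ 'd \<Rightarrow> complex) set). \<forall>n\<ge>1.
           mixed_wiener_norm q \<gamma> (\<lambda>x. f x - sparse_grid_op \<phi> \<psi> n T f x)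
             \<le> ennreal (C * Omega_mix CARD('d) \<alpha> \<beta> \<gamma> \<sigma> T n) * wiener_norm p \<alpha> \<beta> f"
proof -
  \<comment> \<open>The slack below min (\<alpha> + \<beta>) \<alpha> is halved because it has to
    hold \<delta> twice, for the sum over frequencies and for the sum over levels.\<close>
  define \<delta> where "\<delta> = min ((min (\<alpha> + \<beta>) \<alpha> - \<kappa> - \<sigma>) / 2) (s - max (\<alpha> + \<beta>) \<alpha>)"
  have \<delta>: "0 < \<delta>" "\<kappa> + \<sigma> + 2 * \<delta> \<le> min (\<alpha> + \<beta>) \<alpha>" "max (\<alpha> + \<beta>) \<alpha> + \<delta> \<le> s"
  proof -
    have "\<delta> \<le> (min (\<alpha> + \<beta>) \<alpha> - \<kappa> - \<sigma>) / 2" "\<delta> \<le> s - max (\<alpha> + \<beta>) \<alpha>" by (simp_all only: \<delta>_def min.cobounded1 min.cobounded2)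
    note le = this
    have "k + t + 2 * d \<le> m" if "d \<le> (m - k - t) / 2" for k t d m :: real
      using that by (simp add: field_simps)
    from this[OF le(1)] show "\<kappa> + \<sigma> + 2 * \<delta> \<le> min (\<alpha> + \<beta>) \<alpha>" .
    have "m + d \<le> t" if "d \<le> t - m" for t d m :: real
      using that by linarith
    from this[OF le(2)] show "max (\<alpha> + \<beta>) \<alpha> + \<delta> \<le> s" .
    have "0 < (m - k - t) / 2" if "k + t < m" for k t m :: real
      using that by (simp add: field_simps)
    from this[OF \<kappa>\<sigma>] have "0 < (min (\<alpha> + \<beta>) \<alpha> - \<kappa> - \<sigma>) / 2" .
    moreover have "0 < s - max (\<alpha> + \<beta>) \<alpha>" using s_gt by (simp only: diff_gt_0_iff_gt)
    ultimately have "0 < (min (\<alpha> + \<beta>) \<alpha> - \<kappa> - \<sigma>) / 2" "0 < s - max (\<alpha> + \<beta>) \<alpha>" .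
    then show "0 < \<delta>" by (simp only: \<delta>_def min_less_iff_conj)
  qed
  have \<sigma>1: "\<sigma> \<le> 1" using u pq recip_bounds(1)[OF pq(1)] by linarith
  have w: "0 \<le> recip p" by (rule recip_bounds(1)[OF pq(1)])
  define W where "W J j = (if j \<in> J then ennreal (lev (\<alpha> - \<gamma> - \<sigma>) \<beta> j) else 0)" for J and j :: "nat ^ 'd"
  define S where "S x J l = nnsum (\<lambda>z. if fst z \<in> J
        then ennreal (aprod F P (fst z) l (snd z) * x (snd z)) else 0)"
    for x :: "int ^ 'd \<Rightarrow> real" and J :: "(nat ^ 'd) set" and l :: "int ^ 'd"
  define A where "A l = (\<Prod>i\<in>UNIV. ang (l $ i) powr \<gamma>)" for l :: "int ^ 'd"
  obtain K where K: "0 \<le> K" "\<And>x J. (\<forall>k. 0 \<le> x k) \<Longrightarrow>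
    lnorm u (\<lambda>l. ennreal (A l) * S x J l) \<le> ennreal K * lnorm \<sigma> (W J) *
      lnorm (recip p) (\<lambda>k. ennreal ((\<Prod>i\<in>UNIV. ang (k $ i) powr \<alpha>) * angv k powr \<beta> * x k))"
    using lnorm_block_sum_le[where 'd = 'd, OF \<gamma> pq(4) w pq(5) \<delta>] unfolding W_def[abs_def] S_def[abs_def] A_def[abs_def] by blast
  obtain K' where K': "0 \<le> K'" "\<And>n. 1 \<le> n \<Longrightarrow> lnorm \<sigma> (W (- sparse_index n T)) \<le> ennreal (K' * Omega_mix CARD('d) \<alpha> \<beta> \<gamma> \<sigma> T n)"
  proof -
    have "W (- sparse_index n T) = (\<lambda>j. if j \<in> sparse_index n T then 0
            else ennreal (lev (\<alpha> - \<gamma> - \<sigma>) \<beta> j))" for n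
      by (auto simp: W_def fun_eq_iff)
    moreover have "0 \<le> \<alpha> - \<gamma> - \<sigma>" "0 < \<alpha> - \<gamma> - \<sigma> + \<beta>" using a by auto
    ultimately show ?thesis
      using lnorm_weight_le_Omega_mix[where 'd = 'd, OF pq(4) _ _ T, of \<alpha> \<gamma> \<beta>] that by auto
  qed
  \<comment> \<open>Finiteness over all levels comes from the rate itself: for n = 1 the complement
    of the index set is covered by it, and the index set is finite.\<close>
  have fin: "lnorm \<sigma> (W UNIV) < top"
  proof -
    define \<Delta> where "\<Delta> = (sparse_index 1 T :: (nat ^ 'd) set)"
    have \<Delta>: "finite \<Delta>" unfolding \<Delta>_def by (rule finite_sparse_index[OF T])
    have "lnorm \<sigma> (W UNIV) \<le> lnorm \<sigma> (\<lambda>j. W \<Delta> j + W (- \<Delta>) j)"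
      using pq(4) by (intro lnorm_mono) (auto simp: W_def)
    also have "\<dots> \<le> 4 * (lnorm \<sigma> (W \<Delta>) + lnorm \<sigma> (W (- \<Delta>)))"
      by (rule lnorm_add_le[OF pq(4) \<sigma>1])
    also have "\<dots> < top"
    proof -
      have "lnorm \<sigma> (W \<Delta>) \<le> lnorm 1 (W \<Delta>)" by (rule lnorm_antimono[OF pq(4) \<sigma>1])
      also have "\<dots> = sum (W \<Delta>) \<Delta>"
        unfolding lnorm_1 by (rule nnsum_finite_support[OF \<Delta>]) (auto simp: W_def)
      also have "\<dots> < top" using \<Delta> by (simp add: W_def)
      finally have 1: "lnorm \<sigma> (W \<Delta>) < top" .
      have "lnorm \<sigma> (W (- \<Delta>)) \<le> ennreal (K' * Omega_mix CARD('d) \<alpha> \<beta> \<gamma> \<sigma> T 1)"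
        unfolding \<Delta>_def by (rule K'(2)) simp
      also have "\<dots> < top" by simp
      finally have 2: "lnorm \<sigma> (W (- \<Delta>)) < top" .
      have "(4 :: ennreal) < top" using ennreal_less_top[of 4] by simp
      then show ?thesis using 1 2 by (simp add: ennreal_mult_less_top)
    qed
    finally show ?thesis .
  qed
  have "mixed_wiener_norm q \<gamma> (\<lambda>x. f x - sparse_grid_op \<phi> \<psi> n T f x)
             \<le> ennreal (K * K' * Omega_mix CARD('d) \<alpha> \<beta> \<gamma> \<sigma> T n) * wiener_norm p \<alpha> \<beta> f"
    if f: "f \<in> wiener_space p \<alpha> \<beta>" and n: "1 \<le> n" for f :: "real ^ 'd \<Rightarrow> complex" and n
  proof -
    define x where "x k = fourier_coeff f (real_vec k)" for k :: "int ^ 'd"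
    define \<Delta> where "\<Delta> = (sparse_index n T :: (nat ^ 'd) set)"
    have \<Delta>: "finite \<Delta>" unfolding \<Delta>_def by (rule finite_sparse_index[OF T])
    have f1: "f absolutely_integrable_on torus_cell" using f by (simp add: wiener_space_def L1_torus_def)
    have pnorm: "wiener_norm p \<alpha> \<beta> f = lnorm (recip p) (\<lambda>k. ennreal ((\<Prod>i\<in>UNIV. ang (k $ i) powr \<alpha>) * angv k powr \<beta> * norm (x k)))"
      unfolding x_def by (rule wiener_norm_eq[OF pq(1)])
    have f2: "wiener_norm p \<alpha> \<beta> f < top" using f by (simp add: wiener_space_def infinity_ennreal_def)
    have main: "lnorm u (\<lambda>l. ennreal (A l) * S (\<lambda>k. norm (x k)) J l) \<le> ennreal K * lnorm \<sigma> (W J) * wiener_norm p \<alpha> \<beta> f" for J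
      unfolding pnorm by (rule K(2)) simp
    \<comment> \<open>The output weight is at least 1, so the block estimate over all levels bounds
      every single coefficient sum; this is the absolute convergence required for the
      telescoping.\<close>
    have Sfin: "S (\<lambda>k. norm (x k)) UNIV l < top" for l
    proof -
      have "1 \<le> A l" unfolding A_def using \<gamma> ang_ge_1 by (intro prod_ge_1 ge_one_powr_ge_zero) auto
      then have "1 * S (\<lambda>k. norm (x k)) UNIV l \<le> ennreal (A l) * S (\<lambda>k. norm (x k)) UNIV l"
        by (intro mult_right_mono) (auto simp flip: ennreal_1 intro!: ennreal_leI)
      also have "\<dots> \<le> lnorm u (\<lambda>l. ennreal (A l) * S (\<lambda>k. norm (x k)) UNIV l)"
        using le_lnorm[OF u(1), of "\<lambda>l. ennreal (A l) * S (\<lambda>k. norm (x k)) UNIV l"] .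
      also have "\<dots> \<le> ennreal K * lnorm \<sigma> (W UNIV) * wiener_norm p \<alpha> \<beta> f" by (rule main)
      also have "\<dots> < top" using fin f2 by (simp add: ennreal_mult_less_top)
      finally show ?thesis by simp
    qed
    have coeff: "ennreal (norm (fourier_coeff (\<lambda>x. f x - sparse_grid_op \<phi> \<psi> n T f x) (real_vec l))) \<le> S (\<lambda>k. norm (x k)) (- \<Delta>) l" for l
    proof -
      define g where "g z = eprod F P (fst z) l (snd z) * x (snd z)" for z :: "(nat ^ 'd) \<times> (int ^ 'd)"
      have ng: "norm (g z) = aprod F P (fst z) l (snd z) * norm (x (snd z))" for z
        by (simp add: g_def norm_mult prod_norm)
      have gfin: "nnsum (\<lambda>z. ennreal (norm (g z))) < top"
        using Sfin[of l] unfolding S_def ng by simp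
      note E = error_coefficient_le[of l x, folded g_def, OF gfin \<Delta>]
      have s: "(\<lambda>k. eprod F P j l k * fourier_coeff f (real_vec k)) summable_on UNIV" for j :: "nat ^ 'd"
        using E(1)[of j] by (simp add: g_def x_def)
      have eta: "fourier_coeff (eta \<phi> \<psi> j f) (real_vec l) = (\<Sum>\<^sub>\<infinity>k. g (j, k))" for j
        using fourier_coeff_eta[of \<phi> \<psi> l f j, folded FP, OF s] by (simp add: g_def x_def)
      have "fourier_coeff (\<lambda>x. f x - sparse_grid_op \<phi> \<psi> n T f x) (real_vec l)
          = x l - fourier_coeff (\<lambda>x. \<Sum>j\<in>\<Delta>. eta \<phi> \<psi> j f x) (real_vec l)"
        unfolding sparse_grid_op_def \<Delta>_def[symmetric] x_def
        by (intro fourier_coeff_diff f1 fourier_coeff_sum(1)[OF eta_integrable \<Delta>])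
      also have "\<dots> = x l - (\<Sum>j\<in>\<Delta>. \<Sum>\<^sub>\<infinity>k. g (j, k))"
        unfolding fourier_coeff_sum(2)[OF eta_integrable \<Delta>] eta ..
      finally show ?thesis using E(2) unfolding S_def ng[symmetric] by simp
    qed
    have "mixed_wiener_norm q \<gamma> (\<lambda>x. f x - sparse_grid_op \<phi> \<psi> n T f x)
        \<le> lnorm u (\<lambda>l. ennreal (A l) * S (\<lambda>k. norm (x k)) (- \<Delta>) l)"
      unfolding mixed_wiener_norm_eq[OF pq(2)] pq(3)[symmetric] A_def[symmetric]
      by (intro lnorm_mono mult_left_mono coeff u(1)) auto
    also have "\<dots> \<le> ennreal K * lnorm \<sigma> (W (- \<Delta>)) * wiener_norm p \<alpha> \<beta> f" by (rule main)
    also have "\<dots> \<le> ennreal K * ennreal (K' * Omega_mix CARD('d) \<alpha> \<beta> \<gamma> \<sigma> T n) * wiener_norm p \<alpha> \<beta> f"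
      unfolding \<Delta>_def by (intro mult_right_mono mult_left_mono K'(2) n) auto
    also have "ennreal K * ennreal (K' * Omega_mix CARD('d) \<alpha> \<beta> \<gamma> \<sigma> T n) = ennreal (K * K' * Omega_mix CARD('d) \<alpha> \<beta> \<gamma> \<sigma> T n)"
      using K(1) by (simp add: ennreal_mult' mult.assoc)
    finally show ?thesis .
  qed
  then show ?thesis using K(1) K'(1) by (intro exI[of _ "K * K'"]) auto
qed

section \<open>Choice of the damping exponent in the two alternatives\<close>

lemma rpow_le_max_rat:
  assumes "0 \<le> N"
  shows "rpow \<bar>of_int l / 2 ^ j\<bar> N \<le> max 1 (rat j l) powr N"
proof (cases "N = 0")
  case False
  have "\<bar>of_int l / 2 ^ j\<bar> powr N \<le> max 1 (rat j l) powr N"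
    using assms by (intro powr_mono2) (auto simp: rat_def ang_def abs_divide le_max_iff_disj divide_right_mono)
  with False show ?thesis by (simp add: rpow_def)
qed (simp add: rpow_def)

lemma sparse_grid_error_le_of_recip_le:
  fixes p q :: ennreal
    and \<alpha> \<beta> \<gamma> T N s C\<^sub>1 C\<^sub>2 C\<^sub>3 :: real
    and \<phi> :: "nat \<Rightarrow> real \<Rightarrow> complex"
    and \<psi> :: "nat \<Rightarrow> (real \<Rightarrow> complex) \<Rightarrow> complex"
  assumes "1 \<le> p" and "1 \<le> q" and "recip p \<le> recip q"
    and "\<gamma> > 0"
    and "\<gamma> - \<beta> + sigma_pq p q < \<alpha>"
    and "\<gamma> + sigma_pq p q \<le> \<alpha>"
    and "T < 1"
    and "N \<ge> 0"
    and "s > max (\<alpha> + \<beta>) \<alpha>"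
    and "\<forall>j. \<forall>l :: int. norm (distr_coeff (\<psi> j) l) \<le> C\<^sub>1 * (1 + rpow \<bar>of_int l / 2 ^ j\<bar> N)"
    and "\<forall>j. \<forall>l :: int. norm (fourier_coeff (\<phi> j) (of_int l)) \<le> C\<^sub>2"
    and "\<forall>j. \<forall>l\<in>freqs j.
           norm (1 - fourier_coeff (\<phi> j) (of_int l) * distr_coeff (\<psi> j) l)
             \<le> C\<^sub>3 * rpow \<bar>of_int l / 2 ^ j\<bar> s"
    and cond: "min (\<alpha> + \<beta>) \<alpha> > N + recip (conj_exp p) \<or>
         (SUP j. amalgam_norm (conj_exp q) j (\<psi> j)) < \<infinity>"
  shows "\<exists>C\<ge>0. \<forall>f \<in> (wiener_space p \<alpha> \<beta> :: (real ^ 'd \<Rightarrow> complex) set). \<forall>n\<ge>1.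
           mixed_wiener_norm q \<gamma> (\<lambda>x. f x - sparse_grid_op \<phi> \<psi> n T f x)
             \<le> ennreal (C * Omega_mix CARD('d) \<alpha> \<beta> \<gamma> (sigma_pq p q) T n) * wiener_norm p \<alpha> \<beta> f"
proof -
  define \<sigma> where "\<sigma> = sigma_pq p q"
  define u where "u = recip q"
  define F where "F = (\<lambda>j l. fourier_coeff (\<phi> j) (of_int l))"
  define P where "P = (\<lambda>j l. distr_coeff (\<psi> j) l)"
  have \<sigma>: "\<sigma> = u - recip p" "0 \<le> \<sigma>" using assms(3) by (auto simp: \<sigma>_def u_def sigma_pq_def)
  have u: "0 \<le> u" "u \<le> 1" using recip_bounds[OF assms(2)] by (auto simp: u_def)
  \<comment> \<open>Positive because s > \<alpha> and \<alpha> >= \<gamma> + \<sigma> > 0; hence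
    \<open>rpow\<close> with exponent s is an ordinary power.\<close>
  have s: "0 < s" using assms \<sigma>(2) unfolding \<sigma>_def[symmetric] by linarith
  have "\<exists>\<kappa> C4. 0 \<le> \<kappa> \<and> \<kappa> + \<sigma> < min (\<alpha> + \<beta>) \<alpha> \<and> 0 \<le> C4 \<and> (\<forall>j. \<forall>l\<in>freqs j.
      lnorm (1 - u) (\<lambda>\<mu>. ennreal (norm (P j (l + 2 ^ j * \<mu>)) * max 1 (rat j (l + 2 ^ j * \<mu>)) powr (- \<kappa>))) \<le> ennreal C4)"
    using cond
  proof
    assume i: "min (\<alpha> + \<beta>) \<alpha> > N + recip (conj_exp p)"
    define e where "e = (min (\<alpha> + \<beta>) \<alpha> - (N + 1 - recip p)) / 2"
    have e: "0 < e" using i recip_bounds(5)[OF assms(1)] by (simp add: e_def)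
    \<comment> \<open>N undoes the growth of the coefficients and 1 - u + e, with 1 - u = 1/q',
      makes the residue classes summable. As \<sigma> = 1/q - 1/p, the sum \<kappa> + \<sigma> is N
      + 1/p' + e, and e is half of the slack in (i).\<close>
    define \<kappa> where "\<kappa> = N + (1 - u) + e"
    have "0 \<le> \<kappa>" using e u assms(8) by (simp add: \<kappa>_def)
    moreover have "\<kappa> + \<sigma> < min (\<alpha> + \<beta>) \<alpha>"
    proof -
      have "\<kappa> + \<sigma> = N + 1 - recip p + e" by (simp add: \<kappa>_def \<sigma>)
      also have "\<dots> < N + 1 - recip p + 2 * e" using e by simp
      also have "\<dots> = min (\<alpha> + \<beta>) \<alpha>"
      proof -
        have "r + 2 * ((m - r) / 2) = m" for r m :: real by (simp add: field_simps)
        then show ?thesis unfolding e_def .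
      qed
      finally show ?thesis .
    qed
    moreover obtain C where C: "0 \<le> C" "\<And>j l. l \<in> freqs j \<Longrightarrow>
      lnorm (1 - u) (\<lambda>\<mu>. ennreal (max 1 (rat j (l + 2 ^ j * \<mu>)) powr (- (1 - u + e)))) \<le> ennreal C"
      using lnorm_max_rat_progression[of "1 - u" e] u e by auto
    moreover have "lnorm (1 - u) (\<lambda>\<mu>. ennreal (norm (P j (l + 2 ^ j * \<mu>)) * max 1 (rat j (l + 2 ^ j * \<mu>)) powr (- \<kappa>))) \<le> ennreal (2 * \<bar>C\<^sub>1\<bar> * C)"
      if l: "l \<in> freqs j" for j l
    proof -
      have pt: "norm (P j k) * max 1 (rat j k) powr (- \<kappa>) \<le> 2 * \<bar>C\<^sub>1\<bar> * max 1 (rat j k) powr (- (1 - u + e))" for k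
      proof -
        define M where "M = max 1 (rat j k)"
        have M: "1 \<le> M" by (simp add: M_def)
        have "1 + rpow \<bar>of_int k / 2 ^ j\<bar> N \<le> 2 * M powr N"
          using rpow_le_max_rat[OF assms(8), of k j] ge_one_powr_ge_zero[OF M assms(8)] by (simp add: M_def)
        moreover have "0 \<le> 1 + rpow \<bar>of_int k / 2 ^ j\<bar> N" by (auto simp: rpow_def)
        ultimately have "C\<^sub>1 * (1 + rpow \<bar>of_int k / 2 ^ j\<bar> N) \<le> \<bar>C\<^sub>1\<bar> * (2 * M powr N)"
          by (intro mult_mono) auto
        then have "norm (P j k) \<le> \<bar>C\<^sub>1\<bar> * (2 * M powr N)"
          using assms(10) unfolding P_def by (meson order_trans)
        then have "norm (P j k) * M powr (- \<kappa>) \<le> \<bar>C\<^sub>1\<bar> * (2 * M powr N) * M powr (- \<kappa>)"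
          by (intro mult_right_mono) auto
        also have "\<dots> = 2 * \<bar>C\<^sub>1\<bar> * (M powr N * M powr (- \<kappa>))" by simp
        also have "M powr N * M powr (- \<kappa>) = M powr (- (1 - u + e))"
          unfolding powr_add[symmetric] \<kappa>_def by (simp add: algebra_simps)
        finally show ?thesis by (simp add: M_def)
      qed
      have "lnorm (1 - u) (\<lambda>\<mu>. ennreal (norm (P j (l + 2 ^ j * \<mu>)) * max 1 (rat j (l + 2 ^ j * \<mu>)) powr (- \<kappa>)))
        \<le> lnorm (1 - u) (\<lambda>\<mu>. ennreal (2 * \<bar>C\<^sub>1\<bar>) * ennreal (max 1 (rat j (l + 2 ^ j * \<mu>)) powr (- (1 - u + e))))"
        using u pt by (intro lnorm_mono) (auto simp flip: ennreal_mult' intro!: ennreal_leI)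
      also have "\<dots> \<le> ennreal (2 * \<bar>C\<^sub>1\<bar>) * ennreal C"
        unfolding lnorm_cmult by (intro mult_left_mono C(2) l) auto
      finally show ?thesis by (simp add: ennreal_mult')
    qed
    ultimately show ?thesis by (intro exI[of _ \<kappa>] exI[of _ "2 * \<bar>C\<^sub>1\<bar> * C"]) auto
  next
    assume ii: "(SUP j. amalgam_norm (conj_exp q) j (\<psi> j)) < \<infinity>"
    then obtain C4 where C4: "0 \<le> C4" "(SUP j. amalgam_norm (conj_exp q) j (\<psi> j)) = ennreal C4"
      by (cases "SUP j. amalgam_norm (conj_exp q) j (\<psi> j)") (auto simp: infinity_ennreal_def)
    have q': "1 \<le> conj_exp q" "recip (conj_exp q) = 1 - u"
      using recip_bounds[OF assms(2)] by (auto simp: u_def)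
    have "lnorm (1 - u) (\<lambda>\<mu>. ennreal (norm (P j (l + 2 ^ j * \<mu>)) * max 1 (rat j (l + 2 ^ j * \<mu>)) powr (- 0))) \<le> ennreal C4"
      if l: "l \<in> freqs j" for j l
    proof -
      have "lnorm (1 - u) (\<lambda>\<mu>. ennreal (norm (P j (l + 2 ^ j * \<mu>)) * max 1 (rat j (l + 2 ^ j * \<mu>)) powr (- 0)))
          = lnorm (1 - u) (\<lambda>\<mu>. ennreal (norm (P j (l + 2 ^ j * \<mu>))))"
      proof -
        have "max 1 (rat j k) \<noteq> 0" for k by (simp add: max_def)
        then show ?thesis by simp
      qed
      also have "\<dots> \<le> amalgam_norm (conj_exp q) j (\<psi> j)"
      proof (cases "conj_exp q = \<infinity>")
        case True
        then have "1 - u = 0" using q' recip_bounds(3) by metis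
        then show ?thesis using True
          by (auto simp: amalgam_norm_def lnorm_0 P_def intro!: SUP_least SUP_upper)
      next
        case False
        have "lnorm (1 - u) (\<lambda>\<mu>. ennreal (norm (P j (l + 2 ^ j * \<mu>)))) = lq_norm (conj_exp q) (\<lambda>\<mu> :: int. distr_coeff (\<psi> j) (l + 2 ^ j * \<mu>))"
          unfolding P_def q'(2)[symmetric] by (rule lq_norm_eq_lnorm[OF q'(1), symmetric])
        then show ?thesis using False l by (auto simp: amalgam_norm_def intro: SUP_upper2)
      qed
      also have "\<dots> \<le> ennreal C4" unfolding C4(2)[symmetric] by (rule SUP_upper) simp
      finally show ?thesis .
    qed
    \<comment> \<open>The amalgam norm already bounds the residue classes, so no damping is spent;
      what remains to be checked follows from \<gamma> > 0 and the two lower bounds on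
      \<alpha>.\<close>
    moreover have "0 + \<sigma> < min (\<alpha> + \<beta>) \<alpha>" using assms(4-6) by (simp add: \<sigma>_def)
    ultimately show ?thesis using C4(1) by (intro exI[of _ 0] exI[of _ C4]) auto
  qed
  then obtain \<kappa> C4 where \<kappa>\<sigma>: "0 \<le> \<kappa>" "\<kappa> + \<sigma> < min (\<alpha> + \<beta>) \<alpha>" "0 \<le> C4" and P_le: "\<And>j l. l \<in> freqs j \<Longrightarrow>
      lnorm (1 - u) (\<lambda>\<mu>. ennreal (norm (P j (l + 2 ^ j * \<mu>)) * max 1 (rat j (l + 2 ^ j * \<mu>)) powr (- \<kappa>))) \<le> ennreal C4"
    by blast
  interpret quasi_coeffs F P u \<kappa> s "\<bar>C\<^sub>2\<bar>" "\<bar>C\<^sub>3\<bar>" C4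
  proof unfold_locales
    show "norm (F j l) \<le> \<bar>C\<^sub>2\<bar>" for j l
      using assms(11) by (auto simp: F_def intro: order_trans[OF _ abs_ge_self])
    show "norm (1 - F j l * P j l) \<le> \<bar>C\<^sub>3\<bar> * \<bar>real_of_int l / 2 ^ j\<bar> powr s" if "l \<in> freqs j" for j l
    proof -
      have "norm (1 - F j l * P j l) \<le> C\<^sub>3 * \<bar>real_of_int l / 2 ^ j\<bar> powr s"
        using assms(12) that s by (simp add: F_def P_def rpow_def)
      also have "\<dots> \<le> \<bar>C\<^sub>3\<bar> * \<bar>real_of_int l / 2 ^ j\<bar> powr s" by (intro mult_right_mono) auto
      finally show ?thesis .
    qed
  qed (use u \<kappa>\<sigma> s P_le in auto)
  show ?thesis
    unfolding \<sigma>_def[symmetric]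
    by (rule sparse_grid_error_le[OF F_def P_def assms(1,2) u_def \<sigma>(2) _ assms(4,7) _ _ \<kappa>\<sigma>(2) assms(9)])
       (use \<sigma> assms(5,6) in \<open>auto simp: \<sigma>_def\<close>)
qed

theorem theorem5p3:
  fixes p q :: ennreal
    and \<alpha> \<beta> \<gamma> T N s C\<^sub>1 C\<^sub>2 C\<^sub>3 :: real
    and \<phi> :: "nat \<Rightarrow> real \<Rightarrow> complex"
    and \<psi> :: "nat \<Rightarrow> (real \<Rightarrow> complex) \<Rightarrow> complex"
  assumes "1 \<le> p" and "1 \<le> q"
    and "\<gamma> > 0"
    and "\<gamma> - \<beta> + sigma_pq p q < \<alpha>"
    and "\<gamma> + sigma_pq p q \<le> \<alpha>"
    and "T < 1"
    and "\<forall>j. periodic_distribution (\<psi> j)"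
    and "\<forall>j. \<phi> j \<in> trig_polys j"
    and "N \<ge> 0"
    and "s > max (\<alpha> + \<beta>) \<alpha>"
    and "\<forall>j. \<forall>l :: int. norm (distr_coeff (\<psi> j) l) \<le> C\<^sub>1 * (1 + rpow \<bar>of_int l / 2 ^ j\<bar> N)"
    and "\<forall>j. \<forall>l :: int. norm (fourier_coeff (\<phi> j) (of_int l)) \<le> C\<^sub>2"
    and "\<forall>j. \<forall>l\<in>freqs j.
           norm (1 - fourier_coeff (\<phi> j) (of_int l) * distr_coeff (\<psi> j) l)
             \<le> C\<^sub>3 * rpow \<bar>of_int l / 2 ^ j\<bar> s"
    and "min (\<alpha> + \<beta>) \<alpha> > N + recip (conj_exp p) \<or>
         N = 0 \<and> (SUP j. amalgam_norm (conj_exp q) j (\<psi> j)) < \<infinity>"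
  shows "\<exists>C\<ge>0. \<forall>f \<in> (wiener_space p \<alpha> \<beta> :: (real ^ 'd \<Rightarrow> complex) set). \<forall>n\<ge>1.
           mixed_wiener_norm q \<gamma> (\<lambda>x. f x - sparse_grid_op \<phi> \<psi> n T f x)
             \<le> ennreal (C * Omega_mix CARD('d) \<alpha> \<beta> \<gamma> (sigma_pq p q) T n) * wiener_norm p \<alpha> \<beta> f"
proof (cases "recip p \<le> recip q")
  case True
  show ?thesis
    by (rule sparse_grid_error_le_of_recip_le[OF assms(1,2) True assms(3-6,9-13)]) (use assms(14) in auto)
next
  case False
  then have qp: "recip q \<le> recip p" by simp
  have \<sigma>: "sigma_pq p q = 0" "sigma_pq p p = 0" "sigma_pq q q = 0" using qp by (auto simp: sigma_pq_def)
  have a: "\<gamma> - \<beta> + sigma_pq p p < \<alpha>" "\<gamma> + sigma_pq p p \<le> \<alpha>" "\<gamma> - \<beta> + sigma_pq q q < \<alpha>" "\<gamma> + sigma_pq q q \<le> \<alpha>"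
    using assms(4,5) by (auto simp: \<sigma>)
  from assms(14) show ?thesis
  proof (elim disjE conjE)
    assume i: "min (\<alpha> + \<beta>) \<alpha> > N + recip (conj_exp p)"
    obtain C where C: "0 \<le> C" "\<And>f n. f \<in> (wiener_space p \<alpha> \<beta> :: (real ^ 'd \<Rightarrow> complex) set) \<Longrightarrow> 1 \<le> n \<Longrightarrow>
        mixed_wiener_norm p \<gamma> (\<lambda>x. f x - sparse_grid_op \<phi> \<psi> n T f x)
          \<le> ennreal (C * Omega_mix CARD('d) \<alpha> \<beta> \<gamma> (sigma_pq p p) T n) * wiener_norm p \<alpha> \<beta> f"
      using sparse_grid_error_le_of_recip_le[where 'd = 'd, OF assms(1,1) order_refl assms(3) a(1,2) assms(6,9-13) disjI1[OF i]] by blast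
    \<comment> \<open>The target norm for q is dominated by the one for p, and alternative (i)
      involves p only.\<close>
    have "mixed_wiener_norm q \<gamma> h \<le> mixed_wiener_norm p \<gamma> h" for h :: "real ^ 'd \<Rightarrow> complex"
      unfolding mixed_wiener_norm_def by (rule wiener_norm_antimono[OF assms(1,2) qp])
    then show ?thesis using C unfolding \<sigma> by (intro exI[of _ C]) (auto intro: order_trans)
  next
    assume ii: "(SUP j. amalgam_norm (conj_exp q) j (\<psi> j)) < \<infinity>"
    obtain C where C: "0 \<le> C" "\<And>f n. f \<in> (wiener_space q \<alpha> \<beta> :: (real ^ 'd \<Rightarrow> complex) set) \<Longrightarrow> 1 \<le> n \<Longrightarrow>
        mixed_wiener_norm q \<gamma> (\<lambda>x. f x - sparse_grid_op \<phi> \<psi> n T f x)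
          \<le> ennreal (C * Omega_mix CARD('d) \<alpha> \<beta> \<gamma> (sigma_pq q q) T n) * wiener_norm q \<alpha> \<beta> f"
      using sparse_grid_error_le_of_recip_le[where 'd = 'd, OF assms(2,2) order_refl assms(3) a(3,4) assms(6,9-13) disjI2[OF ii]] by blast
    \<comment> \<open>The source norm for q is dominated by the one for p, and alternative (ii)
      involves q only.\<close>
    have le: "wiener_norm q \<alpha> \<beta> f \<le> wiener_norm p \<alpha> \<beta> f" for f :: "real ^ 'd \<Rightarrow> complex"
      by (rule wiener_norm_antimono[OF assms(1,2) qp])
    have sub: "f \<in> wiener_space q \<alpha> \<beta>" if "f \<in> wiener_space p \<alpha> \<beta>" for f :: "real ^ 'd \<Rightarrow> complex"
      using that le[of f] by (auto simp: wiener_space_def)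
    show ?thesis
    proof (intro exI[of _ C] conjI ballI allI impI C(1))
      fix f :: "real ^ 'd \<Rightarrow> complex" and n :: nat assume "f \<in> wiener_space p \<alpha> \<beta>" "1 \<le> n"
      then have "mixed_wiener_norm q \<gamma> (\<lambda>x. f x - sparse_grid_op \<phi> \<psi> n T f x)
          \<le> ennreal (C * Omega_mix CARD('d) \<alpha> \<beta> \<gamma> (sigma_pq q q) T n) * wiener_norm q \<alpha> \<beta> f"
        by (intro C(2) sub)
      also have "\<dots> \<le> ennreal (C * Omega_mix CARD('d) \<alpha> \<beta> \<gamma> (sigma_pq q q) T n) * wiener_norm p \<alpha> \<beta> f"
        by (intro mult_left_mono le) auto
      finally show "mixed_wiener_norm q \<gamma> (\<lambda>x. f x - sparse_grid_op \<phi> \<psi> n T f x)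
          \<le> ennreal (C * Omega_mix CARD('d) \<alpha> \<beta> \<gamma> (sigma_pq p q) T n) * wiener_norm p \<alpha> \<beta> f"
        by (simp only: \<sigma>)
    qed
  qed
qed

end
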